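(* For every integer $k\ge 1$, $\tau(P_k)\ge \log_{\sqrt5+5}(k)-1$, where $P_k$ is the path of length $k$ (with $k+1$ vertices and $k$ edges).
   Context: Graphs are simple. For a finite graph $G$ and $\theta:E(G)\to\mathbb{R}$, let $\Delta_\theta(F)=|V(F)|-\sum_{e\in E(F)}\theta(e)$ for subgraphs $F\subseteq G$ (subgraphs have no isolated vertices). A threshold weighting for $G$ is $\theta:E(G)\to[0,2]$ with $\Delta_\theta(F)\ge 0$ for all $F\subseteq G$ and $\Delta_\theta(G)=0$. For a vertex set $S$, $F\ominus S$ is the union of the connected components of $F$ that are vertex-disjoint from $S$. Join-trees: a join-tree over $G$ is a finite rooted binary tree (each non-leaf node has two ordered children) whose leaves are labeled by elements of $E(G)\cup\{\bot\}$; its graph $\langle A\rangle$ is the subgraph of $G$ whose edges are the edge labels occurring in $A$; $V(A)=V(\langle A\rangle)$. $[B,C]$ denotes the join-tree whose root has children $B,C$; one-node join-trees are atomic. Pathsets (fix $\theta$ and a positive integer $n$): for finite $U$, a relation is a subset of $[n]^U$, with density $\mu(\mathcal A)=|\mathcal A|/n^{|U|}$ ($[n]^\emptyset$ has one element). For $x\in[n]^V$, $x_U$ is its restriction to $U\subseteq V$. Join: $\mathcal B\bowtie\mathcal C=\{z\in[n]^{V\cup W}: z_V\in\mathcal B,\ z_W\in\mathcal C\}$ for $\mathcal B\subseteq[n]^V,\mathcal C\subseteq[n]^W$. Restriction: for $\mathcal A\subseteq[n]^V$ and $z\in[n]^T$, $\rho_{V\setminus T}(\mathcal A,z)=\{x\in[n]^{V\setminus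 T}:\exists y\in\mathcal A,\ y_{V\setminus T}=x,\ y_{V\cap T}=z_{V\cap T}\}$. For $F\subseteq G$ and $S\subseteq V(G)$, $\mathcal A\subseteq[n]^{V(F)\setminus S}$ is an $F|S$-pathset if $\mu(\rho_{V(F)\setminus T}(\mathcal A,z))\le n^{-\Delta_\theta(F\ominus T)}$ for all $T$ with $S\subseteq T\subseteq V(G)$ and all $z\in[n]^T$. Pathset complexity $\chi_{\theta,n,A|S}(\mathcal A)$ for $\mathcal A\subseteq[n]^{V(A)\setminus S}$: if $A$ is atomic, the minimum number of $\langle A\rangle|S$-pathsets whose union contains $\mathcal A$; if $A=[B,C]$, the minimum of $\sum_{i=1}^m\max\{\chi_{\theta,n,B|S}(\mathcal B_i),\chi_{\theta,n,C|S}(\mathcal C_i)\}$ over finite families $(\mathcal A_i,\mathcal B_i,\mathcal C_i)_{i\le m}$ of $\langle A\rangle|S$-, $\langle B\rangle|S$-, $\langle C\rangle|S$-pathsets with $\mathcal A_i\subseteq\mathcal B_i\bowtie\mathcal C_i$ and $\mathcal A\subseteq\bigcup_i\mathcal A_i$. The invariant $\tau(G)$ of a finite graph $G$: the largest real $t\ge0$ for which there is a threshold weighting $\theta$ for $G$ such that $\chi_{\theta,n,A|\emptyset}(\mathcal A)\ge n^{t}\mu(\mathcal A)$ for every join-tree $A$ over $G$ with $\langle A\rangle=G$, every positive integer $n$ and every $\mathcal A\subseteq[n]^{V(G)}$. *)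

theory Defs
  imports Complex_Main "HOL-Library.FuncSet"
begin

(* Undirected simple graphs: an edge is a two-element set of vertices. *)

record 'a ugraph =
  verts :: "'a set"
  edges :: "'a set set"

definition fin_simple_graph :: "'a ugraph \<Rightarrow> bool" where
  "fin_simple_graph G \<longleftrightarrow>
     finite (verts G) \<and> (\<forall>e\<in>edges G. e \<subseteq> verts G \<and> card e = 2)"

(* Subgraphs have no isolated vertices, so the vertex set is determined by the edges. *)
definition subgraph :: "'a ugraph \<Rightarrow> 'a ugraph \<Rightarrow> bool" where
  "subgraph F G \<longleftrightarrow>
     verts F \<subseteq> verts G \<and> edges F \<subseteq> edges G \<and> verts F = \<Union>(edges F)"

definition path_graph :: "nat \<Rightarrow> nat ugraph" where
  "path_graph k = \<lparr>verts = {0..k}, edges = {{i, Suc i} |i. i < k}\<rparr>"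

lemma fin_simple_graph_path_graph: "fin_simple_graph (path_graph k)"
  by (auto simp: fin_simple_graph_def path_graph_def)

definition adj :: "'a ugraph \<Rightarrow> ('a \<times> 'a) set" where
  "adj F = {(u, v). {u, v} \<in> edges F}"

definition component :: "'a ugraph \<Rightarrow> 'a \<Rightarrow> 'a ugraph" where
  "component F v =
     (let C = {w \<in> verts F. (v, w) \<in> (adj F)\<^sup>*}
      in \<lparr>verts = C, edges = {e \<in> edges F. e \<subseteq> C}\<rparr>)"

definition components :: "'a ugraph \<Rightarrow> 'a ugraph set" where
  "components F = component F ` verts F"

definition ominus :: "'a ugraph \<Rightarrow> 'a set \<Rightarrow> 'a ugraph" where
  "ominus F S =
     (let K = {C \<in> components F. verts C \<inter> S = {}}
      in \<lparr>verts = \<Union>(verts ` K), edges = \<Union>(edges ` K)\<rparr>)"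

definition Delta :: "('a set \<Rightarrow> real) \<Rightarrow> 'a ugraph \<Rightarrow> real" where
  "Delta \<theta> F = real (card (verts F)) - (\<Sum>e\<in>edges F. \<theta> e)"

(* Only the values of \<theta> on the edges of G matter, here and below. *)
definition threshold_weighting :: "'a ugraph \<Rightarrow> ('a set \<Rightarrow> real) \<Rightarrow> bool" where
  "threshold_weighting G \<theta> \<longleftrightarrow>
     (\<forall>e\<in>edges G. 0 \<le> \<theta> e \<and> \<theta> e \<le> 2) \<and>
     (\<forall>F. subgraph F G \<longrightarrow> Delta \<theta> F \<ge> 0) \<and>
     Delta \<theta> G = 0"

(* Leaf None is the leaf labelled with bottom. *)
datatype (labels: 'e) join_tree =
    Leaf "'e option"
  | Node "'e join_tree" "'e join_tree"

definition join_tree_over :: "'a ugraph \<Rightarrow> 'a set join_tree \<Rightarrow> bool" where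
  "join_tree_over G A \<longleftrightarrow> labels A \<subseteq> edges G"

definition tree_graph :: "'a set join_tree \<Rightarrow> 'a ugraph" where
  "tree_graph A = \<lparr>verts = \<Union>(labels A), edges = labels A\<rparr>"

(* [n]^U as the set of functions U -> {1..n} that are undefined outside U;
   restriction of tuples is the library function restrict. *)
abbreviation tuples :: "nat \<Rightarrow> 'a set \<Rightarrow> ('a \<Rightarrow> nat) set" where
  "tuples n U \<equiv> U \<rightarrow>\<^sub>E {1..n}"

definition rel_density :: "nat \<Rightarrow> 'a set \<Rightarrow> ('a \<Rightarrow> nat) set \<Rightarrow> real" where
  "rel_density n U R = real (card R) / real n ^ card U"

definition rel_join ::
    "nat \<Rightarrow> 'a set \<Rightarrow> 'a set \<Rightarrow> ('a \<Rightarrow> nat) set \<Rightarrow> ('a \<Rightarrow> nat) set \<Rightarrow> ('a \<Rightarrow> nat) set" where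
  "rel_join n V W B C = {z \<in> tuples n (V \<union> W). restrict z V \<in> B \<and> restrict z W \<in> C}"

(* rel_restr n V T R z is rho_{V - T}(R, z), for R a subset of [n]^V and z in [n]^T. *)
definition rel_restr ::
    "nat \<Rightarrow> 'a set \<Rightarrow> 'a set \<Rightarrow> ('a \<Rightarrow> nat) set \<Rightarrow> ('a \<Rightarrow> nat) \<Rightarrow> ('a \<Rightarrow> nat) set" where
  "rel_restr n V T R z =
     {x \<in> tuples n (V - T).
        \<exists>y\<in>R. restrict y (V - T) = x \<and> restrict y (V \<inter> T) = restrict z (V \<inter> T)}"

(* R is an F|S-pathset.  Since S \<subseteq> T, (verts F - S) - T = verts F - T. *)
definition pathset ::
    "'a ugraph \<Rightarrow> ('a set \<Rightarrow> real) \<Rightarrow> nat \<Rightarrow> 'a ugraph \<Rightarrow> 'a set \<Rightarrow> ('a \<Rightarrow> nat) set \<Rightarrow> bool" where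
  "pathset G \<theta> n F S R \<longleftrightarrow>
     R \<subseteq> tuples n (verts F - S) \<and>
     (\<forall>T. S \<subseteq> T \<and> T \<subseteq> verts G \<longrightarrow>
        (\<forall>z\<in>tuples n T.
           rel_density n (verts F - T) (rel_restr n (verts F - S) T R z)
             \<le> real n powr (- Delta \<theta> (ominus F T))))"

(* Pathset complexity.  Both minima exist when n > 0 and \<theta> is nonnegative on the edges
   of G, because every relation consisting of a single tuple is then a pathset. *)
primrec chi ::
    "'a ugraph \<Rightarrow> ('a set \<Rightarrow> real) \<Rightarrow> nat \<Rightarrow> 'a set \<Rightarrow> 'a set join_tree \<Rightarrow> ('a \<Rightarrow> nat) set \<Rightarrow> nat"
where
  "chi G \<theta> n S (Leaf l) R =
     (LEAST c. \<exists>P. finite P \<and> c = card P \<and>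
        (\<forall>Q\<in>P. pathset G \<theta> n (tree_graph (Leaf l)) S Q) \<and>
        R \<subseteq> \<Union>P)"
| "chi G \<theta> n S (Node B C) R =
     (LEAST c. \<exists>(m::nat) As Bs Cs.
        c = (\<Sum>i<m. max (chi G \<theta> n S B (Bs i)) (chi G \<theta> n S C (Cs i))) \<and>
        (\<forall>i<m. pathset G \<theta> n (tree_graph (Node B C)) S (As i) \<and>
               pathset G \<theta> n (tree_graph B) S (Bs i) \<and>
               pathset G \<theta> n (tree_graph C) S (Cs i) \<and>
               As i \<subseteq> rel_join n (verts (tree_graph B) - S) (verts (tree_graph C) - S)
                          (Bs i) (Cs i)) \<and>
        R \<subseteq> (\<Union>i<m. As i))"

(* The largest such t, taken as a supremum: it is not evident that the choice of \<theta>
   allows the supremum to be attained. *)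
definition tau :: "'a ugraph \<Rightarrow> real" where
  "tau G = Sup {t. 0 \<le> t \<and> (\<exists>\<theta>. threshold_weighting G \<theta> \<and>
     (\<forall>A n R. join_tree_over G A \<and> tree_graph A = G \<and> 0 < n \<and> R \<subseteq> tuples n (verts G) \<longrightarrow>
        real (chi G \<theta> n {} A R) \<ge> real n powr t * rel_density n (verts G) R))}"

end

(*
  With weight 2 on the first edge and 1 on the others, Delta of F (-) T is the number of components
  of F avoiding T and the vertex 0. For a fixed n, call c a lower bound for a join-tree A and a
  vertex set S if the complexity of every relation R is at least n^c times its density. Writing
  N(F|T) for the number of components above, three rules produce lower bounds for A = [B,C]:
    c + N(C | S u V(B))   if c is a lower bound for (B, S),
    c + N(C | S)          if c is a lower bound for (B, S u V(C)),
    (c + d + N(A | S u V(D) u V(C)) + N(A|S)) / 2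
                          if c is one for (D, S), D a subtree of B, and d is one for (C, S u V(D)).
  Let b = 5 + sqrt 5. By induction on A, if A|S has a component with l edges avoiding S, then
  log_b(l) + N(A|S) - 1 is a lower bound; if S may touch the component at one end or at both ends,
  l is replaced by l / (3 sqrt 5 - 5) or l / (6 sqrt 5 - 10), and the component itself is not
  counted. In the induction step B and C split the component into runs and gaps; if the first two
  rules do not suffice, then all these are so short that they cannot fill it, unless B and C each
  contain a single long run. In that case one walks down B to a subtree D whose run has between
  (3 - sqrt 5)/2 * l and (sqrt 5 - 1)/2 * l edges and applies the third rule to D and C.
*)

theory Submission imports Defs begin

section \<open>Slices of relations\<close>

text \<open>With weight 1 on every edge each component of a path would have Delta 1. Since the whole
  path must have Delta 0, one extra unit is added; on an end edge it acts as if vertex 0 always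
  belonged to S. The first two rules use the complexity of one child only. When both children carry
  one long run, each of these rules yields just the bound for a shorter run, and such losses would
  accumulate with the depth of the tree. The mean makes up for them: both children contribute, and
  the component itself is counted once more. The constants balance three demands. Let g =
  \<open>touch\<close> / b, the share of l that a run can lose in one step down the tree. On the way
  down a run between (1-g)/2 and (1+g)/2 of l is then met. The third rule wins if the product of
  these shares, (1 - g^2)/4, is at least g, so g^2 + 4g = 1 and g = sqrt 5 - 2. A component touched
  at one end is settled if \<open>touch\<close> * (1 - 3/b) = 1, that is, \<open>touch\<close> = 1 +
  3g = 3 sqrt 5 - 5, whence b = \<open>touch\<close> / g = 5 + sqrt 5.\<close>

definition slice :: "'a set \<Rightarrow> 'a set \<Rightarrow> ('a \<Rightarrow> nat) set \<Rightarrow> ('a \<Rightarrow> nat) \<Rightarrow> ('a \<Rightarrow> nat) set" where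
  "slice U W R z = (\<lambda>y. restrict y U) ` {y \<in> R. \<forall>t\<in>W. y t = z t}"

lemma slice_mono: "R \<subseteq> R' \<Longrightarrow> slice U W R z \<subseteq> slice U W R' z"
  by (auto simp: slice_def)

lemma slice_UN: "slice U W (\<Union>i\<in>I. R i) z = (\<Union>i\<in>I. slice U W (R i) z)"
  unfolding slice_def by blast

lemma restrict_in_tuples: "y \<in> tuples n V \<Longrightarrow> U \<subseteq> V \<Longrightarrow> restrict y U \<in> tuples n U"
  by (auto simp: PiE_iff)

lemma slice_subset_tuples: "R \<subseteq> tuples n V \<Longrightarrow> U \<subseteq> V \<Longrightarrow> slice U W R z \<subseteq> tuples n U"
  unfolding slice_def by (intro image_subsetI restrict_in_tuples) auto

lemma slice_slice_subset:
  assumes "W' \<subseteq> U" "U' \<subseteq> U" "W \<inter> W' = {}"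
  shows "slice U' W' (slice U W R z) z' \<subseteq> slice U' (W \<union> W') R (\<lambda>t. if t \<in> W then z t else z' t)"
proof
  fix x assume "x \<in> slice U' W' (slice U W R z) z'"
  then obtain y where y: "y \<in> R" "\<forall>t\<in>W. y t = z t" "\<forall>t\<in>W'. restrict y U t = z' t"
     "x = restrict (restrict y U) U'"
    by (auto simp: slice_def)
  have "restrict (restrict y U) U' = restrict y U'" using assms by (auto simp: fun_eq_iff)
  moreover have "\<forall>t\<in>W'. y t = z' t" using y(3) assms(1) by (metis restrict_apply' subsetD)
  ultimately show "x \<in> slice U' (W \<union> W') R (\<lambda>t. if t \<in> W then z t else z' t)"
    using y assms unfolding slice_def by (auto intro!: imageI)
qed

text \<open>Restrictions are handled as slices from here on. A slice fixes coordinates by an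
  arbitrary function z and carries no range condition, so iterated restrictions merge into one by
  pasting the fixing functions together.\<close>

lemma rel_restr_eq_slice:
  assumes "R \<subseteq> tuples n V"
  shows "rel_restr n V T R z = slice (V - T) (V \<inter> T) R z"
proof -
  have "restrict y (V \<inter> T) = restrict z (V \<inter> T) \<longleftrightarrow> (\<forall>t\<in>V \<inter> T. y t = z t)" for y
    by (auto simp: fun_eq_iff restrict_def)
  moreover have "restrict y (V - T) \<in> tuples n (V - T)" if "y \<in> R" for y
    using subsetD[OF assms that] by (rule restrict_in_tuples) auto
  moreover have "{x \<in> P. \<exists>y\<in>R. f y = x \<and> q y} = f ` {y \<in> R. q' y}"
    if "\<And>y. q y \<longleftrightarrow> q' y" "\<And>y. y \<in> R \<Longrightarrow> f y \<in> P" for P :: "('a \<Rightarrow> nat) set" and f q q'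
    using that by auto
  ultimately show ?thesis unfolding rel_restr_def slice_def by presburger
qed

lemma finite_tuples: "finite U \<Longrightarrow> finite (tuples n U)"
  by (simp add: finite_PiE)

lemma card_tuples: "finite U \<Longrightarrow> card (tuples n U) = n ^ card U"
  by (simp add: card_PiE)

lemma rel_density_nonneg: "0 \<le> rel_density n U R"
  by (simp add: rel_density_def)

lemma rel_density_mono:
  "R \<subseteq> R' \<Longrightarrow> R' \<subseteq> tuples n U \<Longrightarrow> finite U \<Longrightarrow> rel_density n U R \<le> rel_density n U R'"
  unfolding rel_density_def
  by (intro divide_right_mono of_nat_mono card_mono)
    (simp_all add: finite_subset[OF _ finite_tuples])

lemma rel_density_le_1:
  assumes "R \<subseteq> tuples n U" "finite U" "0 < n"
  shows "rel_density n U R \<le> 1"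
proof -
  have "card R \<le> n ^ card U"
    using card_mono[OF finite_tuples assms(1)] assms(2) card_tuples[OF assms(2)] by metis
  then have "real (card R) \<le> real n ^ card U"
    using of_nat_mono by fastforce
  then show ?thesis using assms(3) by (simp add: rel_density_def)
qed

lemma rel_density_UN:
  assumes "finite I"
  shows "rel_density n U (\<Union>i\<in>I. R i) \<le> (\<Sum>i\<in>I. rel_density n U (R i))"
proof -
  have "real (card (\<Union>i\<in>I. R i)) \<le> (\<Sum>i\<in>I. real (card (R i)))"
    using card_UN_le[OF assms, of R] of_nat_mono by fastforce
  then show ?thesis
    unfolding rel_density_def sum_divide_distrib[symmetric] by (intro divide_right_mono) auto
qed

text \<open>Counting along the fibres of the projection to W; a fibre is no larger than its slice.
  All three composition rules get their density estimates from this.\<close>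

lemma rel_density_fiber:
  assumes fin: "finite U" and n: "0 < n" and R: "R \<subseteq> tuples n U" and W: "W \<subseteq> U"
    and M: "\<And>z. rel_density n (U - W) (slice (U - W) W R z) \<le> M"
  shows "rel_density n U R \<le> rel_density n W ((\<lambda>y. restrict y W) ` R) * M"
proof -
  let ?p = "(\<lambda>y. restrict y W) ` R"
  have finR: "finite R" using finite_subset[OF R] finite_tuples[OF fin] by auto
  have fib: "real (card {y \<in> R. restrict y W = z}) \<le> M * real n ^ card (U - W)" for z
  proof -
    \<comment> \<open>Tuples of one fibre agree on W, so their other coordinates tell them
      apart.\<close>
    have "inj_on (\<lambda>y. restrict y (U - W)) {y \<in> R. restrict y W = z}"
    proof (rule inj_onI)
      fix x y assume x: "x \<in> {y \<in> R. restrict y W = z}" and y: "y \<in> {y \<in> R. restrict y W = z}"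
        and eq: "restrict x (U - W) = restrict y (U - W)"
      have "x \<in> tuples n U" "y \<in> tuples n U" using x y R by auto
      moreover have "x t = y t" if "t \<in> U" for t
      proof (cases "t \<in> W")
        case True
        have "restrict x W = restrict y W" using x y by auto
        with True show ?thesis by (metis restrict_apply')
      next
        case False with that eq show ?thesis by (metis DiffI restrict_apply')
      qed
      ultimately show "x = y" by (meson PiE_ext)
    qed
    then have "card {y \<in> R. restrict y W = z} = card ((\<lambda>y. restrict y (U - W)) ` {y \<in> R. restrict y W = z})"
      by (simp add: card_image)
    also have "\<dots> \<le> card (slice (U - W) W R z)"
      unfolding slice_def
      by (intro card_mono finite_imageI finite_subset[OF _ finR] image_mono) auto
    finally have "real (card {y \<in> R. restrict y W = z}) \<le> card (slice (U - W) W R z)" by simp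
    also have "\<dots> \<le> M * real n ^ card (U - W)"
      using M[of z] n by (simp add: rel_density_def divide_le_eq)
    finally show ?thesis .
  qed
  have "R = (\<Union>z\<in>?p. {y \<in> R. restrict y W = z})" by auto
  then have "card R \<le> (\<Sum>z\<in>?p. card {y \<in> R. restrict y W = z})"
    using card_UN_le[of ?p "\<lambda>z. {y \<in> R. restrict y W = z}"] finR by auto
  then have "real (card R) \<le> (\<Sum>z\<in>?p. real (card {y \<in> R. restrict y W = z}))"
    using of_nat_mono by fastforce
  also have "\<dots> \<le> (\<Sum>z\<in>?p. M * real n ^ card (U - W))"
    by (intro sum_mono fib)
  also have "\<dots> = card ?p * M * real n ^ card (U - W)" by simp
  finally have *: "real (card R) \<le> card ?p * M * real n ^ card (U - W)" .
  have "card U = card W + card (U - W)"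
    using W fin by (metis add.commute card_Diff_subset card_mono diff_add finite_subset)
  then have pw: "real n ^ card U = real n ^ card W * real n ^ card (U - W)"
    by (simp add: power_add)
  have "real (card R) / real n ^ card U \<le> card ?p * M * real n ^ card (U - W) / real n ^ card U"
    using * by (intro divide_right_mono) auto
  also have "\<dots> = card ?p / real n ^ card W * M" using n by (simp add: pw)
  finally show ?thesis by (simp add: rel_density_def)
qed

section \<open>Pathsets and pathset complexity\<close>

lemma tree_graph_simps [simp]:
  "verts (tree_graph A) = \<Union>(labels A)" "edges (tree_graph A) = labels A"
  by (simp_all add: tree_graph_def)

lemma ominus_verts_subset: "verts (ominus F T) \<subseteq> verts F - T"
  by (auto simp: ominus_def components_def component_def Let_def)

lemma ominus_edges_subset: "edges (ominus F T) \<subseteq> edges F"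
  by (auto simp: ominus_def components_def component_def Let_def)

locale pathsets =
  fixes G :: "'a ugraph" and \<theta> :: "'a set \<Rightarrow> real" and n :: nat
  assumes simple: "fin_simple_graph G" and n_pos: "0 < n"
    and theta_nonneg: "\<And>e. e \<in> edges G \<Longrightarrow> 0 \<le> \<theta> e"
begin

lemma finite_verts: "finite (verts G)"
  using simple by (simp add: fin_simple_graph_def)

abbreviation ps where "ps \<equiv> pathset G \<theta> n"
abbreviation ch where "ch \<equiv> chi G \<theta> n"
abbreviation dl where "dl A T \<equiv> Delta \<theta> (ominus (tree_graph A) T)"
abbreviation V where "V A \<equiv> \<Union>(labels A)"

lemma V_subset: "labels A \<subseteq> edges G \<Longrightarrow> V A \<subseteq> verts G"
  using simple by (auto simp: fin_simple_graph_def)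

lemma finite_V: "labels A \<subseteq> edges G \<Longrightarrow> finite (V A)"
  using V_subset finite_verts finite_subset by metis

lemma pathset_subset_tuples: "ps F S R \<Longrightarrow> R \<subseteq> tuples n (verts F - S)"
  by (simp add: pathset_def)

text \<open>The defining inequality speaks of tuples z in [n]^T; here z may be any function, which
  allows pasted functions later.\<close>

lemma pathset_slice:
  assumes R: "ps F S R" and T: "S \<subseteq> T" "T \<subseteq> verts G" and fin: "finite (verts F)"
  shows "rel_density n (verts F - T) (slice (verts F - T) ((verts F - S) \<inter> T) R z)
           \<le> real n powr (- Delta \<theta> (ominus F T))"
proof -
  \<comment> \<open>Values of z outside the range become 1. No tuple of R takes such a value on a
    fixed coordinate, so the slice can only grow.\<close>
  define z' where "z' = (\<lambda>t\<in>T. if z t \<in> {1..n} then z t else 1)"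
  have z': "z' \<in> tuples n T" using n_pos by (auto simp: z'_def)
  have RT: "R \<subseteq> tuples n (verts F - S)" using R by (simp add: pathset_def)
  have d: "verts F - S - T = verts F - T" using T by auto
  have "slice (verts F - T) ((verts F - S) \<inter> T) R z \<subseteq> slice (verts F - T) ((verts F - S) \<inter> T) R z'"
  proof -
    have "\<forall>t\<in>(verts F - S) \<inter> T. y t = z' t"
      if "y \<in> R" "\<forall>t\<in>(verts F - S) \<inter> T. y t = z t" for y
    proof
      fix t assume t: "t \<in> (verts F - S) \<inter> T"
      then have "y t \<in> {1..n}" using PiE_mem[OF subsetD[OF RT that(1)]] by blast
      then show "y t = z' t" using that(2) t by (auto simp: z'_def)
    qed
    then show ?thesis unfolding slice_def by (intro image_mono Collect_mono) blast
  qed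
  then have "rel_density n (verts F - T) (slice (verts F - T) ((verts F - S) \<inter> T) R z)
     \<le> rel_density n (verts F - T) (slice (verts F - T) ((verts F - S) \<inter> T) R z')"
    by (rule rel_density_mono[OF _ slice_subset_tuples[OF RT]]) (use T fin in auto)
  also have "\<dots> = rel_density n (verts F - T) (rel_restr n (verts F - S) T R z')"
    using rel_restr_eq_slice[OF RT] d by simp
  also have "\<dots> \<le> real n powr (- Delta \<theta> (ominus F T))"
    using R T z' by (simp add: pathset_def)
  finally show ?thesis .
qed

lemma pathset_density:
  assumes R: "ps F S R" and S: "S \<subseteq> verts G" and fin: "finite (verts F)"
  shows "rel_density n (verts F - S) R \<le> real n powr (- Delta \<theta> (ominus F S))"
proof -
  have RT: "R \<subseteq> tuples n (verts F - S)" using R by (simp add: pathset_def)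
  have "slice (verts F - S) ((verts F - S) \<inter> S) R (\<lambda>_. 0) = (\<lambda>y. restrict y (verts F - S)) ` R"
  proof -
    have "(verts F - S) \<inter> S = {}" by blast
    then show ?thesis by (simp add: slice_def)
  qed
  also have "\<dots> = R"
  proof -
    have "restrict y (verts F - S) = y" if "y \<in> R" for y
      using PiE_restrict[OF subsetD[OF RT that]] .
    then show ?thesis by (simp cong: image_cong_simp)
  qed
  finally show ?thesis using pathset_slice[OF R subset_refl S fin, of "\<lambda>_. 0"] by simp
qed

text \<open>Fixing T and then a larger T' amounts to fixing T' at once by the pasted function, so
  every inequality required of the restriction is one of those that R satisfies.\<close>

lemma pathset_restrict:
  assumes R: "ps F S R" and T: "S \<subseteq> T" "T \<subseteq> verts G" and fin: "finite (verts F)"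
  shows "ps F T (slice (verts F - T) ((verts F - S) \<inter> T) R z)" (is "ps F T ?R")
proof -
  have RT: "R \<subseteq> tuples n (verts F - S)" using R by (simp add: pathset_def)
  have sub: "?R \<subseteq> tuples n (verts F - T)"
    by (rule slice_subset_tuples[OF RT]) (use T in auto)
  have "rel_density n (verts F - T') (rel_restr n (verts F - T) T' ?R z')
      \<le> real n powr - Delta \<theta> (ominus F T')" if T': "T \<subseteq> T'" "T' \<subseteq> verts G" for T' z'
  proof -
    have e: "verts F - T - T' = verts F - T'" using T' by auto
    have e2: "(verts F - S) \<inter> T \<union> (verts F - T) \<inter> T' = (verts F - S) \<inter> T'"
      using T T' by auto
    have "rel_restr n (verts F - T) T' ?R z' = slice (verts F - T') ((verts F - T) \<inter> T') ?R z'"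
      using rel_restr_eq_slice[OF sub] e by simp
    also have "\<dots> \<subseteq> slice (verts F - T') ((verts F - S) \<inter> T') R
         (\<lambda>t. if t \<in> (verts F - S) \<inter> T then z t else z' t)"
      unfolding e2[symmetric] by (rule slice_slice_subset) (use T' in auto)
    finally have "rel_density n (verts F - T') (rel_restr n (verts F - T) T' ?R z')
       \<le> rel_density n (verts F - T') (slice (verts F - T') ((verts F - S) \<inter> T') R
         (\<lambda>t. if t \<in> (verts F - S) \<inter> T then z t else z' t))"
      by (rule rel_density_mono[OF _ slice_subset_tuples[OF RT]]) (use T T' fin in auto)
    also have "\<dots> \<le> real n powr - Delta \<theta> (ominus F T')"
      by (rule pathset_slice[OF R]) (use T T' fin in auto)
    finally show ?thesis .
  qed
  with sub show ?thesis by (simp add: pathset_def)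
qed

text \<open>A restriction of one tuple has density at most 1 / n^|V(F) - T|, and Delta is at most
  the number of vertices counted because the weights are nonnegative. These pathsets make the minima
  in the complexity exist.\<close>

lemma pathset_singleton:
  assumes x: "x \<in> tuples n (verts F - S)" and fin: "finite (verts F)" and F: "edges F \<subseteq> edges G"
  shows "ps F S {x}"
proof -
  have "rel_density n (verts F - T) (rel_restr n (verts F - S) T {x} z)
      \<le> real n powr - Delta \<theta> (ominus F T)" for T z
  proof -
    have sub: "rel_restr n (verts F - S) T {x} z \<subseteq> {restrict x (verts F - S - T)}"
      unfolding rel_restr_def by blast
    then have "card (rel_restr n (verts F - S) T {x} z) \<le> 1"
      using card_mono[OF _ sub] by simp
    then have "rel_density n (verts F - T) (rel_restr n (verts F - S) T {x} z)
       \<le> 1 / real n ^ card (verts F - T)"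
      unfolding rel_density_def using n_pos by (intro divide_right_mono) auto
    also have "\<dots> = real n powr (- real (card (verts F - T)))"
      using n_pos by (simp add: powr_minus powr_realpow divide_inverse)
    also have "\<dots> \<le> real n powr - Delta \<theta> (ominus F T)"
    proof -
      have "card (verts (ominus F T)) \<le> card (verts F - T)"
        using fin by (intro card_mono ominus_verts_subset) simp
      moreover have "0 \<le> (\<Sum>e\<in>edges (ominus F T). \<theta> e)"
        by (intro sum_nonneg theta_nonneg) (use ominus_edges_subset F in blast)
      ultimately have "Delta \<theta> (ominus F T) \<le> card (verts F - T)"
        by (simp add: Delta_def)
      then show ?thesis using n_pos by (intro powr_mono) auto
    qed
    finally show ?thesis .
  qed
  with x show ?thesis unfolding pathset_def by blast
qed

lemma rel_join_commute: "rel_join n U W B C = rel_join n W U C B"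
  by (auto simp: rel_join_def Un_commute)

lemma tree_graph_commute: "tree_graph (Node B C) = tree_graph (Node C B)"
  by (simp add: tree_graph_def Un_commute)

abbreviation node_family where
  "node_family S B C m As Bs Cs \<equiv>
    (\<forall>i<m. ps (tree_graph (Node B C)) S (As i) \<and>
               ps (tree_graph B) S (Bs i) \<and>
               ps (tree_graph C) S (Cs i) \<and>
               As i \<subseteq> rel_join n (V B - S) (V C - S) (Bs i) (Cs i))"

lemma chi_Node:
  "ch S (Node B C) R = (LEAST c. \<exists>(m::nat) As Bs Cs.
        c = (\<Sum>i<m. max (ch S B (Bs i)) (ch S C (Cs i))) \<and>
        node_family S B C m As Bs Cs \<and> R \<subseteq> (\<Union>i<m. As i))"
  by (simp only: chi.simps tree_graph_simps)

lemma node_family_commute: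
  "node_family S B C m As Bs Cs \<Longrightarrow> node_family S C B m As Cs Bs"
  unfolding tree_graph_commute[of C B]
  using rel_join_commute by (simp only: tree_graph_commute[of B C]) fast

text \<open>The rules single out the left child; this symmetry transfers them to the right
  one.\<close>

lemma chi_Node_commute: "ch S (Node B C) R = ch S (Node C B) R"
proof -
  have "(\<exists>(m::nat) As Bs Cs. c = (\<Sum>i<m. max (ch S C (Bs i)) (ch S B (Cs i))) \<and>
        node_family S C B m As Bs Cs \<and> R \<subseteq> (\<Union>i<m. As i))"
    if ex: "\<exists>(m::nat) As Bs Cs. c = (\<Sum>i<m. max (ch S B (Bs i)) (ch S C (Cs i))) \<and>
        node_family S B C m As Bs Cs \<and> R \<subseteq> (\<Union>i<m. As i)" for c B C
  proof -
    obtain m :: nat and As Bs Cs where "c = (\<Sum>i<m. max (ch S B (Bs i)) (ch S C (Cs i)))"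
        and f: "node_family S B C m As Bs Cs" and r: "R \<subseteq> (\<Union>i<m. As i)"
      using ex by blast
    then have "c = (\<Sum>i<m. max (ch S C (Cs i)) (ch S B (Bs i)))"
      by (simp add: max.commute)
    then show ?thesis
      using node_family_commute[OF f] r by (intro exI[of _ m] exI[of _ As] exI[of _ Cs] exI[of _ Bs]) simp
  qed
  note * = this[of _ B C] this[of _ C B]
  show ?thesis unfolding chi_Node
    by (rule arg_cong[of _ _ Least], rule ext, rule iffI) (erule *(1), erule *(2))
qed

end

primrec subtrees :: "'e join_tree \<Rightarrow> 'e join_tree set" where
  "subtrees (Leaf l) = {Leaf l}"
| "subtrees (Node B C) = insert (Node B C) (subtrees B \<union> subtrees C)"

lemma subtrees_refl [simp]: "A \<in> subtrees A"
  by (cases A) auto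

lemma labels_subtree: "D \<in> subtrees A \<Longrightarrow> labels D \<subseteq> labels A"
  by (induction A) auto

lemma slice_subset_via:
  assumes "\<And>y. y \<in> R \<Longrightarrow> restrict y X \<in> R'" "U \<subseteq> X" "W' \<subseteq> X" "W' \<subseteq> W"
  shows "slice U W R z \<subseteq> slice U W' R' z"
proof
  fix x assume "x \<in> slice U W R z"
  then obtain y where y: "y \<in> R" "\<forall>t\<in>W. y t = z t" "x = restrict y U"
    unfolding slice_def by blast
  have "restrict (restrict y X) U = restrict y U" using assms(2) by (auto simp: fun_eq_iff)
  moreover have "\<forall>t\<in>W'. restrict y X t = z t"
    using y(2) assms(3,4) by (metis restrict_apply' subsetD)
  ultimately show "x \<in> slice U W' R' z"
    unfolding slice_def using assms(1)[OF y(1)] y(3) by (intro image_eqI[of _ _ "restrict y X"]) simp_all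
qed

lemma slice_no_condition: "slice U {} R z = (\<lambda>y. restrict y U) ` R"
  by (simp add: slice_def)

section \<open>Attained minima, and complexity under restriction\<close>

context pathsets
begin

lemma chi_Leaf_le:
  assumes "finite P" "\<forall>Q\<in>P. ps (tree_graph (Leaf l)) S Q" "R \<subseteq> \<Union>P"
  shows "ch S (Leaf l) R \<le> card P"
  unfolding chi.simps by (rule Least_le, intro exI[of _ P] conjI) (use assms in simp_all)

lemma chi_Node_le:
  fixes m :: nat
  assumes "node_family S B C m As Bs Cs" "R \<subseteq> (\<Union>i<m. As i)"
  shows "ch S (Node B C) R \<le> (\<Sum>i<m. max (ch S B (Bs i)) (ch S C (Cs i)))"
  unfolding chi_Node
  by (rule Least_le, rule exI[of _ m], rule exI[of _ As], rule exI[of _ Bs], rule exI[of _ Cs])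
    (use assms in simp)

lemma chi_Leaf_attained:
  assumes "labels (Leaf l) \<subseteq> edges G" "R \<subseteq> tuples n (V (Leaf l) - S)"
  shows "\<exists>P. finite P \<and> ch S (Leaf l) R = card P \<and>
           (\<forall>Q\<in>P. ps (tree_graph (Leaf l)) S Q) \<and> R \<subseteq> \<Union>P"
proof -
  have fin: "finite (V (Leaf l))" using assms finite_V by blast
  then have "finite R" using finite_subset[OF assms(2)] finite_tuples[of "V (Leaf l) - S"] by blast
  moreover have "\<forall>Q\<in>(\<lambda>x. {x}) ` R. ps (tree_graph (Leaf l)) S Q"
    using pathset_singleton[of _ "tree_graph (Leaf l)" S] fin assms by (simp add: subset_iff)
  ultimately have "\<exists>c P. finite P \<and> c = card P \<and>
        (\<forall>Q\<in>P. ps (tree_graph (Leaf l)) S Q) \<and> R \<subseteq> \<Union>P"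
    by (intro exI[of _ "card ((\<lambda>x. {x}) ` R)"] exI[of _ "(\<lambda>x. {x}) ` R"]) simp
  from LeastI_ex[OF this] show ?thesis unfolding chi.simps .
qed

text \<open>The trivial cover at an inner node: each tuple of R is a member of its own, with its two
  projections as relations for the children.\<close>

lemma singleton_family:
  assumes "labels (Node B C) \<subseteq> edges G" "R \<subseteq> tuples n (V (Node B C) - S)"
  shows "\<exists>As b c. node_family S B C (card R) As (\<lambda>i. {b i}) (\<lambda>i. {c i}) \<and> R \<subseteq> (\<Union>i<card R. As i) \<and>
     (\<forall>i<card R. b i \<in> tuples n (V B - S)) \<and> (\<forall>i<card R. c i \<in> tuples n (V C - S))"
proof -
  have fin: "finite (V (Node B C))" using assms finite_V by blast
  then have "finite R" using finite_subset[OF assms(2)] finite_tuples[of "V (Node B C) - S"] by blast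
  then obtain f where f: "bij_betw f {..<card R} R"
    using ex_bij_betw_nat_finite[of R] by (auto simp: atLeast0LessThan)
  define b where "b = (\<lambda>i. restrict (f i) (V B - S))"
  define c where "c = (\<lambda>i. restrict (f i) (V C - S))"
  have fR: "f i \<in> tuples n (V (Node B C) - S)" if "i < card R" for i
    using bij_betwE[OF f] that by (intro subsetD[OF assms(2)]) simp
  have b: "b i \<in> tuples n (V B - S)" if "i < card R" for i
    unfolding b_def by (rule restrict_in_tuples[OF fR[OF that]]) auto
  have c: "c i \<in> tuples n (V C - S)" if "i < card R" for i
    unfolding c_def by (rule restrict_in_tuples[OF fR[OF that]]) auto
  have eq: "V B - S \<union> (V C - S) = V (Node B C) - S" by auto
  have "node_family S B C (card R) (\<lambda>i. {f i}) (\<lambda>i. {b i}) (\<lambda>i. {c i})"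
  proof (intro allI impI conjI)
    fix i assume i: "i < card R"
    show "ps (tree_graph (Node B C)) S {f i}"
      using fR[OF i] fin assms(1) by (intro pathset_singleton) (simp_all del: join_tree.set)
    show "ps (tree_graph B) S {b i}" "ps (tree_graph C) S {c i}"
      using b[OF i] c[OF i] fin assms(1) by (intro pathset_singleton; simp)+
    show "{f i} \<subseteq> rel_join n (V B - S) (V C - S) {b i} {c i}"
      using fR[OF i] unfolding rel_join_def eq b_def c_def by blast
  qed
  moreover have "R \<subseteq> (\<Union>i<card R. {f i})" using f by (auto simp: bij_betw_def)
  ultimately show ?thesis using b c
    by (intro exI[of _ "\<lambda>i. {f i}"] exI[of _ b] exI[of _ c] conjI) simp_all
qed

lemma chi_Node_attained:
  assumes "labels (Node B C) \<subseteq> edges G" "R \<subseteq> tuples n (V (Node B C) - S)"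
  shows "\<exists>(m::nat) As Bs Cs. ch S (Node B C) R = (\<Sum>i<m. max (ch S B (Bs i)) (ch S C (Cs i))) \<and>
        node_family S B C m As Bs Cs \<and> R \<subseteq> (\<Union>i<m. As i)"
proof -
  have "\<exists>c (m::nat) As Bs Cs.
        c = (\<Sum>i<m. max (ch S B (Bs i)) (ch S C (Cs i))) \<and>
        node_family S B C m As Bs Cs \<and> R \<subseteq> (\<Union>i<m. As i)"
  proof -
    obtain As b c where "node_family S B C (card R) As (\<lambda>i. {b i}) (\<lambda>i. {c i})"
        "R \<subseteq> (\<Union>i<card R. As i)"
      using singleton_family[OF assms] by (elim exE conjE) (rule that)
    then show ?thesis
      by - (rule exI, rule exI[of _ "card R"], rule exI[of _ As], rule exI[of _ "\<lambda>i. {b i}"],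
          rule exI[of _ "\<lambda>i. {c i}"], rule conjI, rule refl, rule conjI)
  qed
  from LeastI_ex[OF this] show ?thesis unfolding chi_Node .
qed

lemma chi_le_card:
  assumes "labels A \<subseteq> edges G" "R \<subseteq> tuples n (V A - S)"
  shows "ch S A R \<le> card R"
  using assms
proof (induction A arbitrary: R)
  case (Leaf l)
  have fin: "finite (V (Leaf l))" using Leaf finite_V by blast
  have "finite R" using finite_subset[OF Leaf(2)] finite_tuples[of "V (Leaf l) - S"] fin by blast
  then have "ch S (Leaf l) R \<le> card ((\<lambda>x. {x}) ` R)"
    using pathset_singleton[of _ "tree_graph (Leaf l)" S] fin Leaf
    by (intro chi_Leaf_le) (simp_all add: subset_iff)
  also have "\<dots> \<le> card R" by (rule card_image_le) fact
  finally show ?case .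
next
  case (Node B C)
  obtain As b c where F: "node_family S B C (card R) As (\<lambda>i. {b i}) (\<lambda>i. {c i})"
     "R \<subseteq> (\<Union>i<card R. As i)"
     and bc: "\<forall>i<card R. b i \<in> tuples n (V B - S)" "\<forall>i<card R. c i \<in> tuples n (V C - S)"
    using singleton_family[OF Node.prems] by (elim exE conjE) (rule that)
  have "ch S (Node B C) R \<le> (\<Sum>i<card R. max (ch S B {b i}) (ch S C {c i}))"
    by (rule chi_Node_le[OF F])
  also have "\<dots> \<le> (\<Sum>i<card R. 1)"
  proof (rule sum_mono)
    fix i assume "i \<in> {..<card R}"
    then show "max (ch S B {b i}) (ch S C {c i}) \<le> 1"
      using Node.IH(1)[of "{b i}"] Node.IH(2)[of "{c i}"] Node.prems(1) bc by simp
  qed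
  finally show ?case by simp
qed

text \<open>Slicing all members of an optimal cover gives a cover of the slice with no more members,
  and by induction the costs in the children do not grow either.\<close>

lemma chi_restrict:
  assumes T: "S \<subseteq> T" "T \<subseteq> verts G" and "labels A \<subseteq> edges G" "R \<subseteq> tuples n (V A - S)"
  shows "ch T A (slice (V A - T) ((V A - S) \<inter> T) R z) \<le> ch S A R"
  using assms(3,4)
proof (induction A arbitrary: R)
  case (Leaf l)
  obtain P where P: "finite P" "ch S (Leaf l) R = card P"
      "\<forall>Q\<in>P. ps (tree_graph (Leaf l)) S Q" "R \<subseteq> \<Union>P"
    using chi_Leaf_attained[OF Leaf] by blast
  let ?f = "\<lambda>Q. slice (V (Leaf l) - T) ((V (Leaf l) - S) \<inter> T) Q z"
  have "ch T (Leaf l) (?f R) \<le> card (?f ` P)"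
  proof (rule chi_Leaf_le)
    show "\<forall>Q\<in>?f ` P. ps (tree_graph (Leaf l)) T Q"
      using pathset_restrict[of "tree_graph (Leaf l)" S _ T z] P(3) T finite_V[OF Leaf(1)] by simp
    have "?f R \<subseteq> ?f (\<Union>P)" using P(4) by (rule slice_mono)
    also have "\<dots> = \<Union>(?f ` P)" using slice_UN[of _ _ "\<lambda>Q. Q" P] by simp
    finally show "?f R \<subseteq> \<Union>(?f ` P)" .
  qed (use P in simp)
  also have "\<dots> \<le> card P" by (rule card_image_le) fact
  finally show ?case using P by simp
next
  case (Node B C)
  obtain m :: nat and As Bs Cs where F: "ch S (Node B C) R = (\<Sum>i<m. max (ch S B (Bs i)) (ch S C (Cs i)))"
        "node_family S B C m As Bs Cs" "R \<subseteq> (\<Union>i<m. As i)"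
    using chi_Node_attained[OF Node.prems] by (elim exE conjE) (rule that)
  let ?f = "\<lambda>A R. slice (V A - T) ((V A - S) \<inter> T) R z"
  have lab: "labels B \<subseteq> edges G" "labels C \<subseteq> edges G" using Node.prems by auto
  have eq: "V B - T \<union> (V C - T) = V (Node B C) - T" by auto
  have fam: "node_family T B C m (\<lambda>i. ?f (Node B C) (As i)) (\<lambda>i. ?f B (Bs i)) (\<lambda>i. ?f C (Cs i))"
  proof (intro allI impI conjI)
    fix i assume i: "i < m"
    have psi: "ps (tree_graph (Node B C)) S (As i)" "ps (tree_graph B) S (Bs i)"
        "ps (tree_graph C) S (Cs i)"
      and sub: "As i \<subseteq> rel_join n (V B - S) (V C - S) (Bs i) (Cs i)"
      using F(2) i by blast+
    show "ps (tree_graph (Node B C)) T (?f (Node B C) (As i))"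
      using pathset_restrict[OF psi(1) T, of z] finite_V[OF Node.prems(1)] by simp
    show "ps (tree_graph B) T (?f B (Bs i))"
      using pathset_restrict[OF psi(2) T, of z] finite_V[OF lab(1)] by simp
    show "ps (tree_graph C) T (?f C (Cs i))"
      using pathset_restrict[OF psi(3) T, of z] finite_V[OF lab(2)] by simp
    have AT: "As i \<subseteq> tuples n (V (Node B C) - S)"
      using pathset_subset_tuples[OF psi(1)] by simp
    show "?f (Node B C) (As i) \<subseteq> rel_join n (V B - T) (V C - T) (?f B (Bs i)) (?f C (Cs i))"
    proof
      fix x assume "x \<in> ?f (Node B C) (As i)"
      then obtain y where y: "y \<in> As i" "\<forall>t\<in>(V (Node B C) - S) \<inter> T. y t = z t"
        "x = restrict y (V (Node B C) - T)" unfolding slice_def by blast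
      have yB: "restrict y (V B - S) \<in> Bs i" and yC: "restrict y (V C - S) \<in> Cs i"
        using y(1) sub unfolding rel_join_def by blast+
      \<comment> \<open>Fixing T commutes with projecting to a child; the same argument serves both
        children.\<close>
      have *: "restrict x (V X - T) \<in> ?f X Q"
        if X: "restrict y (V X - S) \<in> Q" "V X \<subseteq> V (Node B C)" for X Q
      proof -
        have "restrict x (V X - T) = restrict (restrict y (V X - S)) (V X - T)"
          unfolding y(3) using X(2) T(1) by (auto simp: fun_eq_iff restrict_def)
        moreover have "\<forall>t\<in>(V X - S) \<inter> T. restrict y (V X - S) t = z t"
        proof
          fix t assume t: "t \<in> (V X - S) \<inter> T"
          then have "t \<in> (V (Node B C) - S) \<inter> T" using X(2) by blast
          then show "restrict y (V X - S) t = z t" using y(2) t by simp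
        qed
        ultimately show ?thesis using X(1) unfolding slice_def
          by (intro image_eqI[of _ _ "restrict y (V X - S)"]) simp_all
      qed
      have "x \<in> tuples n (V (Node B C) - T)"
        unfolding y(3) by (rule restrict_in_tuples[OF subsetD[OF AT y(1)]]) (use T in blast)
      moreover have "restrict x (V B - T) \<in> ?f B (Bs i)" "restrict x (V C - T) \<in> ?f C (Cs i)"
        using *[OF yB] *[OF yC] by simp_all
      ultimately show "x \<in> rel_join n (V B - T) (V C - T) (?f B (Bs i)) (?f C (Cs i))"
        unfolding rel_join_def eq by simp
    qed
  qed
  have "?f (Node B C) R \<subseteq> (\<Union>i<m. ?f (Node B C) (As i))"
    unfolding slice_UN[symmetric] by (rule slice_mono[OF F(3)])
  from chi_Node_le[OF fam this]
  have "ch T (Node B C) (?f (Node B C) R)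
      \<le> (\<Sum>i<m. max (ch T B (?f B (Bs i))) (ch T C (?f C (Cs i))))" .
  also have "\<dots> \<le> (\<Sum>i<m. max (ch S B (Bs i)) (ch S C (Cs i)))"
  proof (rule sum_mono)
    fix i assume i: "i \<in> {..<m}"
    have "Bs i \<subseteq> tuples n (V B - S)" "Cs i \<subseteq> tuples n (V C - S)"
      using F(2) i pathset_subset_tuples[of "tree_graph B" S] pathset_subset_tuples[of "tree_graph C" S]
      by auto
    then show "max (ch T B (?f B (Bs i))) (ch T C (?f C (Cs i))) \<le> max (ch S B (Bs i)) (ch S C (Cs i))"
      using Node.IH(1)[OF lab(1)] Node.IH(2)[OF lab(2)] by (intro max.mono)
  qed
  finally show ?case using F by simp
qed

section \<open>Exponent lower bounds and the rules for composing them\<close>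

definition lower_bound :: "'a set join_tree \<Rightarrow> 'a set \<Rightarrow> real \<Rightarrow> bool" where
  "lower_bound A S c \<longleftrightarrow>
     (\<forall>R\<subseteq>tuples n (V A - S). real n powr c * rel_density n (V A - S) R \<le> ch S A R)"

lemma lower_boundD:
  "lower_bound A S c \<Longrightarrow> R \<subseteq> tuples n (V A - S) \<Longrightarrow>
     real n powr c * rel_density n (V A - S) R \<le> ch S A R"
  by (simp add: lower_bound_def)

lemma lower_bound_mono:
  assumes "lower_bound A S c" "d \<le> c"
  shows "lower_bound A S d"
proof -
  have "real n powr d * rel_density n (V A - S) R \<le> ch S A R" if "R \<subseteq> tuples n (V A - S)" for R
  proof -
    have "real n powr d * rel_density n (V A - S) R \<le> real n powr c * rel_density n (V A - S) R"
      using n_pos assms(2) by (intro mult_right_mono rel_density_nonneg powr_mono) auto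
    with lower_boundD[OF assms(1) that] show ?thesis by linarith
  qed
  then show ?thesis by (simp add: lower_bound_def)
qed

lemma lower_bound_Leaf:
  assumes "labels (Leaf l) \<subseteq> edges G"
  shows "lower_bound (Leaf l) S 0"
proof -
  have "rel_density n (V (Leaf l) - S) R \<le> ch S (Leaf l) R" if R: "R \<subseteq> tuples n (V (Leaf l) - S)" for R
  proof (cases "R = {}")
    case False
    obtain P where P: "finite P" "ch S (Leaf l) R = card P" "R \<subseteq> \<Union>P"
      using chi_Leaf_attained[OF assms R] by (elim exE conjE) (rule that)
    with False have "card P \<ge> 1" by (cases "P = {}") (auto simp: Suc_le_eq card_gt_0_iff)
    moreover have "rel_density n (V (Leaf l) - S) R \<le> 1"
      using R n_pos finite_V[OF assms] by (intro rel_density_le_1) simp_all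
    ultimately show ?thesis using P(2) by simp
  qed (simp add: rel_density_def)
  then show ?thesis using n_pos by (simp add: lower_bound_def)
qed

text \<open>Density is subadditive and the cost of a cover is the sum over its members, so
  inequalities for single triples add up to one for every relation. The gain is that A' is a
  pathset, while R is arbitrary.\<close>

lemma lower_bound_NodeI:
  assumes lab: "labels (Node B C) \<subseteq> edges G"
    and step: "\<And>A' B' C'. ps (tree_graph (Node B C)) S A' \<Longrightarrow> ps (tree_graph B) S B' \<Longrightarrow>
      ps (tree_graph C) S C' \<Longrightarrow> A' \<subseteq> rel_join n (V B - S) (V C - S) B' C' \<Longrightarrow>
      real n powr c * rel_density n (V (Node B C) - S) A' \<le> max (ch S B B') (ch S C C')"
  shows "lower_bound (Node B C) S c"
proof -
  have "real n powr c * rel_density n (V (Node B C) - S) R \<le> ch S (Node B C) R"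
    if R: "R \<subseteq> tuples n (V (Node B C) - S)" for R
  proof -
    obtain m :: nat and As Bs Cs where F: "ch S (Node B C) R = (\<Sum>i<m. max (ch S B (Bs i)) (ch S C (Cs i)))"
        "node_family S B C m As Bs Cs" "R \<subseteq> (\<Union>i<m. As i)"
      using chi_Node_attained[OF lab R] by (elim exE conjE) (rule that)
    have AT: "As i \<subseteq> tuples n (V (Node B C) - S)" if "i < m" for i
      using pathset_subset_tuples[of "tree_graph (Node B C)" S "As i"] F(2) that by simp
    have fin: "finite (V (Node B C) - S)" using finite_V[OF lab] by blast
    have "rel_density n (V (Node B C) - S) R \<le> rel_density n (V (Node B C) - S) (\<Union>i<m. As i)"
      by (rule rel_density_mono[OF F(3) _ fin]) (use AT in blast)
    also have "\<dots> \<le> (\<Sum>i<m. rel_density n (V (Node B C) - S) (As i))"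
      by (rule rel_density_UN) simp
    finally have "real n powr c * rel_density n (V (Node B C) - S) R
       \<le> real n powr c * (\<Sum>i<m. rel_density n (V (Node B C) - S) (As i))"
      by (intro mult_left_mono) auto
    also have "\<dots> = (\<Sum>i<m. real n powr c * rel_density n (V (Node B C) - S) (As i))"
      by (rule sum_distrib_left)
    also have "\<dots> \<le> (\<Sum>i<m. real (max (ch S B (Bs i)) (ch S C (Cs i))))"
      using F(2) by (intro sum_mono step) auto
    also have "\<dots> = ch S (Node B C) R" using F(1) by simp
    finally show ?thesis .
  qed
  then show ?thesis unfolding lower_bound_def by blast
qed

lemma lower_bound_commute: "lower_bound (Node B C) S c \<Longrightarrow> lower_bound (Node C B) S c"
  unfolding lower_bound_def chi_Node_commute[of _ B C] by (simp add: Un_commute)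

text \<open>One level down: in a cover of R, the slices over V(D) are covered by slices of the
  members for B, and each member pays at least its cost in B.\<close>

lemma chi_Node_ge_slice:
  assumes lab: "labels (Node B C) \<subseteq> edges G" and R: "R \<subseteq> tuples n (V (Node B C) - S)"
    and D: "V D \<subseteq> V B" and T: "S \<subseteq> T"
    and step: "\<And>R. R \<subseteq> tuples n (V B - S) \<Longrightarrow>
      real n powr c * rel_density n (V D - T) (slice (V D - T) ((V B - S) \<inter> T) R z) \<le> ch S B R"
  shows "real n powr c * rel_density n (V D - T) (slice (V D - T) ((V (Node B C) - S) \<inter> T) R z)
           \<le> ch S (Node B C) R"
proof -
  obtain m :: nat and As Bs Cs where F: "ch S (Node B C) R = (\<Sum>i<m. max (ch S B (Bs i)) (ch S C (Cs i)))"
      "node_family S B C m As Bs Cs" "R \<subseteq> (\<Union>i<m. As i)"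
    using chi_Node_attained[OF lab R] by (elim exE conjE) (rule that)
  let ?s = "\<lambda>Q. slice (V D - T) ((V B - S) \<inter> T) Q z"
  let ?d = "rel_density n (V D - T)"
  have BT: "Bs i \<subseteq> tuples n (V B - S)" if "i < m" for i
    using pathset_subset_tuples[of "tree_graph B" S "Bs i"] F(2) that by simp
  have fin: "finite (V D - T)" using finite_V[of B] lab finite_subset[OF D] by simp
  have "slice (V D - T) ((V (Node B C) - S) \<inter> T) R z
      \<subseteq> slice (V D - T) ((V (Node B C) - S) \<inter> T) (\<Union>i<m. As i) z"
    by (rule slice_mono[OF F(3)])
  also have "\<dots> = (\<Union>i<m. slice (V D - T) ((V (Node B C) - S) \<inter> T) (As i) z)"
    by (rule slice_UN)
  also have "\<dots> \<subseteq> (\<Union>i<m. ?s (Bs i))"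
  proof (rule UN_mono)
    fix i assume i: "i \<in> {..<m}"
    then have "restrict y (V B - S) \<in> Bs i" if "y \<in> As i" for y
      using F(2) that unfolding rel_join_def by blast
    then show "slice (V D - T) ((V (Node B C) - S) \<inter> T) (As i) z \<subseteq> ?s (Bs i)"
      using D T by (intro slice_subset_via) auto
  qed simp
  finally have "?d (slice (V D - T) ((V (Node B C) - S) \<inter> T) R z) \<le> ?d (\<Union>i<m. ?s (Bs i))"
  proof (rule rel_density_mono[OF _ _ fin])
    show "(\<Union>i<m. ?s (Bs i)) \<subseteq> tuples n (V D - T)"
      using D T by (intro UN_least slice_subset_tuples[OF BT]) auto
  qed
  also have "\<dots> \<le> (\<Sum>i<m. ?d (?s (Bs i)))" by (rule rel_density_UN) simp
  finally have "real n powr c * ?d (slice (V D - T) ((V (Node B C) - S) \<inter> T) R z)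
      \<le> real n powr c * (\<Sum>i<m. ?d (?s (Bs i)))"
    by (intro mult_left_mono) auto
  also have "\<dots> = (\<Sum>i<m. real n powr c * ?d (?s (Bs i)))" by (rule sum_distrib_left)
  also have "\<dots> \<le> (\<Sum>i<m. real (max (ch S B (Bs i)) (ch S C (Cs i))))"
  proof (rule sum_mono)
    fix i assume "i \<in> {..<m}"
    then have "real n powr c * ?d (?s (Bs i)) \<le> ch S B (Bs i)"
      by (intro step BT) simp
    then show "real n powr c * ?d (?s (Bs i)) \<le> real (max (ch S B (Bs i)) (ch S C (Cs i)))"
      by linarith
  qed
  also have "\<dots> = ch S (Node B C) R" using F(1) by simp
  finally show ?thesis .
qed

text \<open>Each node pays at least the maximum over its children, so the descent to D loses
  nothing; at D itself \<open>chi_restrict\<close> and the bound for D with T fixed take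
  over.\<close>

lemma chi_ge_slice:
  assumes "D \<in> subtrees B" and T: "S \<subseteq> T" "T \<subseteq> verts G" and D: "lower_bound D T c"
    and "labels B \<subseteq> edges G" "R \<subseteq> tuples n (V B - S)"
  shows "real n powr c * rel_density n (V D - T) (slice (V D - T) ((V B - S) \<inter> T) R z) \<le> ch S B R"
  using assms(1,5,6)
proof (induction B arbitrary: R)
  have base: "real n powr c * rel_density n (V D - T) (slice (V D - T) ((V D - S) \<inter> T) R z) \<le> ch S D R"
    if "labels D \<subseteq> edges G" "R \<subseteq> tuples n (V D - S)" for R
  proof -
    have "real n powr c * rel_density n (V D - T) (slice (V D - T) ((V D - S) \<inter> T) R z)
       \<le> ch T D (slice (V D - T) ((V D - S) \<inter> T) R z)"
      by (rule lower_boundD[OF D]) (rule slice_subset_tuples[OF that(2)], use T in auto)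
    also have "\<dots> \<le> ch S D R" using chi_restrict[OF T that] by simp
    finally show ?thesis .
  qed
  {
    case (Leaf l) then show ?case using base by simp
  next
    case (Node B C)
    consider "D = Node B C" | "D \<in> subtrees B" | "D \<in> subtrees C" using Node.prems by auto
    then show ?case
    proof cases
      case 1 then show ?thesis using base Node.prems by blast
    next
      case 2
      have "V D \<subseteq> V B" using labels_subtree[OF 2] by auto
      then show ?thesis using Node.prems 2 T
        by (intro chi_Node_ge_slice Node.IH(1)) auto
    next
      case 3
      have "V D \<subseteq> V C" using labels_subtree[OF 3] by auto
      \<comment> \<open>The one-level lemma looks into the left child only, so the children are
        exchanged.\<close>
      then have "real n powr c * rel_density n (V D - T) (slice (V D - T) ((V (Node C B) - S) \<inter> T) R z)
           \<le> ch S (Node C B) R"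
        using Node.prems 3 T by (intro chi_Node_ge_slice Node.IH(2)) (auto simp: Un_commute)
      then show ?thesis by (simp only: chi_Node_commute[of S B C]) (simp add: Un_commute)
    qed
  }
qed

text \<open>The projection of A' to V(B) lies in B'. Once V(B) is fixed, the rest of A' lies in a
  restriction of the pathset C', whose small density is the gain.\<close>

lemma lower_bound_add_sibling:
  assumes B: "lower_bound B S c" and lab: "labels (Node B C) \<subseteq> edges G" and S: "S \<subseteq> verts G"
  shows "lower_bound (Node B C) S (c + dl C (S \<union> V B))"
proof (rule lower_bound_NodeI[OF lab])
  fix A' B' C'
  assume A': "ps (tree_graph (Node B C)) S A'" and B': "ps (tree_graph B) S B'"
    and C': "ps (tree_graph C) S C'" and sub: "A' \<subseteq> rel_join n (V B - S) (V C - S) B' C'"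
  let ?U = "V (Node B C) - S" and ?W = "V B - S" and ?d = "dl C (S \<union> V B)"
  have labC: "labels B \<subseteq> edges G" "labels C \<subseteq> edges G" using lab by auto
  have fin: "finite ?U" "finite (V C)" "finite (V B)" using finite_V lab labC by auto
  have AT: "A' \<subseteq> tuples n ?U" and BT: "B' \<subseteq> tuples n ?W" and CT: "C' \<subseteq> tuples n (V C - S)"
    using pathset_subset_tuples[OF A'] pathset_subset_tuples[OF B'] pathset_subset_tuples[OF C'] by simp_all
  have UW: "?U - ?W = V C - (S \<union> V B)" by auto
  have "rel_density n ?U A' \<le> rel_density n ?W ((\<lambda>y. restrict y ?W) ` A') * real n powr (- ?d)"
  proof (rule rel_density_fiber[OF fin(1) n_pos AT])
    fix z
    have "slice (?U - ?W) ?W A' z \<subseteq> slice (V C - (S \<union> V B)) ((V C - S) \<inter> (S \<union> V B)) C' z"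
      unfolding UW by (rule slice_subset_via[where X = "V C - S"]) (use sub in \<open>auto simp: rel_join_def\<close>)
    then have "rel_density n (?U - ?W) (slice (?U - ?W) ?W A' z)
       \<le> rel_density n (V C - (S \<union> V B)) (slice (V C - (S \<union> V B)) ((V C - S) \<inter> (S \<union> V B)) C' z)"
      unfolding UW
      by (rule rel_density_mono[OF _ slice_subset_tuples[OF CT]]) (use fin in auto)
    also have "\<dots> \<le> real n powr (- ?d)"
      using pathset_slice[OF C', of "S \<union> V B" z] S V_subset[OF labC(1)] fin by simp
    finally show "rel_density n (?U - ?W) (slice (?U - ?W) ?W A' z) \<le> real n powr (- ?d)" .
  qed auto
  also have "\<dots> \<le> rel_density n ?W B' * real n powr (- ?d)"
  proof (rule mult_right_mono)
    have "(\<lambda>y. restrict y ?W) ` A' \<subseteq> B'" using sub unfolding rel_join_def by blast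
    then show "rel_density n ?W ((\<lambda>y. restrict y ?W) ` A') \<le> rel_density n ?W B'"
      by (rule rel_density_mono[OF _ BT]) (use fin in auto)
  qed simp
  finally have "real n powr (c + ?d) * rel_density n ?U A'
      \<le> real n powr (c + ?d) * (rel_density n ?W B' * real n powr (- ?d))"
    by (rule mult_left_mono) simp
  also have "\<dots> = real n powr c * rel_density n ?W B'"
    using n_pos by (simp add: powr_add powr_minus)
  also have "\<dots> \<le> ch S B B'" by (rule lower_boundD[OF B BT])
  also have "\<dots> \<le> max (ch S B B') (ch S C C')" by simp
  finally show "real n powr (c + ?d) * rel_density n ?U A' \<le> real (max (ch S B B') (ch S C C'))" .
qed

text \<open>The opposite order of fixing: the projection to V(C) lies in the pathset C', and each
  fibre over it lies in a slice of B' with V(C) fixed, which is where the bound c applies.\<close>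

lemma lower_bound_given_sibling:
  assumes B: "lower_bound B (S \<union> V C) c" and lab: "labels (Node B C) \<subseteq> edges G" and S: "S \<subseteq> verts G"
  shows "lower_bound (Node B C) S (c + dl C S)"
proof (rule lower_bound_NodeI[OF lab])
  fix A' B' C'
  assume A': "ps (tree_graph (Node B C)) S A'" and B': "ps (tree_graph B) S B'"
    and C': "ps (tree_graph C) S C'" and sub: "A' \<subseteq> rel_join n (V B - S) (V C - S) B' C'"
  let ?U = "V (Node B C) - S" and ?W = "V C - S" and ?d = "dl C S" and ?T = "S \<union> V C"
  have labC: "labels B \<subseteq> edges G" "labels C \<subseteq> edges G" using lab by auto
  have fin: "finite ?U" "finite (V C)" "finite (V B)" using finite_V lab labC by auto
  have T: "S \<subseteq> ?T" "?T \<subseteq> verts G" using S V_subset[OF labC(2)] by auto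
  have AT: "A' \<subseteq> tuples n ?U" and BT: "B' \<subseteq> tuples n (V B - S)" and CT: "C' \<subseteq> tuples n ?W"
    using pathset_subset_tuples[OF A'] pathset_subset_tuples[OF B'] pathset_subset_tuples[OF C'] by simp_all
  have UW: "?U - ?W = V B - ?T" by auto
  let ?M = "ch S B B' * real n powr (- c)"
  have "rel_density n ?U A' \<le> rel_density n ?W ((\<lambda>y. restrict y ?W) ` A') * ?M"
  proof (rule rel_density_fiber[OF fin(1) n_pos AT])
    fix z
    have "slice (?U - ?W) ?W A' z \<subseteq> slice (V B - ?T) ((V B - S) \<inter> ?T) B' z"
      unfolding UW by (rule slice_subset_via[where X = "V B - S"]) (use sub in \<open>auto simp: rel_join_def\<close>)
    then have "rel_density n (?U - ?W) (slice (?U - ?W) ?W A' z)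
       \<le> rel_density n (V B - ?T) (slice (V B - ?T) ((V B - S) \<inter> ?T) B' z)"
      unfolding UW
      by (rule rel_density_mono[OF _ slice_subset_tuples[OF BT]]) (use fin in auto)
    also have "\<dots> = real n powr (- c) * (real n powr c *
          rel_density n (V B - ?T) (slice (V B - ?T) ((V B - S) \<inter> ?T) B' z))"
      using n_pos by (simp add: powr_minus)
    also have "\<dots> \<le> real n powr (- c) * ch S B B'"
      by (intro mult_left_mono chi_ge_slice[OF subtrees_refl T B labC(1) BT]) simp
    finally show "rel_density n (?U - ?W) (slice (?U - ?W) ?W A' z) \<le> ?M" by (simp add: mult.commute)
  qed auto
  also have "\<dots> \<le> real n powr (- ?d) * ?M"
  proof (rule mult_right_mono)
    have "(\<lambda>y. restrict y ?W) ` A' \<subseteq> C'" using sub unfolding rel_join_def by blast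
    then have "rel_density n ?W ((\<lambda>y. restrict y ?W) ` A') \<le> rel_density n ?W C'"
      by (rule rel_density_mono[OF _ CT]) (use fin in auto)
    also have "\<dots> \<le> real n powr (- ?d)" using pathset_density[OF C' S] fin by simp
    finally show "rel_density n ?W ((\<lambda>y. restrict y ?W) ` A') \<le> real n powr (- ?d)" .
  qed simp
  finally have "real n powr (c + ?d) * rel_density n ?U A'
      \<le> real n powr (c + ?d) * (real n powr (- ?d) * ?M)"
    by (rule mult_left_mono) simp
  also have "\<dots> = ch S B B'"
    using n_pos by (simp add: powr_add powr_minus field_simps)
  also have "\<dots> \<le> max (ch S B B') (ch S C C')" by simp
  finally show "real n powr (c + ?d) * rel_density n ?U A' \<le> real (max (ch S B B') (ch S C C'))" .
qed


text \<open>The only rule that uses the complexities of both children: a maximum is at least a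
  geometric mean. The relation being covered is a pathset, so one of the two factors
  \<open>\<mu>\<close> in \<open>\<mu>\<^sup>2\<close> can be bounded by \<open>n\<close> to the power \<open>- dl A S\<close>.\<close>

lemma lower_bound_mean:
  assumes D: "D \<in> subtrees B" and Db: "lower_bound D S c" and Cb: "lower_bound C (S \<union> V D) d"
    and lab: "labels (Node B C) \<subseteq> edges G" and S: "S \<subseteq> verts G"
  shows "lower_bound (Node B C) S
    ((c + d + dl (Node B C) (S \<union> V D \<union> V C) + dl (Node B C) S) / 2)"
proof (rule lower_bound_NodeI[OF lab])
  fix A' B' C'
  assume A': "ps (tree_graph (Node B C)) S A'" and B': "ps (tree_graph B) S B'"
    and C': "ps (tree_graph C) S C'" and sub: "A' \<subseteq> rel_join n (V B - S) (V C - S) B' C'"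
  let ?A = "Node B C" and ?T = "S \<union> V D" and ?T2 = "S \<union> V D \<union> V C"
  let ?U = "V ?A - S" and ?W = "V D - S"
  let ?d2 = "dl ?A ?T2" and ?d1 = "dl ?A S"
  have DB: "V D \<subseteq> V B" using labels_subtree[OF D] by blast
  have labC: "labels B \<subseteq> edges G" "labels C \<subseteq> edges G" using lab by auto
  have fin: "finite ?U" "finite (V C)" "finite (V B)" "finite (V D)"
    using finite_V lab labC finite_subset[OF DB] by auto
  have T: "S \<subseteq> ?T" "?T \<subseteq> verts G" "S \<subseteq> ?T2" "?T2 \<subseteq> verts G"
    using S V_subset[OF labC(1)] V_subset[OF labC(2)] DB by auto
  have AT: "A' \<subseteq> tuples n ?U" and BT: "B' \<subseteq> tuples n (V B - S)" and CT: "C' \<subseteq> tuples n (V C - S)"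
    using pathset_subset_tuples[OF A'] pathset_subset_tuples[OF B'] pathset_subset_tuples[OF C'] by simp_all
  let ?MB = "ch S B B' * real n powr (- c)"
  let ?MC = "ch S C C' * real n powr (- d)"
  \<comment> \<open>Coordinates are fixed in three stages: those of D, those of C, and the rest.
    They are paid for by B' (through D), by C', and by A' being a pathset.\<close>
  have "rel_density n ?U A' \<le> rel_density n ?W ((\<lambda>y. restrict y ?W) ` A') * (?MC * real n powr (- ?d2))"
  proof (rule rel_density_fiber[OF fin(1) n_pos AT])
    fix z
    let ?U1 = "?U - ?W" and ?W2 = "V C - ?T"
    let ?R = "slice ?U1 ?W A' z"
    have RT: "?R \<subseteq> tuples n ?U1" by (rule slice_subset_tuples[OF AT]) auto
    have "rel_density n ?U1 ?R \<le> rel_density n ?W2 ((\<lambda>y. restrict y ?W2) ` ?R) * real n powr (- ?d2)"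
    proof (rule rel_density_fiber[OF _ n_pos RT])
      fix z'
      let ?z = "\<lambda>t. if t \<in> ?W then z t else z' t"
      have U2: "?U1 - ?W2 = V ?A - ?T2" by auto
      have W3: "?W \<union> ?W2 = (V ?A - S) \<inter> ?T2" using DB by auto
      have "slice (?U1 - ?W2) ?W2 ?R z' \<subseteq> slice (?U1 - ?W2) (?W \<union> ?W2) A' ?z"
        by (rule slice_slice_subset) auto
      also have "\<dots> = slice (V ?A - ?T2) ((V ?A - S) \<inter> ?T2) A' ?z"
        unfolding U2 W3 ..
      finally have "rel_density n (?U1 - ?W2) (slice (?U1 - ?W2) ?W2 ?R z')
        \<le> rel_density n (V ?A - ?T2) (slice (V ?A - ?T2) ((V ?A - S) \<inter> ?T2) A' ?z)"
        unfolding U2 by (rule rel_density_mono[OF _ slice_subset_tuples[OF AT]]) (use fin in auto)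
      also have "\<dots> \<le> real n powr (- ?d2)"
        using pathset_slice[OF A' T(3,4), of ?z] fin by simp
      finally show "rel_density n (?U1 - ?W2) (slice (?U1 - ?W2) ?W2 ?R z') \<le> real n powr (- ?d2)" .
    qed (use fin in auto)
    also have "\<dots> \<le> ?MC * real n powr (- ?d2)"
    proof (rule mult_right_mono)
      have "(\<lambda>y. restrict y ?W2) ` ?R = slice ?W2 ?W A' z"
      proof -
        have "restrict (restrict y ?U1) ?W2 = restrict y ?W2" for y :: "'a \<Rightarrow> nat"
          by (auto simp: fun_eq_iff restrict_def)
        then show ?thesis unfolding slice_def image_image by simp
      qed
      also have "\<dots> \<subseteq> slice ?W2 ((V C - S) \<inter> ?T) C' z"
        by (rule slice_subset_via[where X = "V C - S"]) (use sub in \<open>auto simp: rel_join_def\<close>)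
      finally have "rel_density n ?W2 ((\<lambda>y. restrict y ?W2) ` ?R)
          \<le> rel_density n ?W2 (slice ?W2 ((V C - S) \<inter> ?T) C' z)"
        by (rule rel_density_mono[OF _ slice_subset_tuples[OF CT]]) (use fin in auto)
      also have "\<dots> = real n powr (- d) * (real n powr d *
            rel_density n ?W2 (slice ?W2 ((V C - S) \<inter> ?T) C' z))"
        using n_pos by (simp add: powr_minus)
      also have "\<dots> \<le> real n powr (- d) * ch S C C'"
        by (intro mult_left_mono chi_ge_slice[OF subtrees_refl T(1,2) Cb labC(2) CT]) simp
      finally show "rel_density n ?W2 ((\<lambda>y. restrict y ?W2) ` ?R) \<le> ?MC" by (simp add: mult.commute)
    qed simp
    finally show "rel_density n ?U1 ?R \<le> ?MC * real n powr (- ?d2)" .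
  qed (use DB in auto)
  also have "\<dots> \<le> ?MB * (?MC * real n powr (- ?d2))"
  proof (rule mult_right_mono)
    \<comment> \<open>No coordinate is fixed here; the empty condition becomes an intersection with
      S to match \<open>chi_ge_slice\<close> at T = S.\<close>
    have "(\<lambda>y. restrict y ?W) ` A' = slice ?W {} A' (\<lambda>_. 0)" by (simp add: slice_no_condition)
    also have "\<dots> \<subseteq> slice ?W ((V B - S) \<inter> S) B' (\<lambda>_. 0)"
      by (rule slice_subset_via[where X = "V B - S"]) (use sub DB in \<open>auto simp: rel_join_def\<close>)
    finally have "rel_density n ?W ((\<lambda>y. restrict y ?W) ` A')
       \<le> rel_density n ?W (slice ?W ((V B - S) \<inter> S) B' (\<lambda>_. 0))"
      by (rule rel_density_mono[OF _ slice_subset_tuples[OF BT]]) (use fin DB in auto)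
    also have "\<dots> = real n powr (- c) * (real n powr c *
          rel_density n ?W (slice ?W ((V B - S) \<inter> S) B' (\<lambda>_. 0)))"
      using n_pos by (simp add: powr_minus)
    also have "\<dots> \<le> real n powr (- c) * ch S B B'"
      by (intro mult_left_mono chi_ge_slice[OF D subset_refl S Db labC(1) BT]) simp
    finally show "rel_density n ?W ((\<lambda>y. restrict y ?W) ` A') \<le> ?MB" by (simp add: mult.commute)
  qed simp
  finally have mu: "rel_density n ?U A' \<le> ?MB * (?MC * real n powr (- ?d2))" .
  have mu1: "rel_density n ?U A' \<le> real n powr (- ?d1)"
    using pathset_density[OF A' S] fin by simp
  let ?\<mu> = "rel_density n ?U A'"
  define q where "q = (c + d + ?d2 + ?d1) / 2"
  have qq: "q + q = c + d + ?d2 + ?d1" by (simp add: q_def)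
  have "(real n powr q * ?\<mu>)\<^sup>2 = real n powr (q + q) * (?\<mu> * ?\<mu>)"
    unfolding power2_eq_square powr_add by (simp only: ac_simps)
  also have "\<dots> \<le> real n powr (q + q) * ((?MB * (?MC * real n powr (- ?d2))) * real n powr (- ?d1))"
    by (intro mult_left_mono mult_mono mu mu1 rel_density_nonneg) simp_all
  also have "\<dots> = real (ch S B B') * real (ch S C C')"
    unfolding qq using n_pos by (simp add: powr_add powr_minus field_simps)
  also have "\<dots> \<le> (real (max (ch S B B') (ch S C C')))\<^sup>2"
    unfolding power2_eq_square by (intro mult_mono) auto
  finally have "real n powr q * ?\<mu> \<le> real (max (ch S B B') (ch S C C'))"
    by (rule power2_le_imp_le) simp
  then show "real n powr ((c + d + ?d2 + ?d1) / 2) * ?\<mu> \<le> real (max (ch S B B') (ch S C C'))"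
    by (simp only: q_def)
qed

end

section \<open>Runs of consecutive edges\<close>

text \<open>The edge \<open>{i, Suc i}\<close> is coded by i. The first missing edge from i on, read
  as a vertex, is the right end of the run through i; for i outside X it is i itself.\<close>

definition run_end :: "nat set \<Rightarrow> nat \<Rightarrow> nat" where
  "run_end X i = (LEAST j. i \<le> j \<and> j \<notin> X)"

lemma run_end_eqI: "i \<le> j \<Longrightarrow> {i..<j} \<subseteq> X \<Longrightarrow> j \<notin> X \<Longrightarrow> run_end X i = j"
  unfolding run_end_def by (rule Least_equality) (auto simp: subset_iff not_le)

lemma run_end:
  assumes "finite X"
  shows "i \<le> run_end X i" "run_end X i \<notin> X" "{i..<run_end X i} \<subseteq> X"
proof -
  have ex: "\<exists>j. i \<le> j \<and> j \<notin> X"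
  proof (rule ccontr)
    assume "\<nexists>j. i \<le> j \<and> j \<notin> X"
    then have "{i..} \<subseteq> X" by auto
    with assms show False using infinite_Ici[of i] finite_subset by blast
  qed
  show "i \<le> run_end X i" "run_end X i \<notin> X"
    using LeastI_ex[OF ex] by (auto simp: run_end_def)
  show "{i..<run_end X i} \<subseteq> X"
  proof
    fix y assume y: "y \<in> {i..<run_end X i}"
    then have "\<not> (i \<le> y \<and> y \<notin> X)" unfolding run_end_def by (intro not_less_Least) simp
    with y show "y \<in> X" by simp
  qed
qed

lemma run_end_gt: "finite X \<Longrightarrow> i \<in> X \<Longrightarrow> i < run_end X i"
  using run_end[of X i] by (cases "i = run_end X i") auto

definition run_verts :: "nat set \<Rightarrow> nat set" where
  "run_verts X = X \<union> Suc ` X"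

lemma in_run_verts: "x \<in> run_verts X \<longleftrightarrow> x \<in> X \<or> 0 < x \<and> x - 1 \<in> X"
  by (cases x) (auto simp: run_verts_def)

text \<open>A run is coded by its right end vertex. The condition on \<open>s\<close> says that the run avoids
  \<open>S \<union> {0}\<close>: every such vertex to the left of the right end is separated from it by a
  missing edge.\<close>

definition free_runs :: "nat set \<Rightarrow> nat set \<Rightarrow> nat set" where
  "free_runs X S = {b. 0 < b \<and> b - 1 \<in> X \<and> b \<notin> X \<and>
     (\<forall>s\<in>insert 0 S. s \<le> b \<longrightarrow> (\<exists>y\<in>{s..<b}. y \<notin> X))}"

lemma finite_free_runs: "finite X \<Longrightarrow> finite (free_runs X S)"
proof (rule finite_subset)
  show "free_runs X S \<subseteq> Suc ` X"
  proof
    fix b assume "b \<in> free_runs X S"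
    then show "b \<in> Suc ` X" by (intro image_eqI[of _ _ "b - 1"]) (auto simp: free_runs_def)
  qed
qed simp

text \<open>The missing edge that separates a vertex s from the run of A is missing from X too, and
  it lies to the left of all edges of the run, hence of b.\<close>

lemma free_runs_subset:
  assumes b: "0 < b" "b - 1 \<in> X" "b \<notin> X" and XA: "X \<subseteq> A" and fin: "finite A"
    and r: "run_end A (b - 1) \<in> free_runs A S"
  shows "b \<in> free_runs X S"
proof -
  let ?r = "run_end A (b - 1)"
  have bA: "b - 1 \<in> A" using b XA by auto
  have br: "b \<le> ?r" using run_end_gt[OF fin bA] by simp
  have sub: "{b - 1..<?r} \<subseteq> A" using run_end(3)[OF fin] .
  have "\<exists>y\<in>{s..<b}. y \<notin> X" if s: "s \<in> insert 0 S" "s \<le> b" for s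
  proof -
    have "\<exists>y\<in>{s..<?r}. y \<notin> A" using r s br by (auto simp: free_runs_def)
    then obtain y where y: "s \<le> y" "y < ?r" "y \<notin> A" by auto
    then have "y < b - 1" using sub by (metis atLeastLessThan_iff not_le subsetD)
    then show ?thesis using y XA by (intro bexI[of _ y]) auto
  qed
  with b show ?thesis by (auto simp: free_runs_def)
qed

text \<open>Each free run of A not ending at r is charged. If it has an edge of X, the charge goes
  to a free run of X inside it; otherwise it is itself a run of Y that avoids the vertices of X.
  Members of T, Z1 and Z2 belong to the run ending at r and receive no charge, so T comes on top and
  Z1, Z2 can be left out.\<close>

lemma card_free_runs_le:
  assumes fin: "finite A" and XA: "X \<subseteq> A" and YA: "Y \<subseteq> A" and AXY: "A \<subseteq> X \<union> Y"
    and T: "T \<subseteq> free_runs X S - Z1"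
    and r: "\<And>b. b \<in> T \<union> Z1 \<union> Z2 \<Longrightarrow> run_end A (b - 1) = r"
  shows "card (free_runs A S - {r}) + card T
    \<le> card (free_runs X S - Z1) + card (free_runs Y (S \<union> run_verts X) - Z2)"
proof -
  have finXY: "finite X" "finite Y" using fin XA YA finite_subset by auto
  define F1 where "F1 = {q \<in> free_runs A S - {r}. \<exists>i\<in>X. run_end A i = q}"
  define F2 where "F2 = {q \<in> free_runs A S - {r}. \<not> (\<exists>i\<in>X. run_end A i = q)}"
  define XX where "XX = {b \<in> free_runs X S. run_end A (b - 1) \<noteq> r}"
  have finXX: "finite XX" using finite_free_runs[OF finXY(1)] by (simp add: XX_def)
  have "F1 \<subseteq> (\<lambda>b. run_end A (b - 1)) ` XX"
  proof
    fix q assume "q \<in> F1"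
    then obtain i where i: "i \<in> X" "run_end A i = q" and q: "q \<in> free_runs A S" "q \<noteq> r"
      by (auto simp: F1_def)
    let ?b = "run_end X i"
    have b: "i < ?b" "?b \<notin> X" "{i..<?b} \<subseteq> X"
      using run_end_gt[OF finXY(1) i(1)] run_end[OF finXY(1)] by auto
    have b1: "?b - 1 \<in> X" using b by auto
    have "q \<notin> A" using run_end(2)[OF fin] i(2) by auto
    have "?b \<le> q"
    proof (rule ccontr)
      assume "\<not> ?b \<le> q"
      moreover have "i \<le> q" using run_end(1)[OF fin] i(2) by auto
      ultimately have "q \<in> X" using b by auto
      with \<open>q \<notin> A\<close> XA show False by auto
    qed
    then have "run_end A (?b - 1) = q"
      using run_end(3)[OF fin, of i] i(2) b \<open>q \<notin> A\<close> by (intro run_end_eqI) (auto simp: subset_iff)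
    then show "q \<in> (\<lambda>b. run_end A (b - 1)) ` XX"
      using free_runs_subset[OF _ b1 b(2) XA fin, of S] q b(1) by (force simp: XX_def)
  qed
  then have c1: "card F1 \<le> card XX" using surj_card_le[OF finXX] by blast
  have "XX \<inter> T = {}" using r by (auto simp: XX_def)
  moreover have "finite T" using T finite_free_runs[OF finXY(1)] finite_subset by blast
  ultimately have "card XX + card T = card (XX \<union> T)"
    using finXX by (simp add: card_Un_disjoint)
  also have "\<dots> \<le> card (free_runs X S - Z1)"
    using T r finite_free_runs[OF finXY(1)] by (intro card_mono) (auto simp: XX_def)
  finally have c2: "card XX + card T \<le> card (free_runs X S - Z1)" .
  have "F2 \<subseteq> free_runs Y (S \<union> run_verts X) - Z2"
  proof
    fix q assume "q \<in> F2"
    then have q: "q \<in> free_runs A S" "q \<noteq> r" and nX: "\<And>i. i \<in> X \<Longrightarrow> run_end A i \<noteq> q"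
      by (auto simp: F2_def)
    have q1: "0 < q" "q - 1 \<in> A" "q \<notin> A" using q by (auto simp: free_runs_def)
    have "{q - 1..<q} = {q - 1}" using q1 by auto
    then have "run_end A (q - 1) = q" using q1 by (intro run_end_eqI) auto
    then have "q \<notin> Z2" and "q - 1 \<notin> X" using q(2) r nX by auto
    then have "q - 1 \<in> Y" using q1 AXY by auto
    \<comment> \<open>A vertex of X joined to q inside A would put an edge of X into the run ending
      at q.\<close>
    have sep: "\<exists>y\<in>{s..<q}. y \<notin> A" if s: "s \<in> insert 0 (S \<union> run_verts X)" "s \<le> q" for s
    proof (rule ccontr)
      assume no: "\<not> (\<exists>y\<in>{s..<q}. y \<notin> A)"
      then have "s \<in> run_verts X" using s q by (auto simp: free_runs_def)
      then consider "s \<in> X" | "0 < s" "s - 1 \<in> X" by (auto simp: in_run_verts)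
      then show False
      proof cases
        case 1
        then have "run_end A s = q" using no s q1 by (intro run_end_eqI) auto
        with nX 1 show False by auto
      next
        case 2
        have "{s - 1..<q} \<subseteq> insert (s - 1) {s..<q}" by auto
        then have "run_end A (s - 1) = q"
          using no s q1 2 XA by (intro run_end_eqI) auto
        with nX 2 show False by auto
      qed
    qed
    have "\<exists>y\<in>{s..<q}. y \<notin> Y" if "s \<in> insert 0 (S \<union> run_verts X)" "s \<le> q" for s
      using sep[OF that] YA by blast
    then show "q \<in> free_runs Y (S \<union> run_verts X) - Z2"
      using q1 YA \<open>q - 1 \<in> Y\<close> \<open>q \<notin> Z2\<close> unfolding free_runs_def by blast
  qed
  then have c3: "card F2 \<le> card (free_runs Y (S \<union> run_verts X) - Z2)"
    using finite_free_runs[OF finXY(2)] by (intro card_mono) auto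
  have "free_runs A S - {r} = F1 \<union> F2" by (auto simp: F1_def F2_def)
  then have "card (free_runs A S - {r}) \<le> card F1 + card F2"
    using card_Un_le by metis
  with c1 c2 c3 show ?thesis by linarith
qed

section \<open>Covering an interval by runs and gaps\<close>

text \<open>A run of X that the window \<open>{u..<v}\<close> does not cut off; a run reaching u or
  v counts only if the flag on that side is set.\<close>

definition inner_run :: "nat set \<Rightarrow> nat \<Rightarrow> nat \<Rightarrow> bool \<Rightarrow> bool \<Rightarrow> nat \<Rightarrow> nat \<Rightarrow> bool" where
  "inner_run X u v lf rf a b \<longleftrightarrow> u \<le> a \<and> a < b \<and> b \<le> v \<and> {a..<b} \<subseteq> X \<and>
     (if a = u then lf else a - 1 \<notin> X) \<and> (if b = v then rf else b \<notin> X)"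

text \<open>The right ends of inner runs. The last condition makes the run begin properly as well:
  the left flag is set or an edge is missing before b.\<close>

definition inner_ends :: "nat set \<Rightarrow> nat \<Rightarrow> nat \<Rightarrow> bool \<Rightarrow> bool \<Rightarrow> nat set" where
  "inner_ends X u v lf rf = {b. u < b \<and> b \<le> v \<and> b - 1 \<in> X \<and> (if b = v then rf else b \<notin> X) \<and>
     (lf \<or> (\<exists>y\<in>{u..<b}. y \<notin> X))}"

lemma finite_inner_ends [simp]: "finite (inner_ends X u v lf rf)"
  by (rule finite_subset[of _ "{..v}"]) (auto simp: inner_ends_def)

lemma card_mult_mono:
  fixes c :: real
  assumes "A \<subseteq> B" "finite B" "x \<in> B" "x \<notin> A" "0 \<le> c"
  shows "c + card A * c \<le> card B * c"
proof -
  have "card (insert x A) \<le> card B" using assms by (intro card_mono) auto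
  then have "1 + card A \<le> card B" using assms finite_subset[of A B] by simp
  then have "real (1 + card A) * c \<le> card B * c"
    using assms(5) by (intro mult_right_mono) auto
  then show ?thesis by (simp add: algebra_simps)
qed

lemma next_outside:
  fixes u v :: nat
  assumes "u < v"
  obtains e where "u \<le> e" "e \<le> v" "{u..<e} \<subseteq> X" "e = v \<or> e \<notin> X"
proof -
  let ?X = "X \<inter> {..<v}"
  have fin: "finite ?X" by simp
  have "run_end ?X u \<le> v"
  proof (rule ccontr)
    assume "\<not> run_end ?X u \<le> v"
    then have "v \<in> {u..<run_end ?X u}" using assms by simp
    then have "v \<in> ?X" using run_end(3)[OF fin] by blast
    then show False by simp
  qed
  then show ?thesis using run_end[OF fin, of u] by (intro that[of "run_end ?X u"]) auto
qed

lemma previous_outside: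
  fixes u v :: nat
  assumes "u < v"
  obtains a where "u \<le> a" "a \<le> v" "{a..<v} \<subseteq> X" "a = u \<or> a - 1 \<notin> X"
proof -
  define a where "a = (LEAST a. u \<le> a \<and> {a..<v} \<subseteq> X)"
  have ex: "u \<le> v \<and> {v..<v} \<subseteq> X" using assms by auto
  have a: "u \<le> a" "{a..<v} \<subseteq> X" using LeastI[of "\<lambda>a. u \<le> a \<and> {a..<v} \<subseteq> X", OF ex] by (auto simp: a_def)
  have "a \<le> v" unfolding a_def using ex by (rule Least_le)
  moreover have "a - 1 \<notin> X" if "a \<noteq> u"
  proof
    assume "a - 1 \<in> X"
    moreover have "{a - 1..<v} \<subseteq> insert (a - 1) {a..<v}" by auto
    ultimately have "u \<le> a - 1 \<and> {a - 1..<v} \<subseteq> X" using a that by auto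
    then have "a \<le> a - 1" unfolding a_def by (rule Least_le)
    with a that show False by auto
  qed
  ultimately show ?thesis using a that by blast
qed

text \<open>Read from left to right: an inner run and the gap after it are together shorter than
  \<kappa> + \<zeta> and are charged to the right end of the run; a last run cut off at v costs
  \<nu>.\<close>

lemma length_less_left:
  fixes \<kappa> \<nu> \<zeta> :: real
  assumes "u < v" "u \<in> X" and pos: "0 < \<kappa>" "0 < \<zeta>"
    and K: "\<And>a b. inner_run X u v True rf a b \<Longrightarrow> real b - real a < \<kappa>"
    and R: "\<And>a. \<not> rf \<Longrightarrow> u \<le> a \<Longrightarrow> a < v \<Longrightarrow> {a..<v} \<subseteq> X \<Longrightarrow> a = u \<or> a - 1 \<notin> X \<Longrightarrow> real v - real a < \<nu>"
    and Z: "\<And>a b. u \<le> a \<Longrightarrow> a < b \<Longrightarrow> b \<le> v \<Longrightarrow> {a..<b} \<inter> X = {} \<Longrightarrow> real b - real a < \<zeta>"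
    and nu: "\<not> rf \<Longrightarrow> 0 < \<nu>"
  shows "real v - real u < card (inner_ends X u v True rf) * (\<kappa> + \<zeta>) + (if rf then 0 else \<nu>)"
  using assms(1,2) K R Z
proof (induction "v - u" arbitrary: u rule: less_induct)
  case less
  let ?T = "\<lambda>u. inner_ends X u v True rf"
  note K = less.prems(3) and R = less.prems(4) and Z = less.prems(5)
  obtain e where e: "u \<le> e" "e \<le> v" "{u..<e} \<subseteq> X" "e = v \<or> e \<notin> X"
    using next_outside[OF less.prems(1)] .
  have ue: "u < e" using e less.prems(1,2) by (metis order_le_imp_less_or_eq)
  have e1: "e - 1 \<in> X" using e ue by auto
  show ?case
  proof (cases "e = v")
    case True
    show ?thesis
    proof (cases rf)
      case rf: True
      have "v \<in> ?T u" using True ue e1 rf by (auto simp: inner_ends_def)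
      then have "\<kappa> + \<zeta> \<le> card (?T u) * (\<kappa> + \<zeta>)"
        using card_mult_mono[of "{}" "?T u" v "\<kappa> + \<zeta>"] pos by simp
      moreover have "real v - real u < \<kappa>"
        by (rule K) (use True rf less.prems(1) e in \<open>auto simp: inner_run_def\<close>)
      ultimately have "real v - real u < card (?T u) * (\<kappa> + \<zeta>)" using pos by linarith
      then show ?thesis using rf by simp
    next
      case False
      then have "real v - real u < \<nu>" using True e less.prems(1) by (intro R) auto
      moreover have "0 \<le> card (?T u) * (\<kappa> + \<zeta>)" using pos by simp
      ultimately show ?thesis using False by simp
    qed
  next
    case False
    then have ev: "e < v" "e \<notin> X" using e by auto
    have eT: "e \<in> ?T u" using ev ue e1 by (auto simp: inner_ends_def)
    have k: "real e - real u < \<kappa>" by (rule K) (use ev ue e in \<open>auto simp: inner_run_def\<close>)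
    obtain m where m: "e \<le> m" "m \<le> v" "{e..<m} \<subseteq> - X" "m = v \<or> m \<notin> - X"
      using next_outside[OF ev(1)] .
    have em: "e < m" using m ev by (metis ComplI order_le_imp_less_or_eq)
    have z: "real m - real e < \<zeta>" by (rule Z) (use m em ue in auto)
    show ?thesis
    proof (cases "m = v")
      case True
      have "\<kappa> + \<zeta> \<le> card (?T u) * (\<kappa> + \<zeta>)"
        using card_mult_mono[of "{}" "?T u" e "\<kappa> + \<zeta>"] pos eT by simp
      with k z True nu show ?thesis by auto
    next
      case False
      then have mv: "m < v" "m \<in> X" using m by auto
      have "m - 1 \<in> {e..<m}" using em by auto
      then have m1: "m - 1 \<notin> X" using m(3) by blast
      \<comment> \<open>The edge before m is missing, so the remaining window again starts with a
        proper run and keeps the left flag true.\<close>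
      have "real v - real m < card (?T m) * (\<kappa> + \<zeta>) + (if rf then 0 else \<nu>)"
      proof (rule less.hyps)
        show "real b - real a < \<kappa>" if "inner_run X m v True rf a b" for a b
          by (rule K) (use that em ue m1 in \<open>auto simp: inner_run_def split: if_splits\<close>)
        show "real v - real a < \<nu>" if "\<not> rf" "m \<le> a" "a < v" "{a..<v} \<subseteq> X" "a = m \<or> a - 1 \<notin> X" for a
          by (rule R) (use that em ue m1 in auto)
        show "real b - real a < \<zeta>" if "m \<le> a" "a < b" "b \<le> v" "{a..<b} \<inter> X = {}" for a b
          by (rule Z) (use that em ue in auto)
      qed (use mv em ue in auto)
      moreover have "(\<kappa> + \<zeta>) + card (?T m) * (\<kappa> + \<zeta>) \<le> card (?T u) * (\<kappa> + \<zeta>)"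
        by (rule card_mult_mono[of _ _ e]) (use pos eT em ue in \<open>auto simp: inner_ends_def\<close>)
      ultimately show ?thesis using k z by linarith
    qed
  qed
qed

text \<open>The mirror image: a run is charged together with the gap before it, and now the run at u
  may be cut off.\<close>

lemma length_less_right:
  fixes \<kappa> \<nu> \<zeta> :: real
  assumes "u < v" "v - 1 \<in> X" and pos: "0 < \<kappa>" "0 < \<zeta>"
    and K: "\<And>a b. inner_run X u v lf True a b \<Longrightarrow> real b - real a < \<kappa>"
    and L: "\<And>b. \<not> lf \<Longrightarrow> u < b \<Longrightarrow> b \<le> v \<Longrightarrow> {u..<b} \<subseteq> X \<Longrightarrow> b = v \<or> b \<notin> X \<Longrightarrow> real b - real u < \<nu>"
    and Z: "\<And>a b. u \<le> a \<Longrightarrow> a < b \<Longrightarrow> b \<le> v \<Longrightarrow> {a..<b} \<inter> X = {} \<Longrightarrow> real b - real a < \<zeta>"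
    and nu: "\<not> lf \<Longrightarrow> 0 < \<nu>"
  shows "real v - real u < card (inner_ends X u v lf True) * (\<kappa> + \<zeta>) + (if lf then 0 else \<nu>)"
  using assms(1,2) K L Z
proof (induction v rule: less_induct)
  case (less v)
  let ?T = "\<lambda>v. inner_ends X u v lf True"
  note K = less.prems(3) and L = less.prems(4) and Z = less.prems(5)
  obtain a where a: "u \<le> a" "a \<le> v" "{a..<v} \<subseteq> X" "a = u \<or> a - 1 \<notin> X"
    using previous_outside[OF less.prems(1)] .
  have av: "a < v" using a less.prems(1,2) by (metis order_le_imp_less_or_eq)
  show ?case
  proof (cases "a = u")
    case True
    show ?thesis
    proof (cases lf)
      case lf: True
      have "v \<in> ?T v" using lf less.prems(1,2) by (auto simp: inner_ends_def)
      then have "\<kappa> + \<zeta> \<le> card (?T v) * (\<kappa> + \<zeta>)"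
        using card_mult_mono[of "{}" "?T v" v "\<kappa> + \<zeta>"] pos by simp
      moreover have "real v - real u < \<kappa>"
        by (rule K) (use True lf less.prems(1) a in \<open>auto simp: inner_run_def\<close>)
      ultimately have "real v - real u < card (?T v) * (\<kappa> + \<zeta>)" using pos by linarith
      then show ?thesis using lf by simp
    next
      case False
      then have "real v - real u < \<nu>" using True a less.prems(1) by (intro L) auto
      moreover have "0 \<le> card (?T v) * (\<kappa> + \<zeta>)" using pos by simp
      ultimately show ?thesis using False by simp
    qed
  next
    case False
    then have ua: "u < a" "a - 1 \<notin> X" using a by auto
    have vT: "v \<in> ?T v" using ua av less.prems(1,2)
      by (auto simp: inner_ends_def intro!: bexI[of _ "a - 1"])
    have k: "real v - real a < \<kappa>" by (rule K) (use ua av a in \<open>auto simp: inner_run_def\<close>)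
    obtain m where m: "u \<le> m" "m \<le> a" "{m..<a} \<subseteq> - X" "m = u \<or> m - 1 \<notin> - X"
      using previous_outside[OF ua(1)] .
    have ma: "m < a" using m ua by (cases "m = a") auto
    have z: "real a - real m < \<zeta>" by (rule Z) (use m ma av in auto)
    show ?thesis
    proof (cases "m = u")
      case True
      have "\<kappa> + \<zeta> \<le> card (?T v) * (\<kappa> + \<zeta>)"
        using card_mult_mono[of "{}" "?T v" v "\<kappa> + \<zeta>"] pos vT by simp
      with k z True nu show ?thesis by auto
    next
      case False
      then have um: "u < m" "m - 1 \<in> X" using m by auto
      have m1: "m \<notin> X" using m ma by auto
      have "real m - real u < card (?T m) * (\<kappa> + \<zeta>) + (if lf then 0 else \<nu>)"
      proof (rule less.IH)
        show "real b - real a < \<kappa>" if "inner_run X u m lf True a b" for a b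
          by (rule K) (use that ma av m1 in \<open>auto simp: inner_run_def split: if_splits\<close>)
        show "real b - real u < \<nu>" if "\<not> lf" "u < b" "b \<le> m" "{u..<b} \<subseteq> X" "b = m \<or> b \<notin> X" for b
          by (rule L) (use that ma av m1 in auto)
        show "real b - real a < \<zeta>" if "u \<le> a" "a < b" "b \<le> m" "{a..<b} \<inter> X = {}" for a b
          by (rule Z) (use that ma av in auto)
      qed (use um ma av in auto)
      moreover have "(\<kappa> + \<zeta>) + card (?T m) * (\<kappa> + \<zeta>) \<le> card (?T v) * (\<kappa> + \<zeta>)"
        by (rule card_mult_mono[of _ _ v]) (use pos vT ma av m1 in \<open>auto simp: inner_ends_def split: if_splits\<close>)
      ultimately show ?thesis using k z by linarith
    qed
  qed
qed

text \<open>A run cut off at u costs \<nu> and the gap after it \<zeta>; from the next run on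
  \<open>length_less_left\<close> applies, with another \<nu> for a run cut off at v. The last
  hypothesis excludes a run cut off at both ends.\<close>

lemma length_less:
  fixes \<kappa> \<nu> \<zeta> :: real
  assumes uv: "u < v" and pos: "0 < \<kappa>" "0 < \<zeta>" "0 < \<nu>"
    and K: "\<And>a b. inner_run X u v lf rf a b \<Longrightarrow> real b - real a < \<kappa>"
    and L: "\<And>b. \<not> lf \<Longrightarrow> u < b \<Longrightarrow> b < v \<Longrightarrow> {u..<b} \<subseteq> X \<Longrightarrow> b \<notin> X \<Longrightarrow> real b - real u < \<nu>"
    and R: "\<And>a. \<not> rf \<Longrightarrow> u < a \<Longrightarrow> a < v \<Longrightarrow> {a..<v} \<subseteq> X \<Longrightarrow> a - 1 \<notin> X \<Longrightarrow> real v - real a < \<nu>"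
    and Z: "\<And>a b. u \<le> a \<Longrightarrow> a < b \<Longrightarrow> b \<le> v \<Longrightarrow> {a..<b} \<inter> X = {} \<Longrightarrow> real b - real a < \<zeta>"
    and not: "\<not> {u..<v} \<subseteq> X"
  shows "real v - real u < card (inner_ends X u v lf rf) * (\<kappa> + \<zeta>) + \<zeta> + 2 * \<nu>"
proof -
  let ?T = "inner_ends X u v lf rf"
  have after: "real v - real m < card ?T * (\<kappa> + \<zeta>) + \<nu>"
    if m: "u \<le> m" "m < v" "m \<in> X" "m = u \<and> lf \<or> u < m \<and> m - 1 \<notin> X" for m
  proof -
    have "real v - real m < card (inner_ends X m v True rf) * (\<kappa> + \<zeta>) + (if rf then 0 else \<nu>)"
    proof (rule length_less_left[OF m(2,3) pos(1,2)])
      show "real b - real a < \<kappa>" if "inner_run X m v True rf a b" for a b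
        by (rule K) (use that m in \<open>auto simp: inner_run_def split: if_splits\<close>)
      show "real v - real a < \<nu>" if "\<not> rf" "m \<le> a" "a < v" "{a..<v} \<subseteq> X" "a = m \<or> a - 1 \<notin> X" for a
      proof (rule R)
        show "u < a" using that m not by (cases "a = u") auto
        show "a - 1 \<notin> X" using that m \<open>u < a\<close> by auto
      qed (use that in auto)
      show "real b - real a < \<zeta>" if "m \<le> a" "a < b" "b \<le> v" "{a..<b} \<inter> X = {}" for a b
        by (rule Z) (use that m in auto)
    qed (use pos in auto)
    moreover have "inner_ends X m v True rf \<subseteq> ?T"
    proof
      fix b assume b: "b \<in> inner_ends X m v True rf"
      have "lf \<or> (\<exists>y\<in>{u..<b}. y \<notin> X)"
      proof (cases "m = u \<and> lf")
        case False
        then have "m - 1 \<in> {u..<b}" "m - 1 \<notin> X" using m b by (auto simp: inner_ends_def)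
        then show ?thesis by blast
      qed simp
      then show "b \<in> ?T" using b m by (auto simp: inner_ends_def split: if_splits)
    qed
    then have "card (inner_ends X m v True rf) \<le> card ?T" by (intro card_mono) auto
    then have "card (inner_ends X m v True rf) * (\<kappa> + \<zeta>) \<le> card ?T * (\<kappa> + \<zeta>)"
      using pos by (intro mult_right_mono) auto
    moreover have "(if rf then 0 else \<nu>) \<le> \<nu>" using pos by simp
    ultimately show ?thesis by linarith
  qed
  have gap: "real v - real e < card ?T * (\<kappa> + \<zeta>) + \<zeta> + \<nu>"
    if e: "u \<le> e" "e < v" "e \<notin> X" for e
  proof -
    obtain m where m: "e \<le> m" "m \<le> v" "{e..<m} \<subseteq> - X" "m = v \<or> m \<notin> - X"
      using next_outside[OF e(2)] .
    have em: "e < m" using m e by (metis ComplI order_le_imp_less_or_eq)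
    have z: "real m - real e < \<zeta>" by (rule Z) (use m em e in auto)
    show ?thesis
    proof (cases "m = v")
      case True
      have "0 \<le> card ?T * (\<kappa> + \<zeta>)" using pos by simp
      moreover have "real m = real v" using True by simp
      ultimately show ?thesis using z pos by linarith
    next
      case False
      then have "real v - real m < card ?T * (\<kappa> + \<zeta>) + \<nu>"
      proof (intro after)
        have "m - 1 \<in> {e..<m}" using em by auto
        then have "m - 1 \<notin> X" using m(3) by blast
        then show "m = u \<and> lf \<or> u < m \<and> m - 1 \<notin> X" using em e by simp
      qed (use m False em e in auto)
      with z show ?thesis by simp
    qed
  qed
  obtain e where e: "u \<le> e" "e \<le> v" "{u..<e} \<subseteq> X" "e = v \<or> e \<notin> X"
    using next_outside[OF uv] .
  have "e < v" "e \<notin> X" using e not by (metis order_le_imp_less_or_eq)+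
  show ?thesis
  proof (cases "lf \<or> u = e")
    case True
    then consider "u = e" | "lf" "u < e" using e by fastforce
    then show ?thesis
    proof cases
      case 1
      then show ?thesis using gap[of u] uv \<open>e \<notin> X\<close> pos by simp
    next
      case 2
      then show ?thesis using after[of u] uv e pos by fastforce
    qed
  next
    case False
    then have "real e - real u < \<nu>" using L[of e] e \<open>e < v\<close> \<open>e \<notin> X\<close> by auto
    with gap[OF e(1) \<open>e < v\<close> \<open>e \<notin> X\<close>] show ?thesis by simp
  qed
qed

section \<open>Constants\<close>

text \<open>\<open>omega\<close> is the inverse of \<open>5 + sqrt 5\<close>, and \<open>touch\<close> is the factor lost by a component touched
  at one end. The identity \<open>touch * (1 - 3 * omega) = 1\<close> makes the estimate
  \<open>budget_one_side\<close> tight, and \<open>touch * omega = sqrt 5 - 2\<close> is what \<open>descend\<close> needs.\<close>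

definition omega :: real where "omega = (5 - sqrt 5) / 20"
definition touch :: real where "touch = 3 * sqrt 5 - 5"

lemma sqrt5_bounds: "2.236 < sqrt (5::real)" "sqrt (5::real) < 2.2361"
  by (rule real_less_rsqrt, simp add: power2_eq_square)
    (rule real_less_lsqrt, simp_all add: power2_eq_square)

lemma omega_bounds: "0 < omega" "omega < 0.1382" and touch_gt_1: "1 < touch"
  using sqrt5_bounds by (auto simp: omega_def touch_def)

lemma omega_inverse: "(sqrt 5 + 5) * omega = 1"
  by (simp add: omega_def algebra_simps)

lemma touch_omega: "touch * omega = sqrt 5 - 2"
  by (simp add: omega_def touch_def field_simps)

lemma touch_inverse: "touch * (1 - 3 * omega) = 1"
  by (simp add: omega_def touch_def field_simps)

lemma inverse_touch: "1 / touch = 1 - 3 * omega"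
  using touch_inverse touch_gt_1 by (subst nonzero_divide_eq_eq) (simp_all add: mult.commute)

text \<open>As \<open>omega\<close> is the inverse of the base, each of the t units in the exponent
  costs a factor \<open>omega\<close> in length.\<close>

lemma less_omega_power:
  assumes "0 < x" "0 < L" and less: "log (sqrt 5 + 5) x + real t < log (sqrt 5 + 5) L"
  shows "x < L * omega ^ t"
proof -
  have b: "1 < sqrt 5 + (5::real)" using sqrt5_bounds by simp
  have "x * (sqrt 5 + 5) ^ t < L"
  proof -
    have "log (sqrt 5 + 5) (x * (sqrt 5 + 5) ^ t) = log (sqrt 5 + 5) x + real t"
      using assms(1) b by (simp add: log_mult log_nat_power)
    with less have "log (sqrt 5 + 5) (x * (sqrt 5 + 5) ^ t) < log (sqrt 5 + 5) L" by simp
    moreover have "0 < x * (sqrt 5 + 5) ^ t" using assms(1) b by simp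
    ultimately show ?thesis using log_less_cancel_iff[OF b] assms(2) by blast
  qed
  then have "x * (sqrt 5 + 5) ^ t * omega ^ t < L * omega ^ t"
    using omega_bounds by (intro mult_strict_right_mono) auto
  then show ?thesis using omega_inverse by (simp add: mult.assoc power_mult_distrib[symmetric])
qed

text \<open>A further run multiplies the permitted lengths by \<open>omega\<close> < 1/2, which
  outweighs the growth in the number of runs.\<close>

lemma Suc_mult_omega_power: "real (Suc m) * omega ^ m \<le> 1"
proof (induction m)
  case (Suc m)
  have "real (Suc (Suc m)) * omega \<le> real (Suc (Suc m)) * (1 / 2)"
    using omega_bounds by (intro mult_left_mono) auto
  also have "\<dots> \<le> real (Suc m)" by simp
  finally have "real (Suc (Suc m)) * omega * omega ^ m \<le> real (Suc m) * omega ^ m"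
    using omega_bounds by (intro mult_right_mono) auto
  with Suc show ?case by (simp add: mult.assoc)
qed simp

text \<open>In the three estimates, \<open>t\<close> is the number of runs of a child inside a window, \<open>omega ^ (t - 1)\<close>
  goes with the length of such a run, \<open>2 * touch * omega ^ t\<close> with a gap between runs, and
  \<open>touch * omega ^ t\<close> with a run cut off by an end of the window.\<close>

lemma budget_one_side:
  assumes t: "1 \<le> t" and l: "0 < l"
  shows "real t * (l / touch * omega ^ (t - 1) + 2 * touch * (l / touch) * omega ^ t)
    + touch * (l / touch) * omega ^ t \<le> l"
proof -
  obtain m where m: "t = Suc m" using t by (cases t) auto
  \<comment> \<open>After x is replaced by p, the coefficients 1 - 3 * \<open>omega\<close>, 2 *
    \<open>omega\<close> and \<open>omega\<close> add up to 1; at t = 1 everything is an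
    equality.\<close>
  define x p where "x = omega ^ m" and "p = real (Suc m) * x"
  have x: "0 \<le> x" using omega_bounds by (simp add: x_def)
  have xp: "x \<le> p" using mult_right_mono[of 1 "real (Suc m)" x] x by (simp add: p_def)
  have p: "p \<le> 1" using Suc_mult_omega_power by (simp add: p_def x_def)
  have L: "l / touch = l * (1 - 3 * omega)"
    by (simp flip: inverse_touch)
  have e: "2 * touch * (l / touch) = 2 * l" "touch * (l / touch) = l" using touch_gt_1 by simp_all
  have "real t * (l / touch * omega ^ (t - 1) + 2 * touch * (l / touch) * omega ^ t)
    + touch * (l / touch) * omega ^ t
    = l * (p * (1 - 3 * omega) + 2 * p * omega + x * omega)"
    unfolding e by (simp only: L) (simp add: m p_def x_def algebra_simps)
  also have "\<dots> \<le> l * (p * (1 - 3 * omega) + 2 * p * omega + p * omega)"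
    using l xp omega_bounds by (intro mult_left_mono add_left_mono mult_right_mono) auto
  also have "\<dots> = l * p" by (simp add: algebra_simps)
  also have "\<dots> \<le> l" using l p by simp
  finally show ?thesis .
qed

lemma budget_two_sides:
  assumes t: "1 \<le> t" and l: "0 < l"
  shows "real t * (l / (2 * touch) * omega ^ (t - 1) + 2 * touch * (l / (2 * touch)) * omega ^ t)
    + 2 * touch * (l / (2 * touch)) * omega ^ t + 2 * (touch * (l / (2 * touch)) * omega ^ t) \<le> l"
proof -
  obtain m where m: "t = Suc m" using t by (cases t) auto
  define x p where "x = omega ^ m" and "p = real (Suc m) * x"
  have x: "0 \<le> x" using omega_bounds by (simp add: x_def)
  have xp: "x \<le> p" using mult_right_mono[of 1 "real (Suc m)" x] x by (simp add: p_def)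
  have p: "p \<le> 1" using Suc_mult_omega_power by (simp add: p_def x_def)
  have L: "l / (2 * touch) = l * (1 - 3 * omega) / 2"
    by (simp flip: inverse_touch)
  have e: "2 * touch * (l / (2 * touch)) = l" "touch * (l / (2 * touch)) = l / 2"
    using touch_gt_1 by simp_all
  have "real t * (l / (2 * touch) * omega ^ (t - 1) + 2 * touch * (l / (2 * touch)) * omega ^ t)
    + 2 * touch * (l / (2 * touch)) * omega ^ t + 2 * (touch * (l / (2 * touch)) * omega ^ t)
    = l * (p * ((1 - 3 * omega) / 2) + p * omega + 2 * x * omega)"
    unfolding e by (simp only: L) (simp add: m p_def x_def field_simps)
  \<comment> \<open>Here the coefficients add up to (1 + 3 * \<open>omega\<close>) / 2, about 0.71,
    so this estimate has slack.\<close>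
  also have "\<dots> \<le> l * (p * ((1 - 3 * omega) / 2) + p * omega + 2 * p * omega)"
    using l xp omega_bounds by (intro mult_left_mono add_left_mono mult_right_mono) auto
  also have "\<dots> = l * (p * ((1 + 3 * omega) / 2))" by (simp add: field_simps)
  also have "\<dots> \<le> l * 1"
  proof (intro mult_left_mono)
    have "p * ((1 + 3 * omega) / 2) \<le> 1 * 1" using p omega_bounds by (intro mult_mono) auto
    then show "p * ((1 + 3 * omega) / 2) \<le> 1" by simp
  qed (use l in simp)
  finally show ?thesis by simp
qed

lemma budget_two_runs:
  assumes t: "2 \<le> t" and L: "0 < L"
  shows "real t * (L * omega ^ (t - 1) + 2 * touch * L * omega ^ t)
    + 2 * touch * L * omega ^ t + 2 * (touch * L * omega ^ t) \<le> 3 / 5 * L"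
proof -
  define m where "m = t - 2"
  have m: "t = Suc (Suc m)" using t by (simp add: m_def)
  define x p where "x = omega ^ Suc m" and "p = real t * x"
  have x: "0 \<le> x" using omega_bounds by (simp add: x_def)
  have xp: "2 * x \<le> p" using mult_right_mono[of 2 "real t" x] x t by (simp add: p_def)
  have "p = real (Suc (Suc m)) * omega ^ m * omega" by (simp add: p_def x_def m)
  also have "\<dots> \<le> 2 * omega"
  proof (intro mult_right_mono)
    have "real (Suc (Suc m)) * omega ^ m \<le> (2 * real (Suc m)) * omega ^ m"
      using omega_bounds by (intro mult_right_mono) auto
    also have "\<dots> \<le> 2" using Suc_mult_omega_power[of m] by (simp only: mult.assoc)
    finally show "real (Suc (Suc m)) * omega ^ m \<le> 2" .
  qed (use omega_bounds in simp)
  finally have p: "p \<le> 2 * omega" .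
  have g: "touch * omega \<le> 0.2361" "0 \<le> touch * omega" using sqrt5_bounds touch_omega by auto
  have "real t * (L * omega ^ (t - 1) + 2 * touch * L * omega ^ t)
    + 2 * touch * L * omega ^ t + 2 * (touch * L * omega ^ t)
    = L * (p + 2 * p * (touch * omega) + 2 * (2 * x) * (touch * omega))"
    by (simp add: m p_def x_def algebra_simps)
  also have "\<dots> \<le> L * (p + 2 * p * (touch * omega) + 2 * p * (touch * omega))"
    using L xp g by (intro mult_left_mono add_left_mono mult_right_mono) auto
  also have "\<dots> = L * (p * (1 + 4 * (touch * omega)))" by (simp add: algebra_simps)
  also have "\<dots> \<le> L * (3 / 5)"
  proof (intro mult_left_mono)
    \<comment> \<open>About 0.54. The value 3/5 stays below (sqrt 5 - 1) / 2, the share of L from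
      which \<open>descend\<close> starts.\<close>
    have "p * (1 + 4 * (touch * omega)) \<le> (2 * 0.1382) * (1 + 4 * 0.2361)"
      using p g omega_bounds x by (intro mult_mono) (auto simp: p_def)
    then show "p * (1 + 4 * (touch * omega)) \<le> 3 / 5" by simp
  qed (use L in simp)
  finally show ?thesis by simp
qed

section \<open>Windows\<close>

text \<open>A window is a stretch of consecutive edges whose inner vertices avoid \<open>S\<close>; a flag
  says that on this side the window ends where its run ends, at a vertex outside \<open>S \<union> {0}\<close>.\<close>

definition window :: "nat set \<Rightarrow> nat set \<Rightarrow> nat \<Rightarrow> nat \<Rightarrow> bool \<Rightarrow> bool \<Rightarrow> bool" where
  "window X S u v lf rf \<longleftrightarrow> u < v \<and> {u..<v} \<subseteq> X \<and> (\<forall>x. u < x \<and> x < v \<longrightarrow> x \<notin> S) \<and>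
     (lf \<longrightarrow> 0 < u \<and> u \<notin> S \<and> u - 1 \<notin> X) \<and> (rf \<longrightarrow> v \<notin> S \<and> v \<notin> X)"

definition loss :: "bool \<Rightarrow> bool \<Rightarrow> real" where
  "loss lf rf = (if lf \<and> rf then 1 else if lf \<or> rf then touch else 2 * touch)"

lemma loss_pos: "0 < loss lf rf" and loss_le: "loss lf rf \<le> 2 * touch"
  using touch_gt_1 by (auto simp: loss_def)

lemma run_end_window:
  assumes "finite A" "{u..<v} \<subseteq> A" "u \<le> i" "i < v"
  shows "run_end A i = run_end A u"
proof (rule run_end_eqI)
  have "v \<le> run_end A u"
  proof (rule ccontr)
    assume "\<not> v \<le> run_end A u"
    then have "run_end A u \<in> {u..<v}" using run_end(1)[OF assms(1), of u] by simp
    with assms(2) run_end(2)[OF assms(1)] show False by blast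
  qed
  then show "i \<le> run_end A u" using assms(4) by simp
  show "{i..<run_end A u} \<subseteq> A" using run_end(3)[OF assms(1), of u] assms(3) by auto
qed (rule run_end(2)[OF assms(1)])

lemma run_end_run_end:
  assumes "finite A" "X \<subseteq> A" "a \<in> X"
  shows "run_end A (run_end X a - 1) = run_end A a"
proof -
  have fin: "finite X" using assms finite_subset by blast
  have "{a..<run_end X a} \<subseteq> A" using run_end(3)[OF fin] assms(2) by blast
  then show ?thesis
    by (rule run_end_window[OF assms(1)]) (use run_end_gt[OF fin assms(3)] in auto)
qed

text \<open>Inner vertices of a window avoid S, so an inner run could meet \<open>insert 0 S\<close>
  only at u or v, and a run reaching these is inner only where the flag rules this out.\<close>

lemma inner_ends_subset_free_runs:
  assumes W: "window A S u v lf rf" and XA: "X \<subseteq> A"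
  shows "inner_ends X u v lf rf \<subseteq> free_runs X S"
proof
  fix b assume b: "b \<in> inner_ends X u v lf rf"
  then have b': "u < b" "b \<le> v" "b - 1 \<in> X" by (auto simp: inner_ends_def)
  have bX: "b \<notin> X" using b W XA by (auto simp: inner_ends_def window_def split: if_splits)
  have "\<exists>y\<in>{s..<b}. y \<notin> X" if s: "s \<in> insert 0 S" "s \<le> b" for s
  proof (cases "s \<le> u")
    case True
    show ?thesis
    proof (cases lf)
      case lf: True
      then have "s \<noteq> u" using s W by (auto simp: window_def)
      then have "u - 1 \<in> {s..<b}" "u - 1 \<notin> X" using True lf b' W XA by (auto simp: window_def)
      then show ?thesis by blast
    next
      case False
      then show ?thesis using b True by (force simp: inner_ends_def)
    qed
  next
    case False
    then have "s \<in> S" "\<not> s < v" using s W by (auto simp: window_def)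
    then have "s = v" "b = v" using s b' by auto
    then show ?thesis using b W \<open>s \<in> S\<close> by (auto simp: inner_ends_def window_def)
  qed
  then show "b \<in> free_runs X S" using b' bX by (auto simp: free_runs_def)
qed

lemma inner_ends_run_end:
  assumes "finite A" "{u..<v} \<subseteq> A" "b \<in> inner_ends X u v lf rf"
  shows "run_end A (b - 1) = run_end A u"
  by (rule run_end_window[OF assms(1,2)]) (use assms(3) in \<open>auto simp: inner_ends_def\<close>)

lemma run_end_in_inner_ends:
  assumes W: "window A S u v lf True" and XA: "X \<subseteq> A" "finite A"
    and x: "x \<in> X" "u \<le> x" "x < v" and l: "lf \<or> (\<exists>y\<in>{u..<x}. y \<notin> X)"
  shows "run_end X x \<in> inner_ends X u v lf True" "{x..<run_end X x} \<subseteq> X" "x < run_end X x"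
    "run_end X x \<le> v" "run_end X x \<notin> X"
proof -
  have fin: "finite X" using XA finite_subset by blast
  show gt: "x < run_end X x" by (rule run_end_gt[OF fin x(1)])
  show sub: "{x..<run_end X x} \<subseteq> X" and notin: "run_end X x \<notin> X" by (rule run_end[OF fin])+
  show le: "run_end X x \<le> v"
  proof (rule ccontr)
    assume "\<not> run_end X x \<le> v"
    then have "v \<in> {x..<run_end X x}" using x by simp
    with sub XA W show False by (auto simp: window_def)
  qed
  have "run_end X x - 1 \<in> {x..<run_end X x}" using gt by auto
  with sub have "run_end X x - 1 \<in> X" by blast
  moreover have "lf \<or> (\<exists>y\<in>{u..<run_end X x}. y \<notin> X)" using l gt by force
  ultimately show "run_end X x \<in> inner_ends X u v lf True"
    using gt le notin x by (auto simp: inner_ends_def)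
qed

section \<open>Lower bounds for join-trees over a path\<close>

abbreviation (input) base :: real where "base \<equiv> sqrt 5 + 5"

definition edge_set :: "nat set join_tree \<Rightarrow> nat set" where
  "edge_set A = {i. {i, Suc i} \<in> labels A}"

lemma edge_set_Node [simp]: "edge_set (Node B C) = edge_set B \<union> edge_set C"
  by (auto simp: edge_set_def)

text \<open>Isolates the combinatorics: n, the weights and relations are gone, \<open>LB\<close> is
  any predicate obeying these rules, and Delta has become a number of free runs.\<close>

locale path_bounds =
  fixes k :: nat and LB :: "nat set join_tree \<Rightarrow> nat set \<Rightarrow> real \<Rightarrow> bool"
  assumes LB_mono: "\<And>A S c d. LB A S c \<Longrightarrow> d \<le> c \<Longrightarrow> LB A S d"
    and LB_Leaf: "\<And>l S. labels (Leaf l) \<subseteq> edges (path_graph k) \<Longrightarrow> LB (Leaf l) S 0"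
    and LB_commute: "\<And>B C S c. LB (Node B C) S c \<Longrightarrow> LB (Node C B) S c"
    and LB_add_sibling: "\<And>B C S c. LB B S c \<Longrightarrow> labels (Node B C) \<subseteq> edges (path_graph k) \<Longrightarrow>
      S \<subseteq> {..k} \<Longrightarrow> LB (Node B C) S (c + card (free_runs (edge_set C) (S \<union> run_verts (edge_set B))))"
    and LB_given_sibling: "\<And>B C S c. LB B (S \<union> run_verts (edge_set C)) c \<Longrightarrow>
      labels (Node B C) \<subseteq> edges (path_graph k) \<Longrightarrow>
      S \<subseteq> {..k} \<Longrightarrow> LB (Node B C) S (c + card (free_runs (edge_set C) S))"
    and LB_mean: "\<And>B C D S c d. D \<in> subtrees B \<Longrightarrow> LB D S c \<Longrightarrow>
      LB C (S \<union> run_verts (edge_set D)) d \<Longrightarrow> labels (Node B C) \<subseteq> edges (path_graph k) \<Longrightarrow>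
      S \<subseteq> {..k} \<Longrightarrow>
      LB (Node B C) S ((c + d
        + card (free_runs (edge_set (Node B C)) (S \<union> run_verts (edge_set D) \<union> run_verts (edge_set C)))
        + card (free_runs (edge_set (Node B C)) S)) / 2)"
begin

abbreviation over :: "nat set join_tree \<Rightarrow> bool" where
  "over A \<equiv> labels A \<subseteq> edges (path_graph k)"

lemma edge_set_subset: "over A \<Longrightarrow> edge_set A \<subseteq> {..<k}"
proof
  fix x assume "over A" "x \<in> edge_set A"
  then obtain i where "i < k" "{x, Suc x} = {i, Suc i}"
    by (auto simp: edge_set_def path_graph_def)
  then show "x \<in> {..<k}" by (auto simp: doubleton_eq_iff)
qed

lemma finite_edge_set: "over A \<Longrightarrow> finite (edge_set A)"
  using edge_set_subset finite_subset by blast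

lemma run_verts_subset: "over A \<Longrightarrow> run_verts (edge_set A) \<subseteq> {..k}"
  using edge_set_subset[of A] by (auto simp: run_verts_def)

text \<open>The run through the edge u enters the bound by the logarithm of its length, so it is not
  counted here as a full unit.\<close>

definition other_runs :: "nat set join_tree \<Rightarrow> nat set \<Rightarrow> nat \<Rightarrow> nat" where
  "other_runs A S u = card (free_runs (edge_set A) S - {run_end (edge_set A) u})"

text \<open>The induction hypothesis. It ranges over all S, because the rules enlarge S by vertices
  of subtrees, and over stretches inside a run, not only entire runs.\<close>

definition bounded :: "nat set join_tree \<Rightarrow> bool" where
  "bounded A \<longleftrightarrow> (\<forall>S u v lf rf. S \<subseteq> {..k} \<longrightarrow> window (edge_set A) S u v lf rf \<longrightarrow>
     LB A S (log base ((real v - real u) / loss lf rf) + other_runs A S u))"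

text \<open>L is a target length of its own: it stays fixed in the descent to subtrees, where the
  run through u gets shorter.\<close>

definition fails :: "nat set join_tree \<Rightarrow> nat set \<Rightarrow> nat \<Rightarrow> real \<Rightarrow> bool" where
  "fails A S u L \<longleftrightarrow> \<not> LB A S (log base L + other_runs A S u)"

lemma fails_commute: "fails (Node X Y) S u L \<Longrightarrow> fails (Node Y X) S u L"
  unfolding fails_def other_runs_def using LB_commute[of Y X] by (auto simp: Un_commute)

lemma boundedD:
  "bounded A \<Longrightarrow> S \<subseteq> {..k} \<Longrightarrow> window (edge_set A) S u v lf rf \<Longrightarrow>
     LB A S (log base ((real v - real u) / loss lf rf) + other_runs A S u)"
  unfolding bounded_def by blast

lemma LB_zero: "over A \<Longrightarrow> S \<subseteq> {..k} \<Longrightarrow> LB A S 0"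
proof (induction A)
  case (Leaf l)
  then show ?case by (intro LB_Leaf)
next
  case (Node B C)
  then have "LB B S 0" by auto
  from LB_add_sibling[OF this Node.prems] show ?case by (rule LB_mono) simp
qed

text \<open>\<open>LB_add_sibling\<close> read backwards: if the node misses the target L, the bound
  obtained from X is below it. The free runs in T are in surplus over the runs the node has to
  count, and each costs the window a factor \<open>omega\<close>.\<close>

lemma run_bound:
  assumes ov: "over (Node X Y)" and S: "S \<subseteq> {..k}" and bd: "bounded X"
    and fl: "fails (Node X Y) S u L" and L: "0 < L"
    and A: "{u..<v} \<subseteq> edge_set (Node X Y)"
    and W: "window (edge_set X) S a b lf rf" "u \<le> a" "a < v"
    and T: "T \<subseteq> free_runs (edge_set X) S - {run_end (edge_set X) a}"
      "\<And>c. c \<in> T \<Longrightarrow> run_end (edge_set (Node X Y)) (c - 1) = run_end (edge_set (Node X Y)) u"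
  shows "(real b - real a) / loss lf rf < L * omega ^ card T"
proof -
  let ?A = "edge_set (Node X Y)"
  let ?x = "(real b - real a) / loss lf rf"
  let ?Y = "card (free_runs (edge_set Y) (S \<union> run_verts (edge_set X)))"
  have fin: "finite ?A" using finite_edge_set[OF ov] .
  have aX: "a \<in> edge_set X" using W(1) by (auto simp: window_def)
  have "run_end ?A (run_end (edge_set X) a - 1) = run_end ?A u"
    using run_end_run_end[OF fin _ aX] run_end_window[OF fin A W(2,3)] by simp
  then have "card (free_runs ?A S - {run_end ?A u}) + card T
    \<le> card (free_runs (edge_set X) S - {run_end (edge_set X) a})
      + card (free_runs (edge_set Y) (S \<union> run_verts (edge_set X)) - {})"
    using T by (intro card_free_runs_le[OF fin]) auto
  then have acc: "other_runs (Node X Y) S u + card T \<le> other_runs X S a + ?Y"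
    unfolding other_runs_def by simp
  have "LB (Node X Y) S (log base ?x + other_runs X S a + ?Y)"
    using LB_add_sibling[OF boundedD[OF bd S W(1)] ov S] .
  then have "log base ?x + other_runs X S a + ?Y < log base L + other_runs (Node X Y) S u"
    using fl LB_mono unfolding fails_def by (meson not_le)
  moreover have "real (other_runs (Node X Y) S u) + real (card T) \<le> real (other_runs X S a) + real ?Y"
    using acc by linarith
  ultimately have "log base ?x + card T < log base L" by linarith
  moreover have "0 < ?x" using W(1) loss_pos by (simp add: window_def)
  ultimately show ?thesis using L by (intro less_omega_power)
qed

text \<open>The counterpart for \<open>LB_given_sibling\<close>. The window now lies in Y and no run
  of X is singled out, so T may contain every free run of X inside the run through u.\<close>

lemma gap_bound:
  assumes ov: "over (Node X Y)" and S: "S \<subseteq> {..k}" and bd: "bounded Y"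
    and fl: "fails (Node X Y) S u L" and L: "0 < L"
    and A: "{u..<v} \<subseteq> edge_set (Node X Y)"
    and W: "window (edge_set Y) (S \<union> run_verts (edge_set X)) a b lf rf" "u \<le> a" "a < v"
    and T: "T \<subseteq> free_runs (edge_set X) S"
      "\<And>c. c \<in> T \<Longrightarrow> run_end (edge_set (Node X Y)) (c - 1) = run_end (edge_set (Node X Y)) u"
  shows "(real b - real a) / loss lf rf < L * omega ^ card T"
proof -
  let ?A = "edge_set (Node X Y)"
  let ?x = "(real b - real a) / loss lf rf"
  let ?S = "S \<union> run_verts (edge_set X)"
  let ?X = "card (free_runs (edge_set X) S)"
  have ov': "over X" "over (Node Y X)" using ov by auto
  have S': "?S \<subseteq> {..k}" using S run_verts_subset[OF ov'(1)] by simp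
  have fin: "finite ?A" using finite_edge_set[OF ov] .
  have aY: "a \<in> edge_set Y" using W(1) by (auto simp: window_def)
  have "run_end ?A (run_end (edge_set Y) a - 1) = run_end ?A u"
    using run_end_run_end[OF fin _ aY] run_end_window[OF fin A W(2,3)] by simp
  then have "card (free_runs ?A S - {run_end ?A u}) + card T
    \<le> card (free_runs (edge_set X) S - {})
      + card (free_runs (edge_set Y) ?S - {run_end (edge_set Y) a})"
    using T by (intro card_free_runs_le[OF fin]) auto
  then have acc: "other_runs (Node X Y) S u + card T \<le> ?X + other_runs Y ?S a"
    unfolding other_runs_def by simp
  have "LB (Node Y X) S (log base ?x + other_runs Y ?S a + ?X)"
    using LB_given_sibling[OF boundedD[OF bd S' W(1)] ov'(2) S] .
  then have "LB (Node X Y) S (log base ?x + other_runs Y ?S a + ?X)" by (rule LB_commute)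
  then have "log base ?x + other_runs Y ?S a + ?X < log base L + other_runs (Node X Y) S u"
    using fl LB_mono unfolding fails_def by (meson not_le)
  moreover have "real (other_runs (Node X Y) S u) + real (card T) \<le> real ?X + real (other_runs Y ?S a)"
    using acc by linarith
  ultimately have "log base ?x + card T < log base L" by linarith
  moreover have "0 < ?x" using W(1) loss_pos by (simp add: window_def)
  ultimately show ?thesis using L by (intro less_omega_power)
qed

end

section \<open>Runs and gaps of one child at a node whose bound fails\<close>

locale failing_node = path_bounds +
  fixes X Y :: "nat set join_tree" and S :: "nat set" and u v :: nat and lf rf :: bool and L :: real
  assumes ov: "over (Node X Y)" and S: "S \<subseteq> {..k}"
    and bX: "bounded X" and bY: "bounded Y"
    and fl: "fails (Node X Y) S u L" and L: "0 < L"
    and W: "window (edge_set (Node X Y)) S u v lf rf"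
begin

abbreviation "ends \<equiv> inner_ends (edge_set X) u v lf rf"

lemma finite_edges: "finite (edge_set (Node X Y))" "finite (edge_set X)"
  using finite_edge_set[OF ov] by auto

lemma uv: "u < v" "{u..<v} \<subseteq> edge_set (Node X Y)"
  using W by (auto simp: window_def)

lemma ends_free: "ends \<subseteq> free_runs (edge_set X) S"
  by (rule inner_ends_subset_free_runs[OF W]) auto

lemma ends_run_end: "c \<in> ends \<Longrightarrow> run_end (edge_set (Node X Y)) (c - 1) = run_end (edge_set (Node X Y)) u"
  using inner_ends_run_end[OF finite_edges(1) uv(2)] .

text \<open>An inner run is free at both ends, so its loss is 1; it is not in surplus itself, whence
  the exponent \<open>card ends - 1\<close>.\<close>

lemma inner_run_bound:
  assumes r: "inner_run (edge_set X) u v lf rf a b"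
  shows "real b - real a < L * omega ^ (card ends - 1)"
proof -
  have ab: "u \<le> a" "a < b" "b \<le> v" "{a..<b} \<subseteq> edge_set X" using r by (auto simp: inner_run_def)
  have bX': "b \<notin> edge_set X" using r W by (auto simp: inner_run_def window_def split: if_splits)
  have re: "run_end (edge_set X) a = b" using ab bX' by (intro run_end_eqI) auto
  have be: "b \<in> ends"
  proof -
    have "b - 1 \<in> {a..<b}" using ab by auto
    then have "b - 1 \<in> edge_set X" using ab by blast
    moreover have "lf \<or> (\<exists>y\<in>{u..<b}. y \<notin> edge_set X)"
    proof (cases "a = u")
      case False
      then have "a - 1 \<in> {u..<b}" "a - 1 \<notin> edge_set X" using r ab by (auto simp: inner_run_def)
      then show ?thesis by blast
    qed (use r in \<open>auto simp: inner_run_def\<close>)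
    ultimately show ?thesis using r ab by (auto simp: inner_ends_def inner_run_def)
  qed
  have "window (edge_set X) S a b True True"
    using r W ab bX' by (auto simp: inner_run_def window_def split: if_splits)
  then have "(real b - real a) / loss True True < L * omega ^ card (ends - {b})"
    by (rule run_bound[OF ov S bX fl L uv(2)]) (use ab re ends_free ends_run_end in auto)
  then show ?thesis using be by (simp add: loss_def card_Diff_singleton)
qed

text \<open>A run cut off at u is not an inner run, so all inner runs are in surplus; in exchange
  its touched end costs the factor \<open>touch\<close>.\<close>

lemma left_run_bound:
  assumes "\<not> lf" "u < b" "b \<le> v" "{u..<b} \<subseteq> edge_set X" "if b = v then rf else b \<notin> edge_set X"
  shows "real b - real u < touch * L * omega ^ card ends"
proof -
  have bX': "b \<notin> edge_set X" using assms W by (auto simp: window_def split: if_splits)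
  have re: "run_end (edge_set X) u = b" using assms bX' by (intro run_end_eqI) auto
  have "b \<notin> ends" using assms by (auto simp: inner_ends_def)
  moreover have "window (edge_set X) S u b False True"
    using assms W bX' by (auto simp: window_def split: if_splits)
  ultimately have "(real b - real u) / loss False True < L * omega ^ card ends"
    by (intro run_bound[OF ov S bX fl L uv(2)]) (use re uv ends_free ends_run_end in auto)
  then show ?thesis using touch_gt_1 by (simp add: loss_def divide_less_eq algebra_simps)
qed

lemma right_run_bound:
  assumes "\<not> rf" "u \<le> a" "a < v" "{a..<v} \<subseteq> edge_set X" "if a = u then lf else a - 1 \<notin> edge_set X"
  shows "real v - real a < touch * L * omega ^ card ends"
proof -
  have "run_end (edge_set X) a \<notin> ends"
  proof
    assume e: "run_end (edge_set X) a \<in> ends"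
    then have "run_end (edge_set X) a < v" using assms(1) by (auto simp: inner_ends_def split: if_splits)
    moreover have "a \<le> run_end (edge_set X) a" "run_end (edge_set X) a \<notin> edge_set X"
      using run_end[OF finite_edges(2)] by auto
    ultimately show False using assms(4) by auto
  qed
  moreover have "window (edge_set X) S a v True False"
    using assms W by (auto simp: window_def split: if_splits)
  ultimately have "(real v - real a) / loss True False < L * omega ^ card ends"
    using assms(2,3) by (intro run_bound[OF ov S bX fl L uv(2)]) (use ends_free ends_run_end in auto)
  then show ?thesis using touch_gt_1 by (simp add: loss_def divide_less_eq algebra_simps)
qed

text \<open>Inside the window a gap generally ends at a vertex of X, which counts as touched; where
  it reaches an end of the window it is as free as the window is.\<close>

lemma gap_bound':
  assumes ab: "u \<le> a" "a < b" "b \<le> v" "{a..<b} \<inter> edge_set X = {}"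
  shows "real b - real a < loss (lf \<and> a = u) (rf \<and> b = v) * L * omega ^ card ends"
proof -
  have "window (edge_set Y) (S \<union> run_verts (edge_set X)) a b (lf \<and> a = u) (rf \<and> b = v)"
  proof -
    have "{a..<b} \<subseteq> edge_set Y" proof
      fix t assume t: "t \<in> {a..<b}"
      then have "t \<in> {u..<v}" using ab by simp
      then have "t \<in> edge_set X \<union> edge_set Y" using uv(2) by auto
      moreover have "t \<notin> edge_set X" using t ab(4) by blast
      ultimately show "t \<in> edge_set Y" by simp
    qed
    moreover have "x \<notin> S \<union> run_verts (edge_set X)" if "a < x" "x < b" for x
    proof -
      have "x \<in> {a..<b}" "x - 1 \<in> {a..<b}" using that by auto
      then have "x \<notin> run_verts (edge_set X)" using ab(4) by (auto simp: in_run_verts)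
      moreover have "x \<notin> S" using that ab W by (auto simp: window_def)
      ultimately show ?thesis by simp
    qed
    moreover have "0 < u \<and> u \<notin> S \<union> run_verts (edge_set X) \<and> u - 1 \<notin> edge_set Y" if "lf" "a = u"
      using that ab W by (auto simp: window_def in_run_verts)
    moreover have "v \<notin> S \<union> run_verts (edge_set X) \<and> v \<notin> edge_set Y" if "rf" "b = v"
    proof -
      have "v - 1 \<in> {a..<b}" using that ab by auto
      then have "v - 1 \<notin> edge_set X" using ab(4) by blast
      then show ?thesis using that W by (auto simp: window_def in_run_verts)
    qed
    ultimately show ?thesis using ab by (auto simp: window_def)
  qed
  then have "(real b - real a) / loss (lf \<and> a = u) (rf \<and> b = v) < L * omega ^ card ends"
    using ab by (intro gap_bound[OF ov S bY fl L uv(2)]) (use ends_free ends_run_end in auto)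
  then show ?thesis using loss_pos[of "lf \<and> a = u" "rf \<and> b = v"]
    by (simp add: divide_less_eq algebra_simps)
qed

lemma gap_bound_weak:
  assumes ab: "u \<le> a" "a < b" "b \<le> v" "{a..<b} \<inter> edge_set X = {}"
  shows "real b - real a < 2 * touch * L * omega ^ card ends"
proof -
  have "loss (lf \<and> a = u) (rf \<and> b = v) * L * omega ^ card ends \<le> 2 * touch * L * omega ^ card ends"
    using loss_le L omega_bounds by (intro mult_right_mono) auto
  with gap_bound'[OF ab] show ?thesis by linarith
qed

lemma not_covered:
  assumes "L \<le> (real v - real u) / loss lf rf"
  shows "\<not> {u..<v} \<subseteq> edge_set X"
proof
  assume "{u..<v} \<subseteq> edge_set X"
  then have "window (edge_set X) S u v lf rf" using W by (auto simp: window_def)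
  then have "(real v - real u) / loss lf rf < L * omega ^ card ({} :: nat set)"
    using uv by (intro run_bound[OF ov S bX fl L uv(2)]) auto
  with assms show False by simp
qed

lemma bounds_pos: "0 < L * omega ^ i" "0 < 2 * touch * L * omega ^ i" "0 < touch * L * omega ^ i"
  using L omega_bounds touch_gt_1 by auto

lemma window_length_less:
  assumes "\<not> {u..<v} \<subseteq> edge_set X"
  shows "real v - real u < card ends * (L * omega ^ (card ends - 1) + 2 * touch * L * omega ^ card ends)
    + 2 * touch * L * omega ^ card ends + 2 * (touch * L * omega ^ card ends)"
proof (rule length_less[where rf = rf and lf = lf])
  show "real b - real u < touch * L * omega ^ card ends"
    if "\<not> lf" "u < b" "b < v" "{u..<b} \<subseteq> edge_set X" "b \<notin> edge_set X" for b
    using that by (intro left_run_bound) auto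
  show "real v - real a < touch * L * omega ^ card ends"
    if "\<not> rf" "u < a" "a < v" "{a..<v} \<subseteq> edge_set X" "a - 1 \<notin> edge_set X" for a
    using that by (intro right_run_bound) auto
qed (use uv bounds_pos inner_run_bound gap_bound_weak assms in auto)

lemma two_runs_short:
  assumes "2 \<le> card ends" "\<not> {u..<v} \<subseteq> edge_set X"
  shows "real v - real u < 3 / 5 * L"
  using window_length_less[OF assms(2)] budget_two_runs[OF assms(1) L] by linarith

text \<open>With an inner run, \<open>budget_two_sides\<close> would make the window shorter than
  itself.\<close>

lemma no_ends_two_sides:
  assumes f: "\<not> lf" "\<not> rf" and Ldef: "L = (real v - real u) / (2 * touch)"
  shows "ends = {}"
proof (rule ccontr)
  assume "ends \<noteq> {}"
  then have t: "1 \<le> card ends" by (simp add: Suc_le_eq card_gt_0_iff)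
  have "\<not> {u..<v} \<subseteq> edge_set X" by (rule not_covered) (simp add: Ldef loss_def f)
  from window_length_less[OF this] budget_two_sides[OF t, of "real v - real u"] uv(1)
  show False by (simp add: Ldef)
qed

text \<open>Without inner runs, every run of X is cut off at u or at v, and \<open>touch * L\<close>
  is half the window. The factor \<open>2 * touch\<close> for two touched ends is chosen for
  this.\<close>

lemma near_an_end:
  assumes f: "\<not> lf" "\<not> rf" and Ldef: "L = (real v - real u) / (2 * touch)"
    and x: "x \<in> edge_set X" "u \<le> x" "x < v"
  shows "real (Suc x) - real u < (real v - real u) / 2 \<or> real v - real x < (real v - real u) / 2"
proof -
  have e: "ends = {}" by (rule no_ends_two_sides[OF f Ldef])
  have nc: "\<not> {u..<v} \<subseteq> edge_set X" by (rule not_covered) (simp add: Ldef loss_def f)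
  have half: "touch * L * omega ^ card ends = (real v - real u) / 2"
    using touch_gt_1 by (simp add: e Ldef)
  obtain a where a: "u \<le> a" "a \<le> Suc x" "{a..<Suc x} \<subseteq> edge_set X" "a = u \<or> a - 1 \<notin> edge_set X"
    using previous_outside[of u "Suc x"] x by auto
  have ax: "a \<le> x"
  proof (rule ccontr)
    assume "\<not> a \<le> x"
    then have "a = Suc x" using a by simp
    with a x show False by auto
  qed
  obtain b where b: "x \<le> b" "b \<le> v" "{x..<b} \<subseteq> edge_set X" "b = v \<or> b \<notin> edge_set X"
    using next_outside[OF x(3)] .
  have xb: "x < b" using b x by (cases "x = b") auto
  have ab: "{a..<b} \<subseteq> edge_set X"
  proof
    fix y assume "y \<in> {a..<b}"
    then have "y \<in> {a..<Suc x} \<or> y \<in> {x..<b}" by auto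
    then show "y \<in> edge_set X" using a b by blast
  qed
  have b1: "b - 1 \<in> edge_set X" using ab ax xb by auto
  consider "a = u" "b = v" | "a = u" "b < v" "b \<notin> edge_set X" | "u < a" "b = v" "a - 1 \<notin> edge_set X"
    | "u < a" "b < v" "a - 1 \<notin> edge_set X" "b \<notin> edge_set X" using a b by fastforce
  then show ?thesis
  proof cases
    case 1 with ab nc show ?thesis by simp
  next
    case 2
    then have "real b - real u < (real v - real u) / 2"
      using left_run_bound[OF f(1), of b] ab xb x half by auto
    then show ?thesis using xb by linarith
  next
    case 3
    then have "real v - real a < (real v - real u) / 2"
      using right_run_bound[OF f(2), of a] ab ax x half by auto
    then show ?thesis using ax by linarith
  next
    case 4
    then have "a - 1 \<in> {u..<b}" using ax xb by auto
    then have "b \<in> ends" using 4 b1 xb x by (auto simp: inner_ends_def)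
    with e show ?thesis by simp
  qed
qed

text \<open>A run of X starting at the free end u is an inner run, and then
  \<open>budget_one_side\<close> makes the window shorter than itself. Applied to both children,
  this leaves the edge u in neither.\<close>

lemma no_left_edge_one_side:
  assumes f: "lf" "\<not> rf" and Ldef: "L = (real v - real u) / touch"
  shows "u \<notin> edge_set X"
proof
  assume uX: "u \<in> edge_set X"
  have nc: "\<not> {u..<v} \<subseteq> edge_set X" by (rule not_covered) (simp add: Ldef loss_def f)
  have lf: "lf = True" using f by simp
  obtain e where e: "u \<le> e" "e \<le> v" "{u..<e} \<subseteq> edge_set X" "e = v \<or> e \<notin> edge_set X"
    using next_outside[OF uv(1)] .
  have "e < v" "e \<notin> edge_set X" using e nc by (cases "e = v"; simp)+
  moreover have "u < e" using e uX \<open>e \<notin> edge_set X\<close> by (cases "u = e") auto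
  moreover have "e - 1 \<in> {u..<e}" using \<open>u < e\<close> by auto
  ultimately have "e \<in> ends" using e(3) f by (auto simp: inner_ends_def)
  then have t: "1 \<le> card ends" by (auto simp: Suc_le_eq card_gt_0_iff)
  have "real v - real u < card ends * (L * omega ^ (card ends - 1) + 2 * touch * L * omega ^ card ends)
    + (if rf then 0 else touch * L * omega ^ card ends)"
    unfolding lf
  proof (rule length_less_left[OF uv(1) uX])
    show "real v - real a < touch * L * omega ^ card (inner_ends (edge_set X) u v True rf)"
      if "\<not> rf" "u \<le> a" "a < v" "{a..<v} \<subseteq> edge_set X" "a = u \<or> a - 1 \<notin> edge_set X" for a
      using right_run_bound[OF that(1-4)] that(5) f by auto
  qed (use bounds_pos inner_run_bound gap_bound_weak lf in auto)
  then show False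
    using budget_one_side[OF t, of "real v - real u"] uv(1) f by (simp add: Ldef)
qed

lemma no_right_edge_one_side:
  assumes f: "\<not> lf" "rf" and Ldef: "L = (real v - real u) / touch"
  shows "v - 1 \<notin> edge_set X"
proof
  assume vX: "v - 1 \<in> edge_set X"
  have nc: "\<not> {u..<v} \<subseteq> edge_set X" by (rule not_covered) (simp add: Ldef loss_def f)
  have rf: "rf = True" using f by simp
  obtain a where a: "u \<le> a" "a \<le> v" "{a..<v} \<subseteq> edge_set X" "a = u \<or> a - 1 \<notin> edge_set X"
    using previous_outside[OF uv(1)] .
  have "u < a" "a - 1 \<notin> edge_set X" using a nc by (cases "a = u"; simp)+
  then have "a - 1 \<in> {u..<v}" using a by auto
  then have "v \<in> ends" using vX \<open>a - 1 \<notin> edge_set X\<close> f uv(1) by (auto simp: inner_ends_def)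
  then have t: "1 \<le> card ends" by (auto simp: Suc_le_eq card_gt_0_iff)
  have "real v - real u < card ends * (L * omega ^ (card ends - 1) + 2 * touch * L * omega ^ card ends)
    + (if lf then 0 else touch * L * omega ^ card ends)"
    unfolding rf
  proof (rule length_less_right[OF uv(1) vX])
    show "real b - real u < touch * L * omega ^ card (inner_ends (edge_set X) u v lf True)"
      if "\<not> lf" "u < b" "b \<le> v" "{u..<b} \<subseteq> edge_set X" "b = v \<or> b \<notin> edge_set X" for b
      using left_run_bound[OF that(1-4)] that(5) f by auto
  qed (use bounds_pos inner_run_bound gap_bound_weak rf in auto)
  then show False
    using budget_one_side[OF t, of "real v - real u"] uv(1) f by (simp add: Ldef)
qed

lemma single_run:
  assumes "lf" "rf" "card ends \<le> 1" "b \<in> ends" "x \<in> edge_set X" "u \<le> x" "x < v"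
  shows "run_end (edge_set X) x = b"
proof -
  have "run_end (edge_set X) x \<in> ends"
    using run_end_in_inner_ends(1)[of "edge_set (Node X Y)" S u v lf "edge_set X" x] W finite_edges assms
    by simp
  with assms(3,4) show ?thesis
    using card_le_Suc0_iff_eq[of ends] by simp
qed

end

section \<open>Windows free at both ends, and the induction over the join-tree\<close>

context path_bounds
begin

lemma fails_child:
  assumes ov: "over (Node X Y)" and S: "S \<subseteq> {..k}" and fl: "fails (Node X Y) S u L"
    and u: "u \<in> edge_set X"
  shows "fails X S u L"
proof -
  let ?A = "edge_set (Node X Y)"
  let ?Y = "card (free_runs (edge_set Y) (S \<union> run_verts (edge_set X)))"
  have fin: "finite ?A" using finite_edge_set[OF ov] .
  have "run_end ?A (run_end (edge_set X) u - 1) = run_end ?A u"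
    using run_end_run_end[OF fin _ u] by simp
  then have "card (free_runs ?A S - {run_end ?A u}) + card ({} :: nat set)
    \<le> card (free_runs (edge_set X) S - {run_end (edge_set X) u})
      + card (free_runs (edge_set Y) (S \<union> run_verts (edge_set X)) - {})"
    by (intro card_free_runs_le[OF fin]) auto
  then have acc: "other_runs (Node X Y) S u \<le> other_runs X S u + ?Y"
    unfolding other_runs_def by simp
  show ?thesis unfolding fails_def
  proof
    assume "LB X S (log base L + other_runs X S u)"
    from LB_add_sibling[OF this ov S]
    have "LB (Node X Y) S (log base L + other_runs (Node X Y) S u)"
      by (rule LB_mono) (use acc in linarith)
    with fl show False by (simp add: fails_def)
  qed
qed

text \<open>The two shares add up to 1, and their difference and their product both equal sqrt 5 -
  2. The difference serves the descent, the product the mean rule.\<close>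

abbreviation low :: real where "low \<equiv> (3 - sqrt 5) / 2"
abbreviation high :: real where "high \<equiv> (sqrt 5 - 1) / 2"

text \<open>In one step down the tree the run starting at \<open>u\<close> loses less than
  \<open>touch * omega * L = (high - low) * L\<close>, so its length cannot jump over the
  interval from \<open>low * L\<close> to \<open>high * L\<close>.\<close>

lemma descend:
  assumes "over D" "S \<subseteq> {..k}" "\<And>D'. D' \<in> subtrees D \<Longrightarrow> bounded D'" "fails D S u L" "2 \<le> L"
    and "0 < u" "u \<notin> S" "u - 1 \<notin> edge_set D" "u \<in> edge_set D"
    and "\<And>x. u < x \<Longrightarrow> x < v \<Longrightarrow> x \<notin> S" "run_end (edge_set D) u < v"
    and "{run_end (edge_set D) u..<v} \<inter> edge_set D = {}"
    and "high * L \<le> real (run_end (edge_set D) u) - real u"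
  shows "\<exists>X\<in>subtrees D. u \<in> edge_set X \<and> run_end (edge_set X) u < v \<and>
    low * L \<le> real (run_end (edge_set X) u) - real u \<and>
    real (run_end (edge_set X) u) - real u \<le> high * L \<and> {run_end (edge_set X) u..<v} \<inter> edge_set X = {}"
  using assms(1,3,4,8,9,11-)
proof (induction D)
  case (Leaf l)
  have "edge_set (Leaf l) \<subseteq> {u}"
  proof
    fix x assume "x \<in> edge_set (Leaf l)"
    then have "{x, Suc x} = {u, Suc u}" using Leaf.prems(5) by (cases l) (auto simp: edge_set_def)
    then show "x \<in> {u}" by (auto simp: doubleton_eq_iff)
  qed
  then have "run_end (edge_set (Leaf l)) u = Suc u"
    using Leaf.prems(5) by (intro run_end_eqI) auto
  \<comment> \<open>The run of a leaf has length 1, while \<open>high * L\<close> exceeds 1.2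
    because L is at least 2: the descent cannot get as far as a leaf.\<close>
  then have "high * L \<le> 1" using Leaf.prems(8) by simp
  moreover have "1.2 < high * 2" using sqrt5_bounds by simp
  moreover have "high * 2 \<le> high * L" using assms(5) sqrt5_bounds by (intro mult_left_mono) auto
  ultimately show ?case by linarith
next
  case (Node B C)
  \<comment> \<open>The induction hypothesis of the child is a premise here, so that one argument
    serves either child.\<close>
  have key: "\<exists>Z\<in>subtrees X. u \<in> edge_set Z \<and> run_end (edge_set Z) u < v \<and>
    low * L \<le> real (run_end (edge_set Z) u) - real u \<and>
    real (run_end (edge_set Z) u) - real u \<le> high * L \<and> {run_end (edge_set Z) u..<v} \<inter> edge_set Z = {}"
    if ov: "over (Node X Y)" and b: "\<And>D. D \<in> subtrees X \<union> subtrees Y \<Longrightarrow> bounded D"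
      and fl: "fails (Node X Y) S u L" and uX: "u \<in> edge_set X"
      and E: "edge_set (Node X Y) = edge_set (Node B C)"
      and IH: "over X \<Longrightarrow> (\<And>D'. D' \<in> subtrees X \<Longrightarrow> bounded D') \<Longrightarrow> fails X S u L \<Longrightarrow>
         u - 1 \<notin> edge_set X \<Longrightarrow> u \<in> edge_set X \<Longrightarrow> run_end (edge_set X) u < v \<Longrightarrow>
         {run_end (edge_set X) u..<v} \<inter> edge_set X = {} \<Longrightarrow>
         high * L \<le> real (run_end (edge_set X) u) - real u \<Longrightarrow>
         \<exists>Z\<in>subtrees X. u \<in> edge_set Z \<and> run_end (edge_set Z) u < v \<and>
           low * L \<le> real (run_end (edge_set Z) u) - real u \<and>
           real (run_end (edge_set Z) u) - real u \<le> high * L \<and>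
           {run_end (edge_set Z) u..<v} \<inter> edge_set Z = {}"
    for X Y
  proof -
    let ?A = "edge_set (Node X Y)"
    define q where "q = run_end ?A u"
    define q1 where "q1 = run_end (edge_set X) u"
    have fin: "finite ?A" "finite (edge_set X)" using finite_edge_set[OF ov] by auto
    have uA: "u \<in> ?A" using uX by simp
    have uq: "u < q" unfolding q_def by (rule run_end_gt[OF fin(1) uA])
    have qv: "q < v" and qdis: "{q..<v} \<inter> ?A = {}" and qh: "high * L \<le> real q - real u"
      using Node.prems(6-8) unfolding q_def E by auto
    have W: "window ?A S u q True True"
      using uq qv run_end[OF fin(1), of u] assms(6,7,10) Node.prems(4) unfolding E[symmetric]
      by (auto simp: window_def q_def)
    interpret failing_node k LB X Y S u q True True L
      by unfold_locales (use ov assms(2,5) b fl W in auto)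
    have q1: "q1 \<in> ends" "u < q1" "q1 \<le> q"
      using run_end_in_inner_ends[OF W _ fin(1) uX] uq by (auto simp: q1_def)
    have one: "card ends \<le> 1"
    proof (rule ccontr)
      assume "\<not> card ends \<le> 1"
      then have t: "2 \<le> card ends" by simp
      have "\<not> {u..<q} \<subseteq> edge_set X"
      proof
        assume sub: "{u..<q} \<subseteq> edge_set X"
        have "c = q" if c: "c \<in> ends" for c
        proof (rule ccontr)
          assume "c \<noteq> q"
          then have "c \<notin> edge_set X" "c \<in> {u..<q}" using c by (auto simp: inner_ends_def)
          with sub show False by blast
        qed
        then have "ends \<subseteq> {q}" by blast
        then have "card ends \<le> card {q}" by (intro card_mono) auto
        with t show False by simp
      qed
      from two_runs_short[OF t this] have "real q - real u < 3 / 5 * L" .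
      moreover have "3 / 5 * L \<le> high * L" using assms(5) sqrt5_bounds by (intro mult_right_mono) auto
      ultimately show False using qh by linarith
    qed
    have gap: "{q1..<q} \<inter> edge_set X = {}"
    proof (rule ccontr)
      assume "{q1..<q} \<inter> edge_set X \<noteq> {}"
      then obtain x where x: "q1 \<le> x" "x < q" "x \<in> edge_set X" by auto
      then have "run_end (edge_set X) x = q1" using single_run[OF _ _ one q1(1)] q1 by simp
      with run_end_gt[OF fin(2) x(3)] x(1) show False by simp
    qed
    have dis: "{q1..<v} \<inter> edge_set X = {}"
    proof -
      have "{q1..<v} \<subseteq> {q1..<q} \<union> {q..<v}" by auto
      then show ?thesis using gap qdis by auto
    qed
    show ?thesis
    \<comment> \<open>While the run is long the descent goes on. Otherwise the length has just
      dropped below \<open>high * L\<close>, and the gap lost in this step is too short for it to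
      have fallen below \<open>low * L\<close>.\<close>
    proof (cases "high * L \<le> real q1 - real u")
      case True
      show ?thesis
        by (rule IH)
          (use ov b fails_child[OF ov assms(2) fl uX] Node.prems(4) E uX q1 qv dis True
            in \<open>auto simp: q1_def[symmetric]\<close>)
    next
      case False
      then have "q1 < q" using qh q1 by (cases "q1 = q") auto
      have "card ends = 1" using one q1(1) by (auto simp: le_Suc_eq)
      with gap_bound'[of q1 q] gap q1 \<open>q1 < q\<close> have "real q - real q1 < (touch * omega) * L"
        by (simp add: loss_def algebra_simps)
      then have "real q - real q1 < (sqrt 5 - 2) * L" by (simp add: touch_omega)
      moreover have "high * L - (sqrt 5 - 2) * L = low * L" by (simp add: field_simps)
      ultimately have "low * L \<le> real q1 - real u" using qh by linarith
      then show ?thesis using uX False q1 qv dis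
        by (intro bexI[of _ X]) (auto simp: q1_def[symmetric])
    qed
  qed
  have b: "\<And>D. D \<in> subtrees B \<union> subtrees C \<Longrightarrow> bounded D" using Node.prems(2) by auto
  from Node.prems(5) consider "u \<in> edge_set B" | "u \<in> edge_set C" by auto
  then show ?case
  proof cases
    case 1
    have "\<exists>Z\<in>subtrees B. u \<in> edge_set Z \<and> run_end (edge_set Z) u < v \<and>
      low * L \<le> real (run_end (edge_set Z) u) - real u \<and>
      real (run_end (edge_set Z) u) - real u \<le> high * L \<and> {run_end (edge_set Z) u..<v} \<inter> edge_set Z = {}"
      by (rule key[OF Node.prems(1) b Node.prems(3) 1 refl Node.IH(1)])
    then show ?thesis by auto
  next
    case 2
    have "\<exists>Z\<in>subtrees C. u \<in> edge_set Z \<and> run_end (edge_set Z) u < v \<and>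
      low * L \<le> real (run_end (edge_set Z) u) - real u \<and>
      real (run_end (edge_set Z) u) - real u \<le> high * L \<and> {run_end (edge_set Z) u..<v} \<inter> edge_set Z = {}"
      by (rule key[OF _ _ fails_commute[OF Node.prems(3)] 2 _ Node.IH(2)]) (use Node.prems(1) b in auto)
    then show ?thesis by auto
  qed
qed

text \<open>X has a run from u that stops before v, and Y a run up to v that starts after u; each
  misses less than (sqrt 5 - 2) * L. So X can be cut down to a subtree Z with a run of medium
  length, and Y still covers the rest of the window: the mean rule for Z and Y reaches the target
  L.\<close>

lemma split_run_contradiction:
  assumes ov: "over (Node X Y)" and S: "S \<subseteq> {..k}"
    and bX: "\<And>D. D \<in> subtrees X \<Longrightarrow> bounded D" and bY: "bounded Y"
    and fl: "fails (Node X Y) S u L" and W: "window (edge_set (Node X Y)) S u v True True"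
    and L: "L = real v - real u" and uX: "u \<in> edge_set X"
  shows False
proof -
  let ?A = "edge_set (Node X Y)" and ?X = "edge_set X" and ?Y = "edge_set Y"
  have fin: "finite ?A" "finite ?X" "finite ?Y" using finite_edge_set[OF ov] by auto
  have uv: "u < v" "{u..<v} \<subseteq> ?A" and vA: "v \<notin> ?A" and vS: "v \<notin> S"
    and u0: "0 < u" "u \<notin> S" "u - 1 \<notin> ?A" and inS: "\<And>x. u < x \<Longrightarrow> x < v \<Longrightarrow> x \<notin> S"
    using W by (auto simp: window_def)
  have L0: "0 < L" using L uv by simp
  interpret X: failing_node k LB X Y S u v True True L
    by unfold_locales (use ov S bX bY fl W L0 in auto)
  have EYX: "edge_set (Node Y X) = ?A" by auto
  interpret Y: failing_node k LB Y X S u v True True L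
    by unfold_locales (use ov S bX bY fails_commute[OF fl] W L0 EYX in auto)
  have nX: "\<not> {u..<v} \<subseteq> ?X" by (rule X.not_covered) (simp add: L loss_def)
  have nY: "\<not> {u..<v} \<subseteq> ?Y" by (rule Y.not_covered) (simp add: L loss_def)
  have oneX: "card X.ends \<le> 1" using X.two_runs_short[OF _ nX] L L0 by (cases "2 \<le> card X.ends") auto
  have oneY: "card Y.ends \<le> 1" using Y.two_runs_short[OF _ nY] L L0 by (cases "2 \<le> card Y.ends") auto
  define q where "q = run_end ?X u"
  have q: "q \<in> X.ends" "{u..<q} \<subseteq> ?X" "u < q" "q \<le> v" "q \<notin> ?X"
    using run_end_in_inner_ends[OF W _ fin(1) uX] uv by (auto simp: q_def)
  have qv: "q < v" using q nX by (cases "q = v") auto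
  have Xend: "run_end ?X x = q" if "x \<in> ?X" "u \<le> x" "x < v" for x
    by (rule X.single_run[OF _ _ oneX q(1) that]) auto
  have Xdis: "{q..<v} \<inter> ?X = {}"
  proof (rule ccontr)
    assume "{q..<v} \<inter> ?X \<noteq> {}"
    then obtain x where x: "q \<le> x" "x < v" "x \<in> ?X" by auto
    then show False using Xend[of x] run_end_gt[OF fin(2) x(3)] q(3) by simp
  qed
  have v1: "v - 1 \<in> ?Y"
  proof -
    have "v - 1 \<in> {q..<v}" using qv by auto
    moreover from this have "v - 1 \<in> {u..<v}" using q(3) by auto
    then have "v - 1 \<in> ?X \<union> ?Y" using uv(2) by auto
    ultimately show ?thesis using Xdis by blast
  qed
  have vv: "run_end ?Y (v - 1) = v"
    proof (rule run_end_eqI)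
    have "{v - 1..<v} = {v - 1}" using uv by auto
    then show "{v - 1..<v} \<subseteq> ?Y" using v1 by simp
  qed (use vA in auto)
  have "run_end ?Y (v - 1) \<in> Y.ends"
    using run_end_in_inner_ends(1)[of "edge_set (Node Y X)" S u v True ?Y "v - 1"] W EYX fin v1 uv by simp
  then have "v \<in> Y.ends" using vv by simp
  then have Yend: "run_end ?Y x = v" if "x \<in> ?Y" "u \<le> x" "x < v" for x
    using that by (intro Y.single_run[OF _ _ oneY]) auto
  have Ysub: "{x..<v} \<subseteq> ?Y" if "x \<in> ?Y" "u \<le> x" "x < v" for x
    using Yend[OF that] run_end(3)[OF fin(3), of x] by simp
  \<comment> \<open>Otherwise the single run of Y would cover the window.\<close>
  have uY: "u \<notin> ?Y" using Ysub[of u] nY uv by auto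
  have qY: "q \<in> ?Y"
  proof -
    have "q \<in> {u..<v}" using q qv by auto
    then show ?thesis using uv(2) q(5) by auto
  qed
  have card1: "card X.ends = 1" "card Y.ends = 1"
    using oneX oneY q(1) \<open>v \<in> Y.ends\<close> by (auto simp: le_Suc_eq)
  have g: "touch * L * omega ^ 1 = (sqrt 5 - 2) * L"
    by (simp add: touch_omega[symmetric] algebra_simps)
  have gapX: "real v - real q < (sqrt 5 - 2) * L"
    using X.gap_bound'[of q v] Xdis q qv unfolding card1 g[symmetric] by (simp add: loss_def)
  obtain r where r: "u \<le> r" "r \<le> v" "{u..<r} \<subseteq> - ?Y" "r = v \<or> r \<notin> - ?Y"
    using next_outside[OF uv(1)] .
  have rq: "r \<le> q"
  proof (rule ccontr)
    assume "\<not> r \<le> q"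
    then have "q \<in> {u..<r}" using q by simp
    with r(3) qY show False by blast
  qed
  then have rY: "r \<in> ?Y" using r qv by auto
  then have ur: "u < r" using uY r(1) by (cases "r = u") auto
  have rsub: "{r..<v} \<subseteq> ?Y" by (rule Ysub) (use rY ur rq qv in auto)
  have gapY: "real r - real u < (sqrt 5 - 2) * L"
    using Y.gap_bound'[of u r] r ur rq qv unfolding card1 g[symmetric] by (auto simp: loss_def)
  have L2: "2 \<le> L" using q(3) qv L by simp
  have "\<exists>Z\<in>subtrees X. u \<in> edge_set Z \<and> run_end (edge_set Z) u < v \<and>
    low * L \<le> real (run_end (edge_set Z) u) - real u \<and>
    real (run_end (edge_set Z) u) - real u \<le> high * L \<and> {run_end (edge_set Z) u..<v} \<inter> edge_set Z = {}"
  proof (rule descend)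
    show "fails X S u L" by (rule fails_child[OF ov S fl uX])
    have "(1 - (sqrt 5 - 2)) * L = L - (sqrt 5 - 2) * L" by (simp add: algebra_simps)
    then have "(1 - (sqrt 5 - 2)) * L \<le> real q - real u" using gapX L by linarith
    moreover have "high * L \<le> (1 - (sqrt 5 - 2)) * L"
      using L0 sqrt5_bounds by (intro mult_right_mono) auto
    ultimately show "high * L \<le> real (run_end ?X u) - real u" unfolding q_def by linarith
  qed (use ov S bX L2 u0 inS uX Xdis qv in \<open>auto simp: q_def[symmetric]\<close>)
  then obtain Z where Z: "Z \<in> subtrees X" "u \<in> edge_set Z" "run_end (edge_set Z) u < v"
    "low * L \<le> real (run_end (edge_set Z) u) - real u" "real (run_end (edge_set Z) u) - real u \<le> high * L"
    "{run_end (edge_set Z) u..<v} \<inter> edge_set Z = {}"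
    by blast
  let ?Z = "edge_set Z"
  define p where "p = run_end ?Z u"
  have ZX: "?Z \<subseteq> ?X" using labels_subtree[OF Z(1)] by (auto simp: edge_set_def)
  have finZ: "finite ?Z" using ZX fin finite_subset by blast
  have p: "u < p" "p < v" "p \<notin> ?Z" "{u..<p} \<subseteq> ?Z" "{p..<v} \<inter> ?Z = {}"
    using run_end_gt[OF finZ Z(2)] run_end[OF finZ, of u] Z by (auto simp: p_def)
  have pL: "low * L \<le> real p - real u" "real p - real u \<le> high * L" using Z by (auto simp: p_def)
  have WZ: "window ?Z S u p True True"
    using p u0 inS ZX by (auto simp: window_def)
  let ?S = "S \<union> run_verts ?Z"
  \<comment> \<open>Y starts less than about 0.24 * L after u, the run of Z is at least about 0.38 *
    L long; hence Y covers everything from p to v.\<close>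
  have rp: "r \<le> p"
  proof -
    have "(sqrt 5 - 2) * L \<le> low * L" using L0 sqrt5_bounds by (intro mult_right_mono) auto
    then have "real r - real u < real p - real u" using gapY pL by linarith
    then show ?thesis by simp
  qed
  \<comment> \<open>The left end p is a vertex of Z and counts as touched, the right end v is free,
    so the loss is \<open>touch\<close>.\<close>
  have WY: "window ?Y ?S p v False True"
  proof -
    have "x \<notin> run_verts ?Z" if x: "p < x" "x \<le> v" for x
    proof -
      have "x - 1 \<in> {p..<v}" using x by auto
      then have "x - 1 \<notin> ?Z" using p(5) by blast
      moreover have "x \<notin> ?Z"
      proof (cases "x = v")
        case True then show ?thesis using vA ZX by auto
      next
        case False
        then have "x \<in> {p..<v}" using x by auto
        then show ?thesis using p(5) by blast
      qed
      ultimately show ?thesis by (simp add: in_run_verts)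
    qed
    moreover have "{p..<v} \<subseteq> ?Y" using rsub rp by auto
    ultimately show ?thesis using p vA vS inS by (auto simp: window_def)
  qed
  have "run_verts ?Z \<subseteq> run_verts ?X" using ZX by (auto simp: run_verts_def)
  then have S': "?S \<subseteq> {..k}" using S run_verts_subset[of X] ov by auto
  let ?c = "log base ((real p - real u) / loss True True) + other_runs Z S u"
  let ?d = "log base ((real v - real p) / loss False True) + other_runs Y ?S p"
  let ?n1 = "card (free_runs ?A (?S \<union> run_verts ?Y))" and ?n2 = "card (free_runs ?A S)"
  have LB: "LB (Node X Y) S ((?c + ?d + ?n1 + ?n2) / 2)"
    by (rule LB_mean[OF Z(1) boundedD[OF bX[OF Z(1)] S WZ] boundedD[OF bY S' WY] ov S])
  have rA: "run_end ?A u = v" using uv vA by (intro run_end_eqI) auto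
  have acc1: "other_runs (Node X Y) S u \<le> other_runs Z S u + card (free_runs ?A ?S - {v})"
  proof -
    have "run_end ?A (run_end ?Z u - 1) = run_end ?A u"
      by (rule run_end_run_end[OF fin(1) _ Z(2)]) (use ZX in auto)
    moreover have "run_end ?A (v - 1) = v"
      using run_end_window[OF fin(1) uv(2), of "v - 1"] uv(1) rA by simp
    ultimately have "card (free_runs ?A S - {v}) + card ({} :: nat set)
      \<le> card (free_runs ?Z S - {run_end ?Z u}) + card (free_runs ?A ?S - {v})"
      using ZX rA by (intro card_free_runs_le[OF fin(1)]) auto
    then show ?thesis unfolding other_runs_def rA by simp
  qed
  have acc2: "card (free_runs ?A ?S - {v}) \<le> other_runs Y ?S p + ?n1"
  proof -
    have pY: "p \<in> ?Y" using WY by (auto simp: window_def)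
    have "run_end ?A (run_end ?Y p - 1) = v"
      using run_end_run_end[OF fin(1) _ pY] run_end_window[OF fin(1) uv(2), of p] p rA by simp
    then have "card (free_runs ?A ?S - {v}) + card ({} :: nat set)
      \<le> card (free_runs ?Y ?S - {run_end ?Y p}) + card (free_runs ?A (?S \<union> run_verts ?Y) - {})"
      by (intro card_free_runs_le[OF fin(1)]) auto
    then show ?thesis unfolding other_runs_def by simp
  qed
  \<comment> \<open>The full count includes the run ending at v. This one extra unit is the +1 that
    pays for the factor \<open>base\<close> in \<open>prod\<close>.\<close>
  have acc3: "?n2 = Suc (other_runs (Node X Y) S u)"
  proof -
    have "v \<in> inner_ends ?A u v True True"
    proof -
      have "v - 1 \<in> {u..<v}" using uv by auto
      then have "v - 1 \<in> ?A" using uv(2) by blast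
      then show ?thesis using uv(1) by (simp add: inner_ends_def)
    qed
    then have "v \<in> free_runs ?A S" using inner_ends_subset_free_runs[OF W subset_refl] by blast
    from card_Suc_Diff1[OF finite_free_runs[OF fin(1)] this] show ?thesis
      unfolding other_runs_def rA by (rule sym)
  qed
  have prod: "L\<^sup>2 \<le> (real p - real u) * ((real v - real p) / touch) * base"
  proof -
    define x where "x = real p - real u"
    \<comment> \<open>x * (L - x) is concave, so on the interval it is smallest at the ends, with
      value \<open>low * high * L\<^sup>2\<close>.\<close>
    have "0 \<le> (x - low * L) * (high * L - x)" using pL by (simp add: x_def)
    also have "\<dots> = x * (L - x) - (sqrt 5 - 2) * L\<^sup>2"
      by (simp add: field_simps power2_eq_square)
    finally have "(sqrt 5 - 2) * L\<^sup>2 \<le> x * (L - x)" by simp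
    then have "touch * omega * L\<^sup>2 \<le> x * (L - x)" by (simp add: touch_omega)
    then have "base * (touch * omega * L\<^sup>2) \<le> base * (x * (L - x))"
      by (rule mult_left_mono) simp
    moreover have "base * (touch * omega * L\<^sup>2) = (base * omega) * (touch * L\<^sup>2)" by simp
    ultimately have "touch * L\<^sup>2 \<le> base * (x * (L - x))" by (simp add: omega_inverse)
    then have "L\<^sup>2 \<le> base * (x * (L - x)) / touch"
      using touch_gt_1 by (subst pos_le_divide_eq) (simp_all add: mult.commute)
    also have "\<dots> = x * ((L - x) / touch) * base" by simp
    also have "L - x = real v - real p" using L by (simp add: x_def)
    finally show ?thesis by (simp only: x_def)
  qed
  have b: "1 < base" using sqrt5_bounds by simp
  have "2 * log base L = log base (L\<^sup>2)" using L0 by (simp add: log_nat_power)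
  also have "\<dots> \<le> log base ((real p - real u) * ((real v - real p) / touch) * base)"
    using prod L0 p touch_gt_1 b by (subst log_le_cancel_iff) auto
  also have "\<dots> = log base (real p - real u) + log base ((real v - real p) / touch) + 1"
  proof -
    have "0 < real p - real u" "0 < (real v - real p) / touch" "0 < base" "base \<noteq> 1"
      using p touch_gt_1 b by simp_all
    then show ?thesis
      using log_mult_pos[of "(real p - real u) * ((real v - real p) / touch)" base base]
        log_mult_pos[of "real p - real u" "(real v - real p) / touch" base] log_eq_one[of base]
        mult_pos_pos[of "real p - real u" "(real v - real p) / touch"]
      by linarith
  qed
  finally have "2 * log base L \<le> log base (real p - real u) + log base ((real v - real p) / touch) + 1" .
  moreover have "real ?n2 = 1 + real (other_runs (Node X Y) S u)" using acc3 by simp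
  moreover have "real (other_runs (Node X Y) S u) \<le> real (other_runs Z S u) + real (other_runs Y ?S p) + real ?n1"
    using acc1 acc2 by linarith
  ultimately have "log base L + other_runs (Node X Y) S u \<le> (?c + ?d + ?n1 + ?n2) / 2"
    by (simp add: loss_def)
  then have "LB (Node X Y) S (log base L + other_runs (Node X Y) S u)"
    by (rule LB_mono[OF LB])
  with fl show False by (simp add: fails_def)
qed

lemma bounded_Node:
  assumes ov: "over (Node B C)" and b: "\<And>D. D \<in> subtrees B \<union> subtrees C \<Longrightarrow> bounded D"
  shows "bounded (Node B C)"
  unfolding bounded_def
proof (intro allI impI, rule ccontr)
  fix S u v lf rf
  assume S: "S \<subseteq> {..k}" and W: "window (edge_set (Node B C)) S u v lf rf"
    and n: "\<not> LB (Node B C) S (log base ((real v - real u) / loss lf rf) + other_runs (Node B C) S u)"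
  define L where "L = (real v - real u) / loss lf rf"
  have fl: "fails (Node B C) S u L" using n by (simp add: fails_def L_def)
  have uv: "u < v" "{u..<v} \<subseteq> edge_set (Node B C)" using W by (auto simp: window_def)
  have L0: "0 < L" using uv loss_pos by (simp add: L_def)
  have ov': "over (Node C B)" using ov by auto
  have E: "edge_set (Node C B) = edge_set (Node B C)" by auto
  have fl': "fails (Node C B) S u L" by (rule fails_commute[OF fl])
  interpret B: failing_node k LB B C S u v lf rf L
    by unfold_locales (use ov S b fl W L0 in auto)
  interpret C: failing_node k LB C B S u v lf rf L
    by unfold_locales (use ov' S b fl' W L0 E in auto)
  consider "lf" "rf" | "lf" "\<not> rf" | "\<not> lf" "rf" | "\<not> lf" "\<not> rf" by blast
  then show False
  proof cases
    case 1
    have L: "L = real v - real u" using 1 by (simp add: L_def loss_def)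
    have W': "window (edge_set (Node B C)) S u v True True" using W 1 by simp
    have "u \<in> edge_set B \<or> u \<in> edge_set C" using uv by auto
    then show False
    proof
      assume "u \<in> edge_set B"
      from split_run_contradiction[OF ov S b b fl W' L this] show False by simp_all
    next
      assume "u \<in> edge_set C"
      from split_run_contradiction[OF ov' S b b fl' W'[folded E] L this] show False by simp_all
    qed
  next
    case 2
    have "L = (real v - real u) / touch" using 2 by (simp add: L_def loss_def)
    with 2 have "u \<notin> edge_set B" "u \<notin> edge_set C"
      using B.no_left_edge_one_side C.no_left_edge_one_side by auto
    with uv show False by auto
  next
    case 3
    have "L = (real v - real u) / touch" using 3 by (simp add: L_def loss_def)
    with 3 have "v - 1 \<notin> edge_set B" "v - 1 \<notin> edge_set C"
      using B.no_right_edge_one_side C.no_right_edge_one_side by auto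
    moreover have "v - 1 \<in> {u..<v}" using uv by auto
    ultimately show False using uv(2) by auto
  next
    case 4
    have L: "L = (real v - real u) / (2 * touch)" using 4 by (simp add: L_def loss_def)
    \<comment> \<open>The middle edge: including the edge itself, its distance to either end is at
      least half the window, so neither child can contain it.\<close>
    define x where "x = u + (v - u) div 2"
    have x: "u \<le> x" "x < v" using uv by (auto simp: x_def)
    then have "x \<in> {u..<v}" by simp
    then have "x \<in> edge_set B \<or> x \<in> edge_set C" using uv(2) by auto
    then have "real (Suc x) - real u < (real v - real u) / 2 \<or> real v - real x < (real v - real u) / 2"
      using B.near_an_end[OF 4 L _ x] C.near_an_end[OF 4 L _ x] by blast
    moreover have "v - u \<le> 2 * (Suc x - u)" "2 * (x - u) \<le> v - u" by (auto simp: x_def)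
    then have "real (v - u) \<le> 2 * real (Suc x - u)" "2 * real (x - u) \<le> real (v - u)" by linarith+
    then have "real v - real u \<le> 2 * (real (Suc x) - real u)" "2 * (real x - real u) \<le> real v - real u"
      using x uv by (simp_all add: of_nat_diff)
    ultimately show False by (auto simp: field_simps)
  qed
qed

text \<open>All subtrees are treated at once, because the mean rule uses the bound of a subtree that
  may lie far below the children.\<close>

lemma bounded_subtrees:
  "over A \<Longrightarrow> D \<in> subtrees A \<Longrightarrow> bounded D"
proof (induction A arbitrary: D)
  case (Leaf l)
  have "bounded (Leaf l)" unfolding bounded_def
  proof (intro allI impI)
    fix S u v lf rf
    assume S: "S \<subseteq> {..k}" and W: "window (edge_set (Leaf l)) S u v lf rf"
    have le: "x = u" if "x \<in> edge_set (Leaf l)" for x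
    proof -
      have "u \<in> edge_set (Leaf l)" using W by (auto simp: window_def)
      then have "{x, Suc x} = {u, Suc u}" using that by (cases l) (auto simp: edge_set_def)
      then show ?thesis by (auto simp: doubleton_eq_iff)
    qed
    have "v = Suc u"
    proof (rule ccontr)
      assume "v \<noteq> Suc u"
      then have "Suc u \<in> {u..<v}" using W by (auto simp: window_def)
      then have "Suc u \<in> edge_set (Leaf l)" using W by (auto simp: window_def)
      from le[OF this] show False by simp
    qed
    have "u \<in> edge_set (Leaf l)" using W by (auto simp: window_def)
    then have E: "edge_set (Leaf l) = {u}" using le by blast
    then have "run_end (edge_set (Leaf l)) u = Suc u" by (intro run_end_eqI) auto
    moreover have "free_runs {u} S \<subseteq> {Suc u}"
    proof
      fix b assume "b \<in> free_runs {u} S"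
      then have "0 < b" "b - 1 = u" by (auto simp: free_runs_def)
      then show "b \<in> {Suc u}" by simp
    qed
    ultimately have "free_runs (edge_set (Leaf l)) S - {run_end (edge_set (Leaf l)) u} = {}"
      using E by auto
    then have o: "other_runs (Leaf l) S u = 0" by (simp only: other_runs_def card.empty)
    have "1 \<le> loss lf rf" using touch_gt_1 by (auto simp: loss_def)
    \<comment> \<open>The window is a single edge and the loss is at least 1, so the trivial bound 0
      suffices.\<close>
    then have "log base ((real v - real u) / loss lf rf) \<le> 0"
      using \<open>v = Suc u\<close> sqrt5_bounds by (subst log_le_zero_cancel_iff) auto
    then show "LB (Leaf l) S (log base ((real v - real u) / loss lf rf) + other_runs (Leaf l) S u)"
      using o by (intro LB_mono[OF LB_Leaf[OF Leaf.prems(1)]]) simp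
  qed
  then show ?case using Leaf.prems by simp
next
  case (Node B C)
  then have b: "\<And>D. D \<in> subtrees B \<union> subtrees C \<Longrightarrow> bounded D" by auto
  then show ?case using bounded_Node[OF Node.prems(1) b] Node.prems(2) by auto
qed

lemma LB_path:
  assumes ov: "over A" and E: "edge_set A = {..<k}" and k: "1 \<le> k"
  shows "LB A {} (max 0 (log base k - 1))"
proof -
  \<comment> \<open>Vertex 0 counts as touched, and false flags promise nothing; the resulting loss
    \<open>2 * touch\<close> is below \<open>base\<close> and is absorbed by the subtracted
    1.\<close>
  have "window (edge_set A) {} 0 k False False" unfolding window_def E using k by (simp add: lessThan_atLeast0)
  from boundedD[OF bounded_subtrees[OF ov subtrees_refl] empty_subsetI this]
  have LB: "LB A {} (log base (real k / (2 * touch)) + other_runs A {} 0)"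
    unfolding loss_def by simp
  have b: "1 < base" using sqrt5_bounds by simp
  have "log base k - 1 = log base (real k / base)"
  proof -
    have "0 < real k" using k by simp
    moreover have "0 < base" "base \<noteq> 1" using b by linarith+
    ultimately show ?thesis
      using log_divide_pos[of "real k" base base] log_eq_one[of base] by linarith
  qed
  also have "\<dots> \<le> log base (real k / (2 * touch))"
  proof -
    have "2 * touch \<le> base" using sqrt5_bounds by (simp add: touch_def)
    then have "real k / base \<le> real k / (2 * touch)"
      using touch_gt_1 b by (intro divide_left_mono) simp_all
    moreover have "0 < real k / base" "0 < real k / (2 * touch)"
      using k b touch_gt_1 by (auto intro!: divide_pos_pos)
    ultimately show ?thesis using log_le_cancel_iff[OF b] by blast
  qed
  finally have "log base k - 1 \<le> log base (real k / (2 * touch)) + other_runs A {} 0"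
    by linarith
  then have "LB A {} (log base k - 1)" by (rule LB_mono[OF LB])
  moreover have "LB A {} 0" by (rule LB_zero[OF ov]) simp
  ultimately show ?thesis unfolding max_def by (cases "0 \<le> log base k - 1") simp_all
qed

end

section \<open>The threshold weighting of the path\<close>

definition path_weight :: "nat set \<Rightarrow> real" where
  "path_weight e = (if e = {0, 1} then 2 else 1)"

abbreviation edge :: "nat \<Rightarrow> nat set" where "edge i \<equiv> {i, Suc i}"

lemma inj_edge: "inj edge"
  by (auto simp: inj_def doubleton_eq_iff)

lemma Union_edges: "\<Union> (edge ` X) = run_verts X"
  by (auto simp: run_verts_def)

lemma run_end_0_end: "finite X \<Longrightarrow> 0 \<in> X \<Longrightarrow> run_end X 0 \<in> Suc ` X - X"
proof -
  assume fin: "finite X" and "0 \<in> X"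
  then have gt: "0 < run_end X 0" by (rule run_end_gt)
  then have "run_end X 0 - 1 \<in> {0..<run_end X 0}" by auto
  then have "run_end X 0 - 1 \<in> X" using run_end(3)[OF fin] by blast
  then show ?thesis
    using gt run_end(2)[OF fin] by (intro DiffI image_eqI[of _ _ "run_end X 0 - 1"]) auto
qed

text \<open>Successors of edges of X that are not themselves edges of X are the right ends of runs,
  one per component. A component has one vertex more than edges, and the heavy edge takes one unit
  away.\<close>

lemma Delta_path_weight:
  assumes fin: "finite X" and F: "verts F = run_verts X" "edges F = edge ` X"
  shows "Delta path_weight F = real (card (Suc ` X - X)) - (if 0 \<in> X then 1 else 0)"
proof -
  have "card (X \<union> Suc ` X) = card X + card (Suc ` X - X)"
    using card_Un_disjoint[of X "Suc ` X - X"] fin by (simp add: Un_Diff_cancel)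
  then have v: "real (card (verts F)) = real (card X) + real (card (Suc ` X - X))"
    by (simp add: F run_verts_def)
  have w: "path_weight (edge i) = 1 + (if i = 0 then 1 else 0)" for i
    by (auto simp: path_weight_def doubleton_eq_iff)
  have "(\<Sum>e\<in>edges F. path_weight e) = (\<Sum>i\<in>X. path_weight (edge i))"
    unfolding F(2) using sum.reindex[OF inj_on_subset[OF inj_edge, of X], of path_weight]
    by (simp add: comp_def)
  also have "\<dots> = real (card X) + (if 0 \<in> X then 1 else 0)"
    unfolding w sum.distrib using fin by simp
  finally show ?thesis using v by (simp add: Delta_def)
qed

lemma edges_path_graph: "edges (path_graph k) = edge ` {..<k}"
proof -
  have "{f i |i. i < k} = f ` {..<k}" for f :: "nat \<Rightarrow> nat set" by auto
  then show ?thesis by (simp add: path_graph_def)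
qed

lemma verts_path_graph: "1 \<le> k \<Longrightarrow> verts (path_graph k) = run_verts {..<k}"
proof -
  assume "1 \<le> k"
  then have "x \<in> run_verts {..<k} \<longleftrightarrow> x \<le> k" for x
    by (cases x) (simp_all add: in_run_verts, arith)
  then show ?thesis by (simp add: path_graph_def set_eq_iff)
qed

lemma threshold_weighting_path:
  assumes "1 \<le> k"
  shows "threshold_weighting (path_graph k) path_weight"
proof -
  have "0 \<le> Delta path_weight F" if F: "subgraph F (path_graph k)" for F
  proof -
    define X where "X = {i. edge i \<in> edges F}"
    have "edges F \<subseteq> {edge i |i. i < k}" using F by (simp add: subgraph_def path_graph_def)
    then have e: "edges F = edge ` X" unfolding X_def by blast
    have v: "verts F = run_verts X" using F e Union_edges by (simp add: subgraph_def)
    have fin: "finite X"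
    proof (rule finite_subset)
      show "X \<subseteq> verts F" by (auto simp: v run_verts_def)
      have "verts F \<subseteq> {0..k}" using F unfolding subgraph_def path_graph_def ugraph.simps by blast
      then show "finite (verts F)" by (rule finite_subset) simp
    qed
    \<comment> \<open>If the heavy edge is present, its own component supplies the unit that pays
      for it.\<close>
    have "1 \<le> card (Suc ` X - X)" if "0 \<in> X"
      using run_end_0_end[OF fin that] fin by (auto simp: Suc_le_eq card_gt_0_iff)
    then show ?thesis by (auto simp: Delta_path_weight[OF fin v e])
  qed
  moreover have "Delta path_weight (path_graph k) = 0"
  proof -
    have "Suc ` {..<k} - {..<k} = {k}"
      using assms by (cases k) (simp_all add: image_Suc_lessThan atLeastAtMost_insertL lessThan_Suc_atMost, auto)
    then have "real (card (Suc ` {..<k} - {..<k})) = 1" by simp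
    moreover have "0 \<in> {..<k}" using assms by simp
    ultimately show ?thesis
      using Delta_path_weight[OF _ verts_path_graph[OF assms] edges_path_graph] by simp
  qed
  moreover have "0 \<le> path_weight e \<and> path_weight e \<le> 2" for e by (simp add: path_weight_def)
  ultimately show ?thesis by (simp add: threshold_weighting_def)
qed

text \<open>On a path every edge between two vertices separates them, so a walk from u to w uses
  each of these edges.\<close>

lemma adj_closure_edges:
  assumes "(u, w) \<in> (adj F)\<^sup>*" and F: "edges F = edge ` X"
  shows "u \<le> y \<and> y < w \<or> w \<le> y \<and> y < u \<Longrightarrow> y \<in> X"
  using assms(1)
proof (induction arbitrary: y rule: rtrancl_induct)
  case (step w w')
  then obtain j where j: "j \<in> X" "{w, w'} = {j, Suc j}" by (auto simp: adj_def F)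
  then consider "w = j" "w' = Suc j" | "w = Suc j" "w' = j" by (auto simp: doubleton_eq_iff)
  then show ?case
  proof cases
    case 1
    then have "y = j \<or> (u \<le> y \<and> y < w \<or> w \<le> y \<and> y < u)" using step.prems by auto
    then show ?thesis using j step.IH by blast
  next
    case 2
    then have "y = j \<or> (u \<le> y \<and> y < w \<or> w \<le> y \<and> y < u)" using step.prems by auto
    then show ?thesis using j step.IH by blast
  qed
qed auto

lemma adj_closure_interval:
  assumes "edges F = edge ` X" "u \<le> w" "{u..<w} \<subseteq> X"
  shows "(u, w) \<in> (adj F)\<^sup>*"
  using assms(2,3)
proof (induction w rule: dec_induct)
  case (step w)
  have "(w, Suc w) \<in> adj F" using step assms(1) by (auto simp: adj_def)
  moreover have "{u..<w} \<subseteq> X" using step.prems by auto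
  ultimately show ?case using step.IH by (meson rtrancl.rtrancl_into_rtrancl)
qed simp

text \<open>A free run survives in \<open>ominus F T\<close> and contributes its right end. If the
  heavy edge survives too, its component is not a free run, since free runs are separated from
  vertex 0; its right end pays for the extra weight.\<close>

lemma card_free_runs_le_Delta:
  assumes fin: "finite X" and v: "verts F = run_verts X" and e: "edges F = edge ` X"
  shows "real (card (free_runs X T)) \<le> Delta path_weight (ominus F T)"
proof -
  define C where "C v = {w \<in> verts F. (v, w) \<in> (adj F)\<^sup>*}" for v
  define W where "W = {v \<in> verts F. C v \<inter> T = {}}"
  have oe: "edges (ominus F T) = {d \<in> edges F. \<exists>v\<in>W. d \<subseteq> C v}"
    unfolding ominus_def components_def component_def Let_def W_def C_def by auto blast
  have ov: "verts (ominus F T) = (\<Union>v\<in>W. C v)"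
    unfolding ominus_def components_def component_def Let_def W_def C_def by auto blast
  \<comment> \<open>The surviving edges in code; once the surviving vertices are shown to be theirs,
    \<open>Delta_path_weight\<close> applies again.\<close>
  define Y where "Y = {i \<in> X. \<exists>v\<in>W. edge i \<subseteq> C v}"
  have Ye: "edges (ominus F T) = edge ` Y" by (auto simp: oe e Y_def)
  have closed: "w' \<in> C v" if "w \<in> C v" "(w, w') \<in> (adj F)\<^sup>*" "w' \<in> verts F" for v w w'
    using that by (auto simp: C_def)
  have Yv: "verts (ominus F T) = run_verts Y"
  proof
    show "run_verts Y \<subseteq> verts (ominus F T)"
      unfolding Union_edges[symmetric] by (auto simp: ov Y_def)
    show "verts (ominus F T) \<subseteq> run_verts Y"
    proof
      fix w assume "w \<in> verts (ominus F T)"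
      then obtain a where a: "a \<in> W" "w \<in> C a" by (auto simp: ov)
      then have "w \<in> run_verts X" by (simp add: C_def v)
      then obtain i where i: "i \<in> X" "w \<in> edge i" by (auto simp: run_verts_def)
      have "(x, y) \<in> (adj F)\<^sup>*" if "x \<in> edge i" "y \<in> edge i" for x y
      proof (cases "x = y")
        case False
        then have "{x, y} = edge i" using that by auto
        then show ?thesis using i(1) by (auto simp: adj_def e)
      qed simp
      moreover have "edge i \<subseteq> verts F" using i(1) by (auto simp: v run_verts_def)
      ultimately have "y \<in> C a" if "y \<in> edge i" for y
        using closed[OF a(2), of y] i(2) that by blast
      then have "edge i \<subseteq> C a" by blast
      then have "i \<in> Y" using a i by (auto simp: Y_def)
      then show "w \<in> run_verts Y" using i(2) by (auto simp: run_verts_def)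
    qed
  qed
  have finY: "finite Y" using fin by (simp add: Y_def)
  have free: "free_runs X T \<subseteq> Suc ` Y - Y"
  proof
    fix b assume b: "b \<in> free_runs X T"
    define i where "i = b - 1"
    have i: "b = Suc i" "i \<in> X" "b \<notin> X" using b by (auto simp: free_runs_def i_def)
    have iv: "edge i \<subseteq> verts F" using i by (auto simp: v run_verts_def)
    have sub: "edge i \<subseteq> C i"
    proof -
      have "(i, Suc i) \<in> (adj F)\<^sup>*" by (rule adj_closure_interval[OF e]) (use i in auto)
      then show ?thesis using iv by (auto simp: C_def)
    qed
    have "s \<notin> C i" if s: "s \<in> T" for s
    proof
      assume "s \<in> C i"
      then have r: "(i, s) \<in> (adj F)\<^sup>*" by (simp add: C_def)
      show False
      proof (cases "s \<le> b")
        case True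
        then have "\<exists>y\<in>{s..<b}. y \<notin> X" using b s unfolding free_runs_def by blast
        then obtain y where y: "s \<le> y" "y < b" "y \<notin> X" by auto
        then have "y < i" using i by (cases "y = i") auto
        then show False using adj_closure_edges[OF r e, of y] y by auto
      next
        case False
        then show False using adj_closure_edges[OF r e, of b] i by auto
      qed
    qed
    then have "i \<in> W" using iv by (auto simp: W_def)
    then have "i \<in> Y" using i sub by (auto simp: Y_def)
    then show "b \<in> Suc ` Y - Y" using i by (auto simp: Y_def)
  qed
  have "card (free_runs X T) + (if 0 \<in> Y then 1 else 0) \<le> card (Suc ` Y - Y)"
  proof (cases "0 \<in> Y")
    case True
    then obtain a where a: "a \<in> W" "0 \<in> C a" and "0 \<in> X" by (auto simp: Y_def)
    let ?b = "run_end X 0"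
    have b: "0 < ?b" "?b \<notin> X" "{0..<?b} \<subseteq> X"
      using run_end_gt[OF fin \<open>0 \<in> X\<close>] run_end[OF fin] by auto
    have b1: "?b - 1 \<in> X" using b by auto
    have reach: "(0, y) \<in> (adj F)\<^sup>*" if "y \<le> ?b" for y
      by (rule adj_closure_interval[OF e]) (use that b(3) in auto)
    have "?b \<in> C a" "?b - 1 \<in> C a"
      using b1 run_end_0_end[OF fin \<open>0 \<in> X\<close>]
      by (intro closed[OF a(2) reach]; simp add: v run_verts_def)+
    then have "edge (?b - 1) \<subseteq> C a" using b(1) by simp
    then have "?b - 1 \<in> Y" using b1 a(1) by (auto simp: Y_def)
    then have "?b \<in> Suc ` Y" using b(1) by (intro image_eqI[of _ _ "?b - 1"]) simp_all
    then have "?b \<in> Suc ` Y - Y" using b(2) by (simp add: Y_def)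
    moreover have "?b \<notin> free_runs X T" using b by (auto simp: free_runs_def)
    ultimately have "insert ?b (free_runs X T) \<subseteq> Suc ` Y - Y" "?b \<notin> free_runs X T" using free by auto
    then have "card (insert ?b (free_runs X T)) \<le> card (Suc ` Y - Y)"
      using finY by (intro card_mono) auto
    then show ?thesis
      using True \<open>?b \<notin> free_runs X T\<close> finite_free_runs[OF fin] by simp
  next
    case False
    then show ?thesis using card_mono[OF _ free] finY by simp
  qed
  then have "real (card (free_runs X T)) + (if 0 \<in> Y then 1 else 0) \<le> real (card (Suc ` Y - Y))"
    by (cases "0 \<in> Y") simp_all
  then show ?thesis using Delta_path_weight[OF finY Yv Ye] by simp
qed

lemma labels_over_path:
  assumes "labels A \<subseteq> edges (path_graph k)"
  shows "labels A = edge ` edge_set A" "\<Union> (labels A) = run_verts (edge_set A)" "finite (edge_set A)"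
proof -
  show l: "labels A = edge ` edge_set A"
    using assms unfolding edges_path_graph edge_set_def by blast
  show "\<Union> (labels A) = run_verts (edge_set A)"
    unfolding l by (rule Union_edges)
  have "edge_set A \<subseteq> {..<k}"
  proof
    fix i assume "i \<in> edge_set A"
    then obtain j where "j < k" "edge i = edge j" using assms by (auto simp: edge_set_def edges_path_graph)
    then show "i \<in> {..<k}" using inj_edge by (auto simp: inj_def)
  qed
  then show "finite (edge_set A)" using finite_subset by blast
qed

lemma path_lower_bounds:
  assumes "0 < n"
  shows "path_bounds k (pathsets.lower_bound (path_graph k) path_weight n)"
proof -
  interpret pathsets "path_graph k" path_weight n
    by unfold_locales (use assms fin_simple_graph_path_graph in \<open>auto simp: path_weight_def\<close>)
  have dl: "real (card (free_runs (edge_set A) T)) \<le> dl A T" if "labels A \<subseteq> edges (path_graph k)" for A T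
    by (rule card_free_runs_le_Delta) (use labels_over_path[OF that] in simp_all)
  have V: "V A = run_verts (edge_set A)" if "labels A \<subseteq> edges (path_graph k)" for A
    using labels_over_path(2)[OF that] .
  have vp: "S \<subseteq> verts (path_graph k)" if "S \<subseteq> {..k}" for S
    using that by (auto simp: path_graph_def)
  show ?thesis
  proof
    fix A :: "nat set join_tree" and S and c d :: real
    show "lower_bound A S c \<Longrightarrow> d \<le> c \<Longrightarrow> lower_bound A S d" by (rule lower_bound_mono)
  next
    fix l S
    show "labels (Leaf l) \<subseteq> edges (path_graph k) \<Longrightarrow> lower_bound (Leaf l) S 0"
      by (rule lower_bound_Leaf)
  next
    fix B C :: "nat set join_tree" and S c
    show "lower_bound (Node B C) S c \<Longrightarrow> lower_bound (Node C B) S c" by (rule lower_bound_commute)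
  next
    fix B C :: "nat set join_tree" and S c
    assume b: "lower_bound B S c" and l: "labels (Node B C) \<subseteq> edges (path_graph k)" and S: "S \<subseteq> {..k}"
    have lB: "labels B \<subseteq> edges (path_graph k)" "labels C \<subseteq> edges (path_graph k)" using l by auto
    show "lower_bound (Node B C) S (c + card (free_runs (edge_set C) (S \<union> run_verts (edge_set B))))"
      using lower_bound_add_sibling[OF b l vp[OF S]] unfolding V[OF lB(1)]
      by (rule lower_bound_mono) (use dl[OF lB(2)] in simp)
  next
    fix B C :: "nat set join_tree" and S c
    assume b: "lower_bound B (S \<union> run_verts (edge_set C)) c"
      and l: "labels (Node B C) \<subseteq> edges (path_graph k)" and S: "S \<subseteq> {..k}"
    have lB: "labels B \<subseteq> edges (path_graph k)" "labels C \<subseteq> edges (path_graph k)" using l by auto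
    show "lower_bound (Node B C) S (c + card (free_runs (edge_set C) S))"
      using lower_bound_given_sibling[OF b[folded V[OF lB(2)]] l vp[OF S]]
      by (rule lower_bound_mono) (use dl[OF lB(2)] in simp)
  next
    fix B C D :: "nat set join_tree" and S c d
    assume D: "D \<in> subtrees B" and Db: "lower_bound D S c"
      and Cb: "lower_bound C (S \<union> run_verts (edge_set D)) d"
      and l: "labels (Node B C) \<subseteq> edges (path_graph k)" and S: "S \<subseteq> {..k}"
    have lB: "labels B \<subseteq> edges (path_graph k)" "labels C \<subseteq> edges (path_graph k)" using l by auto
    have lD: "labels D \<subseteq> edges (path_graph k)" using labels_subtree[OF D] lB by auto
    show "lower_bound (Node B C) S ((c + d
        + card (free_runs (edge_set (Node B C)) (S \<union> run_verts (edge_set D) \<union> run_verts (edge_set C)))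
        + card (free_runs (edge_set (Node B C)) S)) / 2)"
    proof (rule lower_bound_mono)
      show "lower_bound (Node B C) S
        ((c + d + dl (Node B C) (S \<union> run_verts (edge_set D) \<union> run_verts (edge_set C)) + dl (Node B C) S) / 2)"
        using lower_bound_mean[OF D Db Cb[folded V[OF lD]] l vp[OF S]]
        unfolding V[OF lD] V[OF lB(2)] .
    qed (use dl[OF l, of "S \<union> run_verts (edge_set D) \<union> run_verts (edge_set C)"] dl[OF l, of S] in simp)
  qed
qed

text \<open>Without a join-tree whose graph is G, the condition in \<open>tau\<close> would be
  vacuous and hold for all t.\<close>

lemma ex_join_tree:
  assumes "finite E"
  shows "\<exists>A. labels A = E"
  using assms
proof induction
  case empty
  have "labels (Leaf None :: 'a join_tree) = {}" by simp
  then show ?case by blast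
next
  case (insert x E)
  then obtain A where "labels A = E" by blast
  then have "labels (Node (Leaf (Some x)) A) = insert x E" by simp
  then show ?case by blast
qed

lemma Union_edges_path_graph: "1 \<le> k \<Longrightarrow> \<Union> (edges (path_graph k)) = verts (path_graph k)"
  by (simp only: verts_path_graph edges_path_graph Union_edges)

theorem theorem1p11:
  fixes k :: nat
  assumes "k \<ge> 1"
  shows "tau (path_graph k) \<ge> log (sqrt 5 + 5) (real k) - 1"
proof -
  let ?G = "path_graph k"
  let ?P = "\<lambda>t \<theta>. threshold_weighting ?G \<theta> \<and>
     (\<forall>A n R. join_tree_over ?G A \<and> tree_graph A = ?G \<and> 0 < n \<and> R \<subseteq> tuples n (verts ?G) \<longrightarrow>
        real (chi ?G \<theta> n {} A R) \<ge> real n powr t * rel_density n (verts ?G) R)"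
  let ?M = "{t. 0 \<le> t \<and> (\<exists>\<theta>. ?P t \<theta>)}"
  \<comment> \<open>\<open>tau\<close> admits only nonnegative exponents, and the logarithmic
    expression is negative for small k.\<close>
  let ?t = "max 0 (log base (real k) - 1)"
  have "?P ?t path_weight"
  proof (intro conjI allI impI threshold_weighting_path[OF assms])
    fix A n R
    assume "join_tree_over ?G A \<and> tree_graph A = ?G \<and> 0 < n \<and> R \<subseteq> tuples n (verts ?G)"
    then have l: "labels A \<subseteq> edges ?G" and t: "tree_graph A = ?G" and n: "0 < n"
      and R: "R \<subseteq> tuples n (verts ?G)"
      unfolding join_tree_over_def by blast+
    interpret pathsets ?G path_weight n
      by unfold_locales (use n fin_simple_graph_path_graph in \<open>auto simp: path_weight_def\<close>)
    have E: "labels A = edges ?G" and Vt: "V A = verts ?G"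
      using tree_graph_simps[of A] unfolding t by simp_all
    have "edge_set A = {..<k}"
    proof -
      have "edge ` edge_set A = edge ` {..<k}"
        using labels_over_path(1)[OF l] E edges_path_graph by simp
      then show ?thesis by (rule inj_image_eq_iff[OF inj_edge, THEN iffD1])
    qed
    then have "lower_bound A {} ?t"
      by (rule path_bounds.LB_path[OF path_lower_bounds[OF n] l _ assms])
    from lower_boundD[OF this, of R, unfolded Vt Diff_empty, OF R]
    show "real (chi ?G path_weight n {} A R) \<ge> real n powr ?t * rel_density n (verts ?G) R" .
  qed
  then have "?t \<in> ?M" by (intro CollectI conjI exI[of _ path_weight]) simp_all
  \<comment> \<open>The supremum needs an upper bound: with n = 2 and the full relation, 2^t is at
    most the complexity, hence at most 2^|V(G)|.\<close>
  moreover have "bdd_above ?M"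
  proof (rule bdd_aboveI)
    fix t assume "t \<in> ?M"
    then obtain \<theta> where th: "threshold_weighting ?G \<theta>"
      and lb: "\<And>A n R. join_tree_over ?G A \<Longrightarrow> tree_graph A = ?G \<Longrightarrow> 0 < n \<Longrightarrow>
        R \<subseteq> tuples n (verts ?G) \<Longrightarrow>
        real n powr t * rel_density n (verts ?G) R \<le> real (chi ?G \<theta> n {} A R)"
      unfolding mem_Collect_eq by metis
    interpret pathsets ?G \<theta> 2
      by unfold_locales (use th fin_simple_graph_path_graph in \<open>auto simp: threshold_weighting_def\<close>)
    have "finite (edges ?G)" by (simp add: path_graph_def)
    then obtain A where A: "labels A = edges ?G" using ex_join_tree by blast
    then have tA: "tree_graph A = ?G" using Union_edges_path_graph[OF assms] by (simp add: tree_graph_def)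
    let ?R = "tuples 2 (verts ?G)"
    have cR: "card ?R = 2 ^ card (verts ?G)" by (rule card_tuples[OF finite_verts])
    then have "rel_density 2 (verts ?G) ?R = 1" unfolding rel_density_def by simp
    then have "2 powr t \<le> real (chi ?G \<theta> 2 {} A ?R)"
      using lb[of A 2 ?R] tA A by (simp add: join_tree_over_def del: PiE_iff)
    also have "\<dots> \<le> real (card ?R)"
    proof -
      have "V A = verts ?G" using A Union_edges_path_graph[OF assms] by simp
      then show ?thesis
        using chi_le_card[of A ?R "{}", unfolded Diff_empty] A by (simp only: of_nat_le_iff subset_refl)
    qed
    also have "\<dots> = 2 powr real (card (verts ?G))" unfolding cR by (simp add: powr_realpow)
    finally show "t \<le> real (card (verts ?G))" by simp
  qed
  ultimately have "?t \<le> tau ?G" unfolding tau_def by (rule cSup_upper)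
  then show ?thesis by simp
qed

end
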